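(* Let $n\ge 1$, $p>1$, let $U\subset\mathbb{R}^n$ be a smooth bounded domain, and let $v_0\in H_0^1(U)$. Assume $I(v_0)\ge 0$ and $J(v_0)\le d$. Then there exists a global weak solution $v$ to the problem $$v_t-\Delta v_t-\Delta v=v|v|^{p-1}\log|v| \ \text{ in } U\times\mathbb{R}^+,\qquad v=0 \ \text{ on } \partial U\times\mathbb{R}^+,\qquad v(\cdot,0)=v_0 \ \text{ in } U,$$ with $v\in L^\infty(0,\infty;H_0^1(U))$ and $v_t\in L^\infty(0,\infty;L^2(U))$.
   Context: Notation: $\|g\|_q=(\int_U|g|^q\,dx)^{1/q}$ for $1\le q<\infty$, $\|\cdot\|=\|\cdot\|_2$, $(h,g)_2=\int_U hg\,dx$ (for vector fields, $(\nabla h,\nabla g)_2=\int_U\nabla h\cdot\nabla g\,dx$), and $\|v\|_{H_0^1(U)}^2=\|v\|^2+\|\nabla v\|^2$. The expressions $|s|^{p+1}\log|s|$ and $s|s|^{p-1}\log|s|$ are taken to be $0$ at $s=0$. Functionals on $H_0^1(U)$: $$J(v)=\tfrac12\|\nabla v\|^2-\tfrac1{1+p}\int_U|v|^{1+p}\log|v|\,dx+\tfrac1{(1+p)^2}\|v\|_{1+p}^{1+p},\qquad I(v)=\|\nabla v\|^2-\int_U|v|^{1+p}\log|v|\,dx.$$ Nehari manifold: $\mathcal N=\{v\in H_0^1(U): I(v)=0,\ \|\nabla v\|^2\neq0\}$. Depth of the well: $d=\inf_{v\in\mathcal N}J(v)$. Weak solution on $(0,T)$: a function $v\in L^\infty((0,T);H_0^1(U))$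 with $v_t\in L^2((0,T);L^2(U))$ and $v(x,0)=v_0(x)$, satisfying, for all $w\in H_0^1(U)$ and $t\in(0,T)$, $$(v_t,w)_2+(\nabla v_t,\nabla w)_2+(\nabla v,\nabla w)_2=(v|v|^{p-1}\log|v|,w)_2.$$ A global weak solution is a weak solution that exists for all $t>0$, i.e. whose maximal existence time is $T=\infty$. *)

theory Defs
  imports "HOL-Analysis.Analysis"
begin

section \<open>Smooth functions, smooth bounded domains, test functions\<close>

primrec Ck_on :: "nat \<Rightarrow> 'a::euclidean_space set \<Rightarrow> ('a \<Rightarrow> real) \<Rightarrow> bool" where
  "Ck_on 0 S f \<longleftrightarrow> continuous_on S f"
| "Ck_on (Suc k) S f \<longleftrightarrow>
     (\<exists>f'. (\<forall>x\<in>S. (f has_derivative f' x) (at x)) \<and> (\<forall>b\<in>Basis. Ck_on k S (\<lambda>x. f' x b)))"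

definition smooth :: "('a::euclidean_space \<Rightarrow> real) \<Rightarrow> bool" where
  "smooth f \<longleftrightarrow> (\<forall>k. Ck_on k UNIV f)"

text \<open>
  Smooth boundary: near each boundary point, \<open>U\<close> is the strict epigraph, in some direction \<open>e\<close>,
  of a smooth function of the variables orthogonal to \<open>e\<close>.  Such a function is represented by a
  function on the whole space that is constant along \<open>e\<close>; in dimension one it is a constant.
\<close>
definition smooth_boundary :: "'a::euclidean_space set \<Rightarrow> bool" where
  "smooth_boundary U \<longleftrightarrow>
     (\<forall>x0\<in>frontier U. \<exists>r>0. \<exists>e \<gamma>. norm e = 1 \<and> smooth \<gamma> \<and> (\<forall>x s. \<gamma> (x + s *\<^sub>R e) = \<gamma> x) \<and>
        U \<inter> ball x0 r = {x \<in> ball x0 r. x \<bullet> e > \<gamma> x})"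

definition smooth_bounded_domain :: "'a::euclidean_space set \<Rightarrow> bool" where
  "smooth_bounded_domain U \<longleftrightarrow>
     open U \<and> connected U \<and> U \<noteq> {} \<and> bounded U \<and> smooth_boundary U"

definition test_functions :: "'a::euclidean_space set \<Rightarrow> ('a \<Rightarrow> real) set" where
  "test_functions U =
     {\<phi>. smooth \<phi> \<and> compact (closure {x. \<phi> x \<noteq> 0}) \<and> closure {x. \<phi> x \<noteq> 0} \<subseteq> U}"


section \<open>Lebesgue and Sobolev spaces\<close>

text \<open>
  Elements of these spaces are represented by functions on the whole space; their values outside
  \<open>U\<close> are irrelevant, and no quotient by almost-everywhere equality is taken.  The codomain is
  a Euclidean space so that scalar functions and vector fields are treated alike.
\<close>
definition Lspace :: "'a::euclidean_space set \<Rightarrow> real \<Rightarrow> ('a \<Rightarrow> 'b::euclidean_space) set" where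
  "Lspace U q = {g. g \<in> borel_measurable (lebesgue_on U) \<and>
                    integrable (lebesgue_on U) (\<lambda>x. norm (g x) powr q)}"

definition Lnorm :: "'a::euclidean_space set \<Rightarrow> real \<Rightarrow> ('a \<Rightarrow> 'b::euclidean_space) \<Rightarrow> real" where
  "Lnorm U q g = (LINT x|lebesgue_on U. norm (g x) powr q) powr (1 / q)"

definition L2inner ::
  "'a::euclidean_space set \<Rightarrow> ('a \<Rightarrow> 'b::euclidean_space) \<Rightarrow> ('a \<Rightarrow> 'b) \<Rightarrow> real" where
  "L2inner U h g = (LINT x|lebesgue_on U. h x \<bullet> g x)"

definition locally_integrable ::
  "'a::euclidean_space set \<Rightarrow> ('a \<Rightarrow> 'b::euclidean_space) \<Rightarrow> bool" where
  "locally_integrable U g \<longleftrightarrow> (\<forall>K. compact K \<and> K \<subseteq> U \<longrightarrow> integrable (lebesgue_on K) g)"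

definition is_weak_gradient ::
  "'a::euclidean_space set \<Rightarrow> ('a \<Rightarrow> real) \<Rightarrow> ('a \<Rightarrow> 'a) \<Rightarrow> bool" where
  "is_weak_gradient U v g \<longleftrightarrow> locally_integrable U v \<and> locally_integrable U g \<and>
     (\<forall>\<phi>\<in>test_functions U. \<forall>b\<in>Basis.
        (LINT x|lebesgue_on U. v x * frechet_derivative \<phi> (at x) b) =
        - (LINT x|lebesgue_on U. (g x \<bullet> b) * \<phi> x))"

text \<open>A weak gradient is unique up to a null set of \<open>U\<close>, so the choice below is harmless.\<close>
definition wgrad :: "'a::euclidean_space set \<Rightarrow> ('a \<Rightarrow> real) \<Rightarrow> 'a \<Rightarrow> 'a" where
  "wgrad U v = (SOME g. is_weak_gradient U v g)"

definition H1 :: "'a::euclidean_space set \<Rightarrow> ('a \<Rightarrow> real) set" where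
  "H1 U = {v \<in> Lspace U 2. \<exists>g \<in> Lspace U 2. is_weak_gradient U v g}"

definition H1norm :: "'a::euclidean_space set \<Rightarrow> ('a \<Rightarrow> real) \<Rightarrow> real" where
  "H1norm U v = sqrt ((Lnorm U 2 v)\<^sup>2 + (Lnorm U 2 (wgrad U v))\<^sup>2)"

definition H01 :: "'a::euclidean_space set \<Rightarrow> ('a \<Rightarrow> real) set" where
  "H01 U = {v \<in> H1 U. \<exists>\<phi>. (\<forall>k::nat. \<phi> k \<in> test_functions U) \<and>
                         (\<lambda>k. H1norm U (\<lambda>x. \<phi> k x - v x)) \<longlonglongrightarrow> 0}"


section \<open>The functionals and the depth of the potential well\<close>

text \<open>
  Library conventions make the products \<open>\<bar>s\<bar> powr (1 + p) * ln \<bar>s\<bar>\<close> and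
  \<open>s * \<bar>s\<bar> powr (p - 1) * ln \<bar>s\<bar>\<close> vanish at \<open>s = 0\<close>.

  No upper bound on \<open>p\<close> is imposed, so for \<open>v\<close> in \<open>H01 U\<close> the logarithmic integral may
  diverge.  On a bounded \<open>U\<close> the negative part of its integrand is bounded, so it can only diverge
  to \<open>+\<infinity>\<close>; then \<open>I v = -\<infinity>\<close>, and \<open>J v = -\<infinity>\<close> as well, because the integrand
  \<open>\<bar>s\<bar> powr (1 + p) * (ln \<bar>s\<bar> / (1 + p) - 1 / (1 + p)\<^sup>2)\<close> entering \<open>J\<close> with a minus sign
  diverges likewise.  If the logarithmic integral is finite, so is the \<open>L\<close>-norm of exponent
  \<open>1 + p\<close>, and both functionals are given by the usual formulas.
\<close>
definition finite_energy :: "'a::euclidean_space set \<Rightarrow> real \<Rightarrow> ('a \<Rightarrow> real) \<Rightarrow> bool" where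
  "finite_energy U p v \<longleftrightarrow> integrable (lebesgue_on U) (\<lambda>x. \<bar>v x\<bar> powr (1 + p) * ln \<bar>v x\<bar>)"

definition J_fun :: "'a::euclidean_space set \<Rightarrow> real \<Rightarrow> ('a \<Rightarrow> real) \<Rightarrow> ereal" where
  "J_fun U p v =
     (if finite_energy U p v then
        ereal (1 / 2 * (Lnorm U 2 (wgrad U v))\<^sup>2
               - 1 / (1 + p) * (LINT x|lebesgue_on U. \<bar>v x\<bar> powr (1 + p) * ln \<bar>v x\<bar>)
               + 1 / (1 + p)\<^sup>2 * Lnorm U (1 + p) v powr (1 + p))
      else -\<infinity>)"

definition I_fun :: "'a::euclidean_space set \<Rightarrow> real \<Rightarrow> ('a \<Rightarrow> real) \<Rightarrow> ereal" where
  "I_fun U p v =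
     (if finite_energy U p v then
        ereal ((Lnorm U 2 (wgrad U v))\<^sup>2
               - (LINT x|lebesgue_on U. \<bar>v x\<bar> powr (1 + p) * ln \<bar>v x\<bar>))
      else -\<infinity>)"

definition nehari :: "'a::euclidean_space set \<Rightarrow> real \<Rightarrow> ('a \<Rightarrow> real) set" where
  "nehari U p = {v \<in> H01 U. I_fun U p v = 0 \<and> (Lnorm U 2 (wgrad U v))\<^sup>2 \<noteq> 0}"

definition well_depth :: "'a::euclidean_space set \<Rightarrow> real \<Rightarrow> ereal" where
  "well_depth U p = (INF v\<in>nehari U p. J_fun U p v)"


section \<open>Functions of time with values in a function space\<close>

text \<open>
  In this section \<open>X\<close> is a space of functions with (semi)norm \<open>N\<close>, and \<open>S\<close> a set of times.
  Strong measurability is almost-everywhere approximability by simple functions.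
\<close>
definition strongly_measurable_on ::
  "('a \<Rightarrow> real) set \<Rightarrow> (('a \<Rightarrow> real) \<Rightarrow> real) \<Rightarrow> real set \<Rightarrow> (real \<Rightarrow> 'a \<Rightarrow> real) \<Rightarrow> bool" where
  "strongly_measurable_on X N S v \<longleftrightarrow>
     (AE t in lebesgue_on S. v t \<in> X) \<and>
     (\<exists>s :: nat \<Rightarrow> real \<Rightarrow> 'a \<Rightarrow> real.
        (\<forall>k. finite (s k ` S) \<and> s k ` S \<subseteq> X \<and> (\<forall>y. {t \<in> S. s k t = y} \<in> sets lebesgue)) \<and>
        (AE t in lebesgue_on S. (\<lambda>k. N (\<lambda>x. s k t x - v t x)) \<longlonglongrightarrow> 0))"

definition Linf_time ::
  "('a \<Rightarrow> real) set \<Rightarrow> (('a \<Rightarrow> real) \<Rightarrow> real) \<Rightarrow> real set \<Rightarrow> (real \<Rightarrow> 'a \<Rightarrow> real) \<Rightarrow> bool" where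
  "Linf_time X N S v \<longleftrightarrow>
     strongly_measurable_on X N S v \<and> (\<exists>C. AE t in lebesgue_on S. N (v t) \<le> C)"

definition L2_time ::
  "('a \<Rightarrow> real) set \<Rightarrow> (('a \<Rightarrow> real) \<Rightarrow> real) \<Rightarrow> real set \<Rightarrow> (real \<Rightarrow> 'a \<Rightarrow> real) \<Rightarrow> bool" where
  "L2_time X N S v \<longleftrightarrow>
     strongly_measurable_on X N S v \<and> integrable (lebesgue_on S) (\<lambda>t. (N (v t))\<^sup>2)"

text \<open>
  \<open>v'\<close> is the weak time derivative of \<open>v\<close>: for every scalar test function \<open>\<psi>\<close> the Bochner
  integrals of \<open>\<psi>' v\<close> and of \<open>- \<psi> v'\<close> in \<open>L\<^sup>2(U)\<close> agree.  Equality in \<open>L\<^sup>2(U)\<close> is expressed by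
  pairing with all its elements, and the pairing is moved under the Bochner integral.
\<close>
definition weak_time_derivative ::
  "'a::euclidean_space set \<Rightarrow> real set \<Rightarrow> (real \<Rightarrow> 'a \<Rightarrow> real) \<Rightarrow> (real \<Rightarrow> 'a \<Rightarrow> real) \<Rightarrow> bool" where
  "weak_time_derivative U S v v' \<longleftrightarrow>
     (\<forall>\<psi>\<in>test_functions S. \<forall>w\<in>Lspace U 2.
        (LINT t|lebesgue_on S. deriv \<psi> t * L2inner U (v t) w) =
        - (LINT t|lebesgue_on S. \<psi> t * L2inner U (v' t) w))"


section \<open>Weak solutions\<close>

text \<open>
  A weak solution \<open>v\<close> on \<open>(0,T)\<close>, where \<open>0 < T \<le> \<infinity>\<close>, together with its time derivative \<open>vt\<close>.
  A function with \<open>v\<close> and \<open>v\<^sub>t\<close> in the stated spaces has a representative that is continuous from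
  \<open>[0,T)\<close> to \<open>L\<^sup>2(U)\<close>; this is the one meant in the initial condition and in the identity for every
  \<open>t\<close>.  The terms \<open>(\<nabla>v, \<nabla>w)\<close> and \<open>(\<nabla>v\<^sub>t, \<nabla>w)\<close> presuppose that \<open>v t\<close> and \<open>vt t\<close> lie in
  \<open>H01 U\<close>, and the right-hand side presupposes integrability.  The lateral boundary condition is
  the membership of \<open>v t\<close> in \<open>H01 U\<close>.
\<close>
definition weak_solution ::
  "'a::euclidean_space set \<Rightarrow> real \<Rightarrow> ('a \<Rightarrow> real) \<Rightarrow> ereal \<Rightarrow>
     (real \<Rightarrow> 'a \<Rightarrow> real) \<Rightarrow> (real \<Rightarrow> 'a \<Rightarrow> real) \<Rightarrow> bool" where
  "weak_solution U p v0 T v vt \<longleftrightarrow>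
     0 < T \<and>
     Linf_time (H01 U) (H1norm U) {t. 0 < t \<and> ereal t < T} v \<and>
     L2_time (Lspace U 2) (Lnorm U 2) {t. 0 < t \<and> ereal t < T} vt \<and>
     weak_time_derivative U {t. 0 < t \<and> ereal t < T} v vt \<and>
     (\<forall>s. 0 \<le> s \<and> ereal s < T \<longrightarrow>
        ((\<lambda>t. Lnorm U 2 (\<lambda>x. v t x - v s x)) \<longlongrightarrow> 0) (at s within {t. 0 \<le> t \<and> ereal t < T})) \<and>
     (AE x in lebesgue_on U. v 0 x = v0 x) \<and>
     (\<forall>t. 0 < t \<and> ereal t < T \<longrightarrow>
        v t \<in> H01 U \<and> vt t \<in> H01 U \<and>
        (\<forall>w\<in>H01 U.
           integrable (lebesgue_on U) (\<lambda>x. v t x * \<bar>v t x\<bar> powr (p - 1) * ln \<bar>v t x\<bar> * w x) \<and>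
           L2inner U (vt t) w + L2inner U (wgrad U (vt t)) (wgrad U w)
             + L2inner U (wgrad U (v t)) (wgrad U w)
           = L2inner U (\<lambda>x. v t x * \<bar>v t x\<bar> powr (p - 1) * ln \<bar>v t x\<bar>) w))"

definition global_weak_solution ::
  "'a::euclidean_space set \<Rightarrow> real \<Rightarrow> ('a \<Rightarrow> real) \<Rightarrow>
     (real \<Rightarrow> 'a \<Rightarrow> real) \<Rightarrow> (real \<Rightarrow> 'a \<Rightarrow> real) \<Rightarrow> bool" where
  "global_weak_solution U p v0 v vt \<longleftrightarrow> weak_solution U p v0 \<infinity> v vt"

end

theory Submission
  imports Defs
begin

text \<open>
  Let \<open>d\<close> be the depth of the well.  If \<open>d \<le> 0\<close>, then \<open>I v0 \<ge> 0\<close> and \<open>J v0 \<le> 0\<close> force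
  \<open>v0 = 0\<close>, and \<open>v = 0\<close> is a solution.

  If \<open>d > 0\<close>, no Sobolev embedding, and hence no upper bound on \<open>p\<close>, is needed: the embedding is
  replaced by the depth itself.  A function of small \<open>H1\<close> norm with \<open>I v < 0\<close> could be scaled onto
  the Nehari manifold with a value of \<open>J\<close> below \<open>d\<close>, so \<open>I \<ge> 0\<close> near \<open>0\<close>.  Therefore
  \<open>\<integral> \<bar>v\<bar> powr (p + 1) * (1 + ln (1 + \<bar>v\<bar>))\<close> is bounded on balls of \<open>H01\<close>, and this makes the
  nonlinearity locally Lipschitz from \<open>H01\<close> to its dual.  In the \<open>H1\<close> inner product the equation
  is then the ordinary differential equation \<open>v' = - \<nabla>J v\<close>.  Its solution stays in the potential
  well, on which \<open>J\<close> is coercive, and so it is global and bounded.  An initial value with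
  \<open>J v0 = d\<close> is reached as the limit of \<open>\<lambda> v0\<close>, \<open>\<lambda> < 1\<close>.
\<close>

section \<open>Gradient flows in a Hilbert space\<close>

text \<open>\<open>H01 U\<close> is a set of functions, not a type, so the flow lives in
  \<open>L2\<close> of pairs (function, gradient); a projection onto the closure of the pairs of
  test functions, which fixes the values of the vector field, keeps it in that closure. The sign of
  \<open>I\<close> near \<open>0\<close> can be argued only where the logarithmic integral is
  finite; it is therefore obtained for test functions and carried to the closure by Fatou's lemma,
  which yields finite energy for all small elements at once. Large balls follow from small ones
  because the weight 1 + ln (1 + |s|) makes the integrand grow at most polynomially under dilation.
  The Nehari set excludes \<open>0\<close>, so the depth alone does not stop a trajectory from
  passing near \<open>0\<close> to negative values of \<open>I\<close>; the sign of \<open>I\<close>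
  on a small ball closes this gap. The vector field is only locally Lipschitz and is cut off outside
  a ball larger than the a priori bound, so that the cut-off is never felt by the trajectory in
  question.\<close>

lemma integral_exp_le:
  fixes K \<tau> :: real
  assumes "0 < K" "0 \<le> \<tau>"
  shows "integral {0..\<tau>} (\<lambda>s. exp (K * s)) \<le> exp (K * \<tau>) / K"
proof -
  have "((\<lambda>s. exp (K * s)) has_integral (exp (K * \<tau>) / K - exp (K * 0) / K)) {0..\<tau>}"
    using assms
    by (intro fundamental_theorem_of_calculus)
       (auto intro!: derivative_eq_intros simp flip: has_real_derivative_iff_has_vector_derivative)
  then have "integral {0..\<tau>} (\<lambda>s. exp (K * s)) = exp (K * \<tau>) / K - exp (K * 0) / K"
    by (rule integral_unique)
  then show ?thesis using assms by simp
qed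

text \<open>The integral operator is a contraction for the sup norm weighted by \<open>exp (- K t)\<close>, which
  gives the solution on the whole half line at once.\<close>

lemma lipschitz_ode_solution:
  fixes g :: "'h::banach \<Rightarrow> 'h"
  assumes lip: "L-lipschitz_on UNIV g"
  obtains x where "x 0 = x0"
    and "\<And>t. 0 \<le> t \<Longrightarrow> (x has_vector_derivative g (x t)) (at t within {0..})"
proof -
  have L0: "0 \<le> L" using lip by (rule lipschitz_on_nonneg)
  \<comment> \<open>The contraction factor below is L / K; this choice makes it at most 1/2, and the
    summand 1 keeps K positive when L = 0.\<close>
  define K where "K = 2 * L + 1"
  have K0: "0 < K" and LK: "L / K \<le> 1/2" using L0 by (auto simp: K_def field_simps)
  have gcont: "continuous_on A g" for A
    using lip lipschitz_on_continuous_on continuous_on_subset by blast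
  have gl: "norm (g a - g b) \<le> L * norm (a - b)" for a b
    using lipschitz_onD[OF lip, of a b] by (simp add: dist_norm)
  \<comment> \<open>The unknown is the rescaled curve y t = exp (- K t) x t, which is bounded even
    though x may grow exponentially.\<close>
  define h where "h = (\<lambda>(y :: real \<Rightarrow>\<^sub>C 'h) s. g (exp (K * s) *\<^sub>R apply_bcontfun y s))"
  have hcont: "continuous_on A (h y)" for A y
    unfolding h_def
    by (rule continuous_on_compose2[OF gcont[of UNIV]]) (auto intro!: continuous_intros)
  have hint: "h y integrable_on {0..t}" for y t
    by (rule integrable_continuous_real) (rule hcont)
  \<comment> \<open>The Picard operator in the rescaled unknown. Bounded continuous functions live
    on the whole line here, so negative times are frozen at \<open>0\<close> by
    \<open>max 0 t\<close>.\<close>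
  define \<Phi> where "\<Phi> = (\<lambda>(y :: real \<Rightarrow>\<^sub>C 'h) t. exp (- K * max 0 t) *\<^sub>R (x0 + integral {0..max 0 t} (h y)))"
  have eint: "(\<lambda>s. c * exp (K * s)) integrable_on {0..t}" for c t
    by (rule integrable_continuous_real) (auto intro!: continuous_intros)
  have hb: "norm (h y s) \<le> (norm (g 0) + L * norm y) * exp (K * s)" if "0 \<le> s" for y s
  proof -
    have "norm (h y s) \<le> norm (g 0) + norm (h y s - g 0)"
      by (metis add.commute diff_add_cancel norm_triangle_ineq)
    also have "norm (h y s - g 0) \<le> L * norm (exp (K * s) *\<^sub>R apply_bcontfun y s)"
      unfolding h_def using gl[of "exp (K * s) *\<^sub>R apply_bcontfun y s" 0] by simp
    also have "\<dots> \<le> L * (exp (K * s) * norm y)"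
      using norm_bounded[of y s] L0 by (auto intro!: mult_left_mono)
    also have "norm (g 0) \<le> norm (g 0) * exp (K * s)"
      using that K0 by (simp add: mult_le_cancel_left1)
    finally show ?thesis by (simp add: algebra_simps)
  qed
  have cont: "continuous_on UNIV (\<Phi> y)" for y
  proof -
    have 1: "continuous_on {0..b} (\<lambda>t. integral {0..t} (h y))" for b
      by (rule indefinite_integral_continuous_1) (rule hint)
    have 2: "isCont (\<lambda>t. integral {0..max 0 t} (h y)) t" for t
    proof -
      have "continuous_on {..<\<bar>t\<bar> + 1} (\<lambda>t. integral {0..max 0 t} (h y))"
        by (rule continuous_on_compose2[OF 1[of "\<bar>t\<bar>+1"]]) (auto intro!: continuous_intros)
      then show ?thesis
        by (simp add: continuous_on_eq_continuous_at)
    qed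
    then have "continuous_on UNIV (\<lambda>t. integral {0..max 0 t} (h y))"
      by (simp add: continuous_on_eq_continuous_at)
    then show ?thesis
      unfolding \<Phi>_def by (intro continuous_intros)
  qed
  have bnd: "norm (\<Phi> y t) \<le> norm x0 + (norm (g 0) + L * norm y) / K" for y t
  proof -
    define \<tau> where "\<tau> = max 0 t"
    have t0: "0 \<le> \<tau>" by (simp add: \<tau>_def)
    define c where "c = norm (g 0) + L * norm y"
    have c0: "0 \<le> c" using L0 by (simp add: c_def)
    have "norm (integral {0..\<tau>} (h y)) \<le> integral {0..\<tau>} (\<lambda>s. c * exp (K * s))"
      by (rule integral_norm_bound_integral[OF hint eint]) (use hb in \<open>auto simp: c_def\<close>)
    also have "\<dots> \<le> c * (exp (K * \<tau>) / K)"
      unfolding integral_mult_right by (intro mult_left_mono integral_exp_le K0 t0 c0)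
    finally have 1: "norm (integral {0..\<tau>} (h y)) \<le> c * (exp (K * \<tau>) / K)" .
    have "norm (\<Phi> y t) = exp (- K * \<tau>) * norm (x0 + integral {0..\<tau>} (h y))"
      by (simp add: \<Phi>_def \<tau>_def)
    also have "\<dots> \<le> exp (- K * \<tau>) * (norm x0 + c * (exp (K * \<tau>) / K))"
      using norm_triangle_ineq[of x0 "integral {0..\<tau>} (h y)"] 1
      by (intro mult_left_mono) auto
    also have "\<dots> = exp (- K * \<tau>) * norm x0 + c / K"
      by (simp add: exp_minus field_simps)
    also have "exp (- K * \<tau>) * norm x0 \<le> 1 * norm x0"
      using K0 t0 by (intro mult_right_mono) auto
    finally show ?thesis by (simp add: c_def)
  qed
  have bcf: "\<Phi> y \<in> bcontfun" for y
    unfolding bcontfun_def bounded_iff using cont bnd by blast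
  define T where "T = (\<lambda>y. Bcontfun (\<Phi> y))"
  have T: "apply_bcontfun (T y) = \<Phi> y" for y
    unfolding T_def using bcf by (simp add: Bcontfun_inverse)
  have contr: "dist (T y) (T z) \<le> 1/2 * dist y z" for y z
  proof (rule dist_bound)
    fix t :: real
    define \<tau> where "\<tau> = max 0 t"
    have t0: "0 \<le> \<tau>" by (simp add: \<tau>_def)
    define c where "c = L * dist y z"
    have c0: "0 \<le> c" using L0 by (simp add: c_def)
    have le: "norm (h y s - h z s) \<le> c * exp (K * s)" for s
    proof -
      have "norm (h y s - h z s) \<le> L * norm (exp (K * s) *\<^sub>R apply_bcontfun y s - exp (K * s) *\<^sub>R apply_bcontfun z s)"
        unfolding h_def by (rule gl)
      also have "\<dots> = L * (exp (K * s) * dist (apply_bcontfun y s) (apply_bcontfun z s))"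
        by (simp add: dist_norm flip: scaleR_diff_right)
      also have "\<dots> \<le> L * (exp (K * s) * dist y z)"
        using dist_bounded[of y s z] L0 by (auto intro!: mult_left_mono)
      finally show ?thesis by (simp add: c_def algebra_simps)
    qed
    have "norm (integral {0..\<tau>} (h y) - integral {0..\<tau>} (h z))
          = norm (integral {0..\<tau>} (\<lambda>s. h y s - h z s))"
      by (simp add: Henstock_Kurzweil_Integration.integral_diff hint)
    also have "\<dots> \<le> integral {0..\<tau>} (\<lambda>s. c * exp (K * s))"
      by (rule integral_norm_bound_integral[OF integrable_diff[OF hint hint] eint]) (use le in auto)
    also have "\<dots> \<le> c * (exp (K * \<tau>) / K)"
      unfolding integral_mult_right by (intro mult_left_mono integral_exp_le K0 t0 c0)
    finally have 1: "norm (integral {0..\<tau>} (h y) - integral {0..\<tau>} (h z)) \<le> c * (exp (K * \<tau>) / K)" .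
    have "dist (apply_bcontfun (T y) t) (apply_bcontfun (T z) t)
        = exp (- K * \<tau>) * norm (integral {0..\<tau>} (h y) - integral {0..\<tau>} (h z))"
      by (simp add: T \<Phi>_def \<tau>_def dist_norm flip: scaleR_diff_right)
    also have "\<dots> \<le> exp (- K * \<tau>) * (c * (exp (K * \<tau>) / K))"
      using 1 by (intro mult_left_mono) auto
    also have "\<dots> = L / K * dist y z"
      by (simp add: c_def exp_minus field_simps)
    also have "\<dots> \<le> 1/2 * dist y z"
      using LK by (intro mult_right_mono) auto
    finally show "dist (apply_bcontfun (T y) t) (apply_bcontfun (T z) t) \<le> 1/2 * dist y z" .
  qed
  obtain y where y: "T y = y"
    using banach_fix_type[of "1/2" T] contr by auto
  define x where "x t = exp (K * t) *\<^sub>R apply_bcontfun y t" for t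
  have hx: "h y s = g (x s)" for s by (simp add: h_def x_def)
  have xeq: "x t = x0 + integral {0..t} (h y)" if "0 \<le> t" for t
  proof -
    have "apply_bcontfun y t = \<Phi> y t" using T[of y] y by simp
    then show ?thesis using that by (simp add: x_def \<Phi>_def exp_minus)
  qed
  show ?thesis
  proof
    show "x 0 = x0" using xeq[of 0] by simp
    fix t :: real assume t: "0 \<le> t"
    have "((\<lambda>u. integral {0..u} (h y)) has_vector_derivative h y t) (at t within {0..t+1})"
      by (rule integral_has_vector_derivative[OF hcont]) (use t in auto)
    then have "((\<lambda>u. x0 + integral {0..u} (h y)) has_vector_derivative h y t) (at t within {0..t+1})"
      by (auto intro!: derivative_eq_intros)
    then have "(x has_vector_derivative h y t) (at t within {0..t+1})"
      by (rule has_vector_derivative_transform[rotated 2]) (use t xeq in auto)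
    moreover have "at t within {0..t+1} = at t within {0..}"
      by (rule at_within_nhd[of t "{..<t+1}"]) auto
    ultimately show "(x has_vector_derivative g (x t)) (at t within {0..})" by (simp add: hx)
  qed
qed

section \<open>Continuous dependence and the cut-off of a vector field\<close>

lemma has_vector_derivative_norm_sq:
  fixes z :: "real \<Rightarrow> 'h::real_inner"
  assumes "(z has_vector_derivative z') (at t within S)"
  shows "((\<lambda>t. (norm (z t))\<^sup>2) has_real_derivative 2 * (z t \<bullet> z')) (at t within S)"
proof -
  have "((\<lambda>t. z t \<bullet> z t) has_derivative (\<lambda>h. z t \<bullet> (h *\<^sub>R z') + (h *\<^sub>R z') \<bullet> z t)) (at t within S)"
    using assms unfolding has_vector_derivative_def by (intro has_derivative_inner) auto
  moreover have "(\<lambda>h. z t \<bullet> (h *\<^sub>R z') + (h *\<^sub>R z') \<bullet> z t) = (*) (2 * (z t \<bullet> z'))"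
    by (auto simp: inner_commute)
  ultimately show ?thesis
    by (simp add: has_field_derivative_def power2_norm_eq_inner)
qed

text \<open>Only derivatives within the interval are assumed, because trajectories are
  differentiable at time \<open>0\<close> from one side.\<close>

lemma DERIV_within_nonpos_imp_decreasing:
  fixes f :: "real \<Rightarrow> real"
  assumes "a \<le> b"
    and deriv: "\<And>t. a \<le> t \<Longrightarrow> t \<le> b \<Longrightarrow> (f has_real_derivative f' t) (at t within {a..b})"
    and nonpos: "\<And>t. a < t \<Longrightarrow> t < b \<Longrightarrow> f' t \<le> 0"
  shows "f b \<le> f a"
proof (cases "a < b")
  case True
  obtain u where u: "u \<in> {a<..<b}" "f b - f a = f' u * (b - a)"
    using mvt_simple[of a b f "\<lambda>t h. f' t * h"] deriv True
    by (auto simp: has_field_derivative_def)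
  then have "f' u * (b - a) \<le> 0"
    using nonpos[of u] True by (auto intro: mult_nonpos_nonneg)
  then show ?thesis using u by simp
qed (use assms in auto)

text \<open>Gronwall in differential form: the Lipschitz bound makes exp (- 2 L t) |x t - y t|^2
  nonincreasing. It carries bounds from approximating trajectories to their limit.\<close>

lemma lipschitz_ode_dependence:
  fixes g :: "'h::real_inner \<Rightarrow> 'h"
  assumes lip: "L-lipschitz_on UNIV g"
    and x: "\<And>t. 0 \<le> t \<Longrightarrow> (x has_vector_derivative g (x t)) (at t within {0..})"
    and y: "\<And>t. 0 \<le> t \<Longrightarrow> (y has_vector_derivative g (y t)) (at t within {0..})"
    and "0 \<le> t"
  shows "norm (x t - y t) \<le> exp (L * t) * norm (x 0 - y 0)"
proof -
  define z where "z t = x t - y t" for t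
  define E where "E t = exp (- 2 * L * t) * (norm (z t))\<^sup>2" for t
  have z: "(z has_vector_derivative (g (x s) - g (y s))) (at s within {0..})" if "0 \<le> s" for s
    unfolding z_def using x[OF that] y[OF that] by (auto intro!: derivative_eq_intros)
  have "E t \<le> E 0"
  proof (rule DERIV_within_nonpos_imp_decreasing[OF \<open>0 \<le> t\<close>])
    fix s assume s: "0 \<le> s" "s \<le> t"
    have 1: "((\<lambda>t. (norm (z t))\<^sup>2) has_real_derivative 2 * (z s \<bullet> (g (x s) - g (y s)))) (at s within {0..t})"
      by (rule has_vector_derivative_norm_sq, rule has_vector_derivative_within_subset[OF z]) (use s in auto)
    have "((\<lambda>t. exp (- 2 * L * t)) has_real_derivative exp (- 2 * L * s) * (- 2 * L)) (at s within {0..t})"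
      by (auto intro!: derivative_eq_intros)
    from DERIV_mult[OF this 1] show "(E has_real_derivative
        (exp (- 2 * L * s) * (2 * (z s \<bullet> (g (x s) - g (y s))) - 2 * L * (norm (z s))\<^sup>2))) (at s within {0..t})"
      unfolding E_def by (rule DERIV_cong) (simp add: algebra_simps)
  next
    fix s
    have "z s \<bullet> (g (x s) - g (y s)) \<le> norm (z s) * norm (g (x s) - g (y s))"
      by (rule norm_cauchy_schwarz)
    also have "\<dots> \<le> norm (z s) * (L * norm (z s))"
      using lipschitz_onD[OF lip, of "x s" "y s"] by (intro mult_left_mono) (auto simp: z_def dist_norm)
    finally have "2 * (z s \<bullet> (g (x s) - g (y s))) - 2 * L * (norm (z s))\<^sup>2 \<le> 0"
      by (simp add: power2_eq_square algebra_simps)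
    then show "exp (- 2 * L * s) * (2 * (z s \<bullet> (g (x s) - g (y s))) - 2 * L * (norm (z s))\<^sup>2) \<le> 0"
      by (intro mult_nonneg_nonpos) auto
  qed
  then have "(norm (z t))\<^sup>2 \<le> exp (2 * L * t) * (norm (z 0))\<^sup>2"
    by (simp add: E_def exp_minus field_simps)
  also have "\<dots> = (exp (L * t) * norm (z 0))\<^sup>2"
    by (simp add: power_mult_distrib power2_eq_square flip: exp_add)
  finally show ?thesis
    unfolding z_def by (rule power2_le_imp_le) auto
qed

text \<open>The map pulls points outside the ball of radius R back to its sphere; composing with it
  turns a field that is Lipschitz on the ball into a globally Lipschitz one. One unit of the
  constant comes from the displacement x - y, the other from the change of the scaling
  factor.\<close>

lemma radial_retraction_lipschitz:
  fixes R :: real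
  assumes "0 < R"
  shows "2-lipschitz_on UNIV (\<lambda>x::'h::real_normed_vector. (R / max R (norm x)) *\<^sub>R x)"
proof (rule lipschitz_onI)
  fix x y :: 'h
  let ?m = "\<lambda>x::'h. max R (norm x)"
  have pos: "0 < ?m x" for x using assms by (simp add: less_max_iff_disj)
  have "(R / ?m x) *\<^sub>R x - (R / ?m y) *\<^sub>R y = (R / ?m x) *\<^sub>R (x - y) + (R / ?m x - R / ?m y) *\<^sub>R y"
    by (simp add: algebra_simps)
  then have "norm ((R / ?m x) *\<^sub>R x - (R / ?m y) *\<^sub>R y)
      \<le> \<bar>R / ?m x\<bar> * norm (x - y) + \<bar>R / ?m x - R / ?m y\<bar> * norm y"
    by (metis norm_scaleR norm_triangle_ineq)
  moreover have "\<bar>R / ?m x\<bar> \<le> 1" using pos[of x] assms by (simp add: field_simps)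
  moreover have "\<bar>R / ?m x - R / ?m y\<bar> * norm y \<le> norm (x - y)"
  proof -
    have "\<bar>R / ?m x - R / ?m y\<bar> * norm y \<le> \<bar>R / ?m x - R / ?m y\<bar> * ?m y"
      by (intro mult_left_mono) auto
    also have "\<dots> = \<bar>(R / ?m x - R / ?m y) * ?m y\<bar>"
      using pos[of y] by (simp add: abs_mult)
    also have "(R / ?m x - R / ?m y) * ?m y = (R / ?m x) * (?m y - ?m x)"
      using pos[of x] pos[of y] by (simp add: field_simps)
    also have "\<bar>\<dots>\<bar> = \<bar>R / ?m x\<bar> * \<bar>?m y - ?m x\<bar>" by (simp only: abs_mult)
    also have "\<dots> \<le> 1 * norm (x - y)"
    proof (rule mult_mono)
      show "\<bar>?m y - ?m x\<bar> \<le> norm (x - y)"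
        using norm_triangle_ineq3[of x y] by linarith
    qed (use \<open>\<bar>R / ?m x\<bar> \<le> 1\<close> in auto)
    finally show ?thesis by simp
  qed
  ultimately have "norm ((R / ?m x) *\<^sub>R x - (R / ?m y) *\<^sub>R y) \<le> 1 * norm (x - y) + norm (x - y)"
    by (blast intro: order_trans add_mono mult_right_mono norm_ge_zero)
  then show "dist ((R / ?m x) *\<^sub>R x) ((R / ?m y) *\<^sub>R y) \<le> 2 * dist x y"
    by (simp add: dist_norm)
qed simp

text \<open>
  The gradient flow of an energy \<open>J\<close> with gradient \<open>G\<close>, started in the closed potential well.  The
  Nehari functional is \<open>G x \<bullet> x\<close>.  Below the depth \<open>d\<close> a trajectory cannot leave the well, since
  it would have to cross the Nehari set, where \<open>J \<ge> d\<close>; at the depth \<open>d\<close> itself it is a limit of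
  the trajectories started from \<open>\<lambda> x0\<close> with \<open>\<lambda> < 1\<close>.
\<close>

theorem potential_well_gradient_flow:
  fixes G P :: "'h::{real_inner,banach} \<Rightarrow> 'h" and J :: "'h \<Rightarrow> real"
  assumes P: "bounded_linear P" and GP: "\<And>x. P (G x) = G x"
    and lip: "\<And>R. \<exists>L. L-lipschitz_on (cball 0 R) G"
    and deriv: "\<And>x. (J has_derivative (\<lambda>h. G x \<bullet> h)) (at x)"
    and \<delta>: "0 < \<delta>" "\<And>x. P x = x \<Longrightarrow> norm x \<le> \<delta> \<Longrightarrow> 0 \<le> G x \<bullet> x"
    and ray: "\<And>x l. P x = x \<Longrightarrow> x \<noteq> 0 \<Longrightarrow> 0 \<le> G x \<bullet> x \<Longrightarrow> 0 < l \<Longrightarrow> l < 1 \<Longrightarrow> 0 < G (l *\<^sub>R x) \<bullet> x"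
    and coercive: "\<And>x. P x = x \<Longrightarrow> 0 \<le> G x \<bullet> x \<Longrightarrow> J x \<le> d \<Longrightarrow> norm x \<le> M"
    and depth: "\<And>x. P x = x \<Longrightarrow> x \<noteq> 0 \<Longrightarrow> G x \<bullet> x = 0 \<Longrightarrow> d \<le> J x"
    and J0: "J 0 < d"
    and x0: "P x0 = x0" "0 \<le> G x0 \<bullet> x0" "J x0 \<le> d"
  obtains x where "x 0 = x0"
    and "\<And>t. 0 \<le> t \<Longrightarrow> P (x t) = x t"
    and "\<And>t. 0 \<le> t \<Longrightarrow> norm (x t) \<le> M"
    and "\<And>t. 0 \<le> t \<Longrightarrow> 0 \<le> G (x t) \<bullet> x t"
    and "\<And>t. 0 \<le> t \<Longrightarrow> (x has_vector_derivative - G (x t)) (at t within {0..})"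
    and "\<And>T. 0 \<le> T \<Longrightarrow> ((\<lambda>t. (norm (G (x t)))\<^sup>2) has_integral J x0 - J (x T)) {0..T}"
proof -
  interpret P: bounded_linear P by (rule P)
  have M0: "0 \<le> M" using coercive[of 0] J0 by (simp add: P.zero)
  \<comment> \<open>The cut-off radius lies strictly above the a priori bound M, so a trajectory
    that is still in the well cannot reach norm R.\<close>
  define R where "R = M + 1"
  have R0: "0 < R" and MR: "M < R" using M0 by (auto simp: R_def)
  define \<rho> where "\<rho> x = (R / max R (norm x)) *\<^sub>R x" for x :: 'h
  have \<rho>id: "\<rho> x = x" if "norm x \<le> R" for x using that R0 by (simp add: \<rho>_def max_absorb1)
  have \<rho>R: "norm (\<rho> x) \<le> R" for x
    using R0 by (auto simp: \<rho>_def field_simps max_def)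
  obtain L where L: "L-lipschitz_on (cball 0 R) G" using lip by blast
  have gl: "(L * 2)-lipschitz_on UNIV (\<lambda>x. - G (\<rho> x))"
  proof -
    have "2-lipschitz_on UNIV \<rho>"
      unfolding \<rho>_def by (rule radial_retraction_lipschitz[OF R0])
    moreover have "L-lipschitz_on (range \<rho>) G"
      by (rule lipschitz_on_subset[OF L]) (auto simp: \<rho>R)
    ultimately have "(L * 2)-lipschitz_on UNIV (\<lambda>x. G (\<rho> x))"
      by (rule lipschitz_on_compose2)
    then show ?thesis by (rule lipschitz_on_minus)
  qed
  have Gcont: "continuous_on UNIV G"
  proof -
    have "isCont G x" for x
    proof -
      obtain L' where "L'-lipschitz_on (cball 0 (norm x + 1)) G" using lip by blast
      then have "continuous_on (cball 0 (norm x + 1)) G" by (rule lipschitz_on_continuous_on)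
      then have "continuous_on (ball 0 (norm x + 1)) G"
        by (rule continuous_on_subset) auto
      then show ?thesis by (simp add: continuous_on_eq_continuous_at)
    qed
    then show ?thesis by (simp add: continuous_on_eq_continuous_at)
  qed
  have Jcont: "continuous_on A J" for A
    using deriv has_derivative_continuous by (blast intro: continuous_at_imp_continuous_on)
  define sol where "sol a x \<longleftrightarrow> x 0 = a \<and>
     (\<forall>t\<ge>0. (x has_vector_derivative - G (\<rho> (x t))) (at t within {0..}))" for a x
  have ex: "\<exists>x. sol a x" for a
    using lipschitz_ode_solution[OF gl, of a] unfolding sol_def by metis
  \<comment> \<open>The component x - P x has derivative zero, because P fixes the values of G; a
    trajectory that starts among the fixed points of P stays there.\<close>
  have solP: "P (x t) = x t" if "sol a x" "P a = a" "0 \<le> t" for a x t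
  proof -
    have "((\<lambda>t. x t - P (x t)) has_vector_derivative - G (\<rho> (x s)) - P (- G (\<rho> (x s)))) (at s within {0..})"
      if "0 \<le> s" for s
      using \<open>sol a x\<close> that
      by (intro has_vector_derivative_diff P.has_vector_derivative) (auto simp: sol_def)
    then have d0: "((\<lambda>t. x t - P (x t)) has_vector_derivative 0) (at s within {0..})" if "s \<in> {0..}" for s
      using that by (simp add: P.neg GP)
    obtain c where c: "\<And>s. s \<in> {0..} \<Longrightarrow> x s - P (x s) = c"
      using has_vector_derivative_zero_constant[OF _ d0] convex_real_interval(1) by blast
    have "x t - P (x t) = x 0 - P (x 0)" using c[of t] c[of 0] \<open>0 \<le> t\<close> by simp
    then show ?thesis using that by (simp add: sol_def)
  qed
  have solcont: "continuous_on {0..} x" if "sol a x" for a x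
    using that has_vector_derivative_continuous unfolding sol_def continuous_on_eq_continuous_within by blast
  have Jderiv: "((\<lambda>t. J (x t)) has_real_derivative - (norm (G (x t)))\<^sup>2) (at t within S)"
    if "sol a x" "0 \<le> t" "norm (x t) \<le> R" "S \<subseteq> {0..}" for a x t S
  proof -
    have "(x has_vector_derivative - G (x t)) (at t within S)"
      using that \<rho>id[of "x t"] unfolding sol_def by (metis has_vector_derivative_within_subset)
    then have "(x has_derivative (\<lambda>h. h *\<^sub>R (- G (x t)))) (at t within S)"
      by (simp add: has_vector_derivative_def)
    then have "((\<lambda>t. J (x t)) has_derivative (\<lambda>h. G (x t) \<bullet> (h *\<^sub>R (- G (x t))))) (at t within S)"
      by (rule has_derivative_compose) (rule deriv)
    moreover have "(\<lambda>h. G (x t) \<bullet> (h *\<^sub>R (- G (x t)))) = (*) (- (norm (G (x t)))\<^sup>2)"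
      by (auto simp: power2_norm_eq_inner)
    ultimately show ?thesis by (simp add: has_field_derivative_def)
  qed
  have Icont: "continuous_on {0..} (\<lambda>t. G (x t) \<bullet> x t)" if "sol a x" for a x
    by (intro continuous_intros continuous_on_compose2[OF Gcont solcont[OF that]] solcont[OF that]) auto
  have strict: "norm (x t) \<le> M \<and> 0 \<le> G (x t) \<bullet> x t"
    if x: "sol a x" and a: "P a = a" "0 \<le> G a \<bullet> a" "J a < d" and t: "0 \<le> t" for a x t
  proof -
    have xP: "P (x t) = x t" if "0 \<le> t" for t using solP[OF x a(1) that] .
    \<comment> \<open>The bad times: the Nehari functional is nonpositive away from the small ball,
      or the cut-off radius is reached. Both conditions are closed, so a nonempty W has a first
      element; inside the small ball the sign is guaranteed by the hypothesis on \<delta>.\<close>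
    define W where "W = {t \<in> {0..}. G (x t) \<bullet> x t \<le> 0 \<and> \<delta> \<le> norm (x t)} \<union> {t \<in> {0..}. R \<le> norm (x t)}"
    have "closed W"
    proof -
      have "W = ({t \<in> {0..}. G (x t) \<bullet> x t \<le> 0} \<inter> {t \<in> {0..}. \<delta> \<le> norm (x t)}) \<union> {t \<in> {0..}. R \<le> norm (x t)}"
        by (auto simp: W_def)
      moreover have "closed \<dots>"
        by (intro closed_Un closed_Int continuous_on_closed_Collect_le Icont[OF x] solcont[OF x]
            continuous_on_norm continuous_on_const closed_atLeast)
      ultimately show ?thesis by simp
    qed
    \<comment> \<open>Only times strictly before t are required to avoid W; the values at t follow
      by continuity. This allows the application at the first bad time itself.\<close>
    have decr: "0 \<le> G (x t) \<bullet> x t \<and> J (x t) \<le> J a"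
      if "0 \<le> t" and W: "\<And>s. 0 \<le> s \<Longrightarrow> s < t \<Longrightarrow> s \<notin> W" for t
    proof
      have I: "0 \<le> G (x s) \<bullet> x s" and N: "norm (x s) \<le> R" if "0 \<le> s" "s < t" for s
        using W[OF that] that \<delta>(2)[OF xP, of s] by (auto simp: W_def not_le intro: less_imp_le)
      show I': "0 \<le> G (x t) \<bullet> x t"
      proof (cases "t = 0")
        case True then show ?thesis using x a by (simp add: sol_def)
      next
        case False
        then have cl: "closure {0..<t} = {0..t}" using \<open>0 \<le> t\<close> by (simp add: closure_atLeastLessThan)
        show ?thesis
        proof (rule continuous_ge_on_closure[where S="{0..<t}" and f="\<lambda>t. G (x t) \<bullet> x t"])
          show "continuous_on (closure {0..<t}) (\<lambda>t. G (x t) \<bullet> x t)"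
            unfolding cl by (rule continuous_on_subset[OF Icont[OF x]]) auto
          show "t \<in> closure {0..<t}" unfolding cl using \<open>0 \<le> t\<close> by simp
        qed (use I in simp)
      qed
      have N': "norm (x t) \<le> R"
      proof (cases "t = 0")
        case True
        then show ?thesis using x a coercive[of a] MR by (simp add: sol_def)
      next
        case False
        then have cl: "closure {0..<t} = {0..t}" using \<open>0 \<le> t\<close> by (simp add: closure_atLeastLessThan)
        show ?thesis
        proof (rule continuous_le_on_closure[where S="{0..<t}" and f="\<lambda>t. norm (x t)"])
          show "continuous_on (closure {0..<t}) (\<lambda>t. norm (x t))"
            unfolding cl by (rule continuous_on_norm, rule continuous_on_subset[OF solcont[OF x]]) auto
          show "t \<in> closure {0..<t}" unfolding cl using \<open>0 \<le> t\<close> by simp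
        qed (use N in simp)
      qed
      have "J (x t) \<le> J (x 0)"
      proof (rule DERIV_within_nonpos_imp_decreasing[OF \<open>0 \<le> t\<close>])
        fix s assume s: "0 \<le> s" "s \<le> t"
        then show "((\<lambda>t. J (x t)) has_real_derivative - (norm (G (x s)))\<^sup>2) (at s within {0..t})"
          using N N' by (intro Jderiv[OF x]) (auto simp: less_le)
      qed auto
      then show "J (x t) \<le> J a" using x by (simp add: sol_def)
    qed
    \<comment> \<open>At the first bad time coercivity bounds the norm by M < R, so the Nehari
      functional vanishes there at a nonzero point. The depth then gives J \<ge> d, while J has not
      increased from J a < d.\<close>
    have "W = {}"
    proof (rule ccontr)
      assume ne: "W \<noteq> {}"
      define \<tau> where "\<tau> = Inf W"
      have bb: "bdd_below W" by (rule bdd_belowI[of _ 0]) (auto simp: W_def)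
      have \<tau>W: "\<tau> \<in> W" unfolding \<tau>_def using closed_contains_Inf[OF ne bb \<open>closed W\<close>] .
      then have \<tau>0: "0 \<le> \<tau>" by (auto simp: W_def)
      have "s \<notin> W" if "s < \<tau>" for s using cInf_lower[OF _ bb, of s] that by (auto simp: \<tau>_def)
      with decr[OF \<tau>0] have I: "0 \<le> G (x \<tau>) \<bullet> x \<tau>" and J: "J (x \<tau>) \<le> J a" by auto
      have "norm (x \<tau>) \<le> M" using coercive[OF xP[OF \<tau>0] I] J a by simp
      then have "G (x \<tau>) \<bullet> x \<tau> \<le> 0" "\<delta> \<le> norm (x \<tau>)" using \<tau>W MR by (auto simp: W_def)
      then have "d \<le> J (x \<tau>)" using I \<delta> by (intro depth xP \<tau>0) auto
      then show False using J a by simp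
    qed
    then show ?thesis using decr[OF t] coercive[OF xP[OF t]] a by auto
  qed
  obtain x where x: "sol x0 x" using ex by blast
  have main: "norm (x t) \<le> M \<and> 0 \<le> G (x t) \<bullet> x t" if t: "0 \<le> t" for t
  proof (cases "J x0 < d")
    case True
    then show ?thesis using strict[OF x] x0 t by simp
  next
    case False
    then have "x0 \<noteq> 0" using J0 x0 by auto
    \<comment> \<open>The shift by 2 puts every l n strictly between 0 and 1, including l 0 =
      1/2.\<close>
    define l :: "nat \<Rightarrow> real" where "l n = 1 - 1 / (n + 2)" for n
    have l: "0 < l n" "l n < 1" for n by (auto simp: l_def field_simps)
    have llim: "l \<longlonglongrightarrow> 1"
    proof -
      have "(\<lambda>n. 1 - 1 / real (n + 2)) \<longlonglongrightarrow> 1 - 0"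
        by (intro tendsto_diff tendsto_const LIMSEQ_ignore_initial_segment lim_1_over_n)
      then show ?thesis by (simp add: l_def[abs_def] add.commute)
    qed
    have P': "P (l n *\<^sub>R x0) = l n *\<^sub>R x0" for n using x0 by (simp add: P.scaleR)
    have I': "0 < G (s *\<^sub>R x0) \<bullet> x0" if "0 < s" "s < 1" for s
      using ray[OF x0(1) \<open>x0 \<noteq> 0\<close> x0(2) that] .
    \<comment> \<open>J is strictly increasing along the segment that ends in x0, as its derivative
      at s is G (s x0) \<bullet> x0 > 0; so the scaled initial values lie strictly below the level
      d.\<close>
    have "J (l n *\<^sub>R x0) < J (1 *\<^sub>R x0)" for n :: nat
    proof (rule DERIV_pos_imp_increasing_open[OF l(2)])
      fix s assume s: "l n < s" "s < 1"
      have "((\<lambda>s. s *\<^sub>R x0) has_derivative (\<lambda>h. h *\<^sub>R x0)) (at s)"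
        by (auto intro!: derivative_eq_intros)
      then have "((\<lambda>s. J (s *\<^sub>R x0)) has_derivative (\<lambda>h. G (s *\<^sub>R x0) \<bullet> (h *\<^sub>R x0))) (at s)"
        by (rule has_derivative_compose) (rule deriv)
      moreover have "(\<lambda>h. G (s *\<^sub>R x0) \<bullet> (h *\<^sub>R x0)) = (*) (G (s *\<^sub>R x0) \<bullet> x0)" by auto
      ultimately have "((\<lambda>s. J (s *\<^sub>R x0)) has_real_derivative G (s *\<^sub>R x0) \<bullet> x0) (at s)"
        by (simp add: has_field_derivative_def)
      then show "\<exists>y. ((\<lambda>s. J (s *\<^sub>R x0)) has_real_derivative y) (at s) \<and> 0 < y"
        using I' l[of n] s by force
    next
      show "continuous_on {l n..1} (\<lambda>s. J (s *\<^sub>R x0))"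
        by (rule continuous_on_compose2[OF Jcont[of UNIV]]) (auto intro!: continuous_intros)
    qed
    then have J': "J (l n *\<^sub>R x0) < d" for n using x0 less_le_trans by simp blast
    have I'': "0 \<le> G (l n *\<^sub>R x0) \<bullet> (l n *\<^sub>R x0)" for n
      using I'[OF l, of n] l(1)[of n] by simp
    define X where "X n = (SOME x. sol (l n *\<^sub>R x0) x)" for n
    have X: "sol (l n *\<^sub>R x0) (X n)" for n unfolding X_def using ex[of "l n *\<^sub>R x0"] by (rule someI_ex)
    have Xb: "norm (X n t) \<le> M \<and> 0 \<le> G (X n t) \<bullet> X n t" for n
      using strict[OF X P' I'' J' t] .
    have "norm (X n t - x t) \<le> exp (L * 2 * t) * norm (l n *\<^sub>R x0 - x0)" for n
      using lipschitz_ode_dependence[OF gl, of "X n" x t] X[of n] x t by (simp add: sol_def)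
    moreover have "(\<lambda>n. exp (L * 2 * t) * norm (l n *\<^sub>R x0 - x0)) \<longlonglongrightarrow> 0"
      using llim by (auto intro!: tendsto_eq_intros)
    ultimately have "(\<lambda>n. X n t - x t) \<longlonglongrightarrow> 0"
      by (rule Lim_null_comparison[OF always_eventually, rule_format])
    then have lim: "(\<lambda>n. X n t) \<longlonglongrightarrow> x t" by (simp add: LIM_zero_iff)
    then have "(\<lambda>n. G (X n t)) \<longlonglongrightarrow> G (x t)"
      using Gcont by (auto simp: continuous_on_eq_continuous_at intro: isCont_tendsto_compose)
    then have "(\<lambda>n. G (X n t) \<bullet> X n t) \<longlonglongrightarrow> G (x t) \<bullet> x t" by (intro tendsto_inner lim)
    then have "0 \<le> G (x t) \<bullet> x t" by (rule LIMSEQ_le_const) (use Xb in auto)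
    moreover have "norm (x t) \<le> M" by (rule LIMSEQ_le_const2[OF tendsto_norm[OF lim]]) (use Xb in auto)
    ultimately show ?thesis by simp
  qed
  have NR: "norm (x t) \<le> R" if "0 \<le> t" for t using main[OF that] MR by simp
  show ?thesis
  proof
    show "x 0 = x0" using x by (simp add: sol_def)
    show "P (x t) = x t" if "0 \<le> t" for t using solP[OF x x0(1) that] .
    show "norm (x t) \<le> M" "0 \<le> G (x t) \<bullet> x t" if "0 \<le> t" for t using main[OF that] by auto
    show "(x has_vector_derivative - G (x t)) (at t within {0..})" if "0 \<le> t" for t
      using x that \<rho>id[OF NR[OF that]] by (auto simp: sol_def)
    show "((\<lambda>t. (norm (G (x t)))\<^sup>2) has_integral J x0 - J (x T)) {0..T}" if T: "0 \<le> T" for T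
    proof -
      \<comment> \<open>Energy identity: along the field - G the derivative of J is - |G|^2. The
        cut-off is inactive since the norm stays below R.\<close>
      have "((\<lambda>t. - (norm (G (x t)))\<^sup>2) has_integral J (x T) - J (x 0)) {0..T}"
      proof (rule fundamental_theorem_of_calculus[OF T])
        fix t assume t: "t \<in> {0..T}"
        then have "((\<lambda>t. J (x t)) has_real_derivative - (norm (G (x t)))\<^sup>2) (at t within {0..T})"
          by (intro Jderiv[OF x] NR) auto
        then show "((\<lambda>t. J (x t)) has_vector_derivative - (norm (G (x t)))\<^sup>2) (at t within {0..T})"
          by (simp add: has_real_derivative_iff_has_vector_derivative)
      qed
      from has_integral_neg[OF this] show ?thesis using x by (simp add: sol_def)
    qed
  qed
qed

section \<open>The Hilbert space of square integrable functions\<close>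

definition square_integrable :: "('a::euclidean_space \<Rightarrow> 'b::euclidean_space) \<Rightarrow> bool" where
  "square_integrable f \<longleftrightarrow>
     f \<in> borel_measurable lebesgue \<and> integrable lebesgue (\<lambda>x. (norm (f x))\<^sup>2)"

lemma square_integrable_measurable [measurable_dest]:
  "square_integrable f \<Longrightarrow> f \<in> borel_measurable lebesgue"
  by (simp add: square_integrable_def)

lemma square_integrable_integrable:
  "square_integrable f \<Longrightarrow> integrable lebesgue (\<lambda>x. (norm (f x))\<^sup>2)"
  by (simp add: square_integrable_def)

lemma square_integrable_inner:
  assumes f: "square_integrable f" and g: "square_integrable g"
  shows "integrable lebesgue (\<lambda>x. f x \<bullet> g x)"
proof (rule Bochner_Integration.integrable_bound)
  show "integrable lebesgue (\<lambda>x. (norm (f x))\<^sup>2 + (norm (g x))\<^sup>2)"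
    using f g by (intro Bochner_Integration.integrable_add square_integrable_integrable)
  show "(\<lambda>x. f x \<bullet> g x) \<in> borel_measurable lebesgue"
    using f[THEN square_integrable_measurable] g[THEN square_integrable_measurable] by measurable
  have "\<bar>a \<bullet> b\<bar> \<le> (norm a)\<^sup>2 + (norm b)\<^sup>2" for a b :: 'b
  proof -
    have "\<bar>a \<bullet> b\<bar> \<le> norm a * norm b" by (rule Cauchy_Schwarz_ineq2)
    moreover have "2 * (norm a * norm b) \<le> (norm a)\<^sup>2 + (norm b)\<^sup>2"
      using sum_squares_bound[of "norm a" "norm b"] by simp
    moreover have "0 \<le> norm a * norm b" by simp
    ultimately show ?thesis by linarith
  qed
  then show "AE x in lebesgue. norm (f x \<bullet> g x) \<le> norm ((norm (f x))\<^sup>2 + (norm (g x))\<^sup>2)"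
    by (intro AE_I2) simp
qed

lemma square_integrable_add:
  assumes f: "square_integrable f" and g: "square_integrable g"
  shows "square_integrable (\<lambda>x. f x + g x)"
proof -
  have "integrable lebesgue (\<lambda>x. (norm (f x))\<^sup>2 + (norm (g x))\<^sup>2 + 2 * (f x \<bullet> g x))"
    using assms by (intro Bochner_Integration.integrable_add integrable_mult_right square_integrable_inner
        square_integrable_integrable)
  moreover have "(norm (f x))\<^sup>2 + (norm (g x))\<^sup>2 + 2 * (f x \<bullet> g x) = (norm (f x + g x))\<^sup>2" for x
    by (simp add: power2_norm_eq_inner inner_simps inner_commute)
  ultimately show ?thesis
    using f[THEN square_integrable_measurable] g[THEN square_integrable_measurable]
    by (simp add: square_integrable_def)
qed

lemma square_integrable_scaleR:
  "square_integrable f \<Longrightarrow> square_integrable (\<lambda>x. c *\<^sub>R f x)"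
  by (auto simp: square_integrable_def power_mult_distrib)

lemma square_integrable_zero: "square_integrable (\<lambda>x. 0)"
  by (simp add: square_integrable_def)

lemma square_integrable_uminus: "square_integrable f \<Longrightarrow> square_integrable (\<lambda>x. - f x)"
  by (simp add: square_integrable_def)

lemma square_integrable_diff:
  "square_integrable f \<Longrightarrow> square_integrable g \<Longrightarrow> square_integrable (\<lambda>x. f x - g x)"
  using square_integrable_add[of f "\<lambda>x. - g x"] square_integrable_uminus[of g] by simp

lemma square_integrable_cong_AE:
  assumes f: "square_integrable f" and g: "g \<in> borel_measurable lebesgue"
    and eq: "AE x in lebesgue. f x = g x"
  shows "square_integrable g"
proof -
  have "integrable lebesgue (\<lambda>x. (norm (g x))\<^sup>2)"
  proof (rule integrable_cong_AE_imp)
    show "integrable lebesgue (\<lambda>x. (norm (f x))\<^sup>2)" using f by (rule square_integrable_integrable)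
    show "(\<lambda>x. (norm (g x))\<^sup>2) \<in> borel_measurable lebesgue" using g by measurable
    show "AE x in lebesgue. (norm (f x))\<^sup>2 = (norm (g x))\<^sup>2" using eq by eventually_elim simp
  qed
  then show ?thesis using g by (simp add: square_integrable_def)
qed

text \<open>Square integrability is part of the relation, which makes it a partial equivalence whose
  quotient contains only classes of square integrable functions.\<close>

definition eq_L2 :: "('a::euclidean_space \<Rightarrow> 'b::euclidean_space) \<Rightarrow> ('a \<Rightarrow> 'b) \<Rightarrow> bool" where
  "eq_L2 f g \<longleftrightarrow> square_integrable f \<and> square_integrable g \<and> (AE x in lebesgue. f x = g x)"

quotient_type (overloaded) ('a, 'b) L2 = "'a::euclidean_space \<Rightarrow> 'b::euclidean_space" / partial: eq_L2
proof (rule part_equivpI)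
  show "\<exists>f :: 'a \<Rightarrow> 'b. eq_L2 f f"
    using square_integrable_zero by (auto simp: eq_L2_def)
  show "transp (eq_L2 :: ('a \<Rightarrow> 'b) \<Rightarrow> _)"
  proof (rule transpI)
    fix f g h :: "'a \<Rightarrow> 'b"
    assume "eq_L2 f g" "eq_L2 g h"
    moreover from this have "AE x in lebesgue. f x = g x" "AE x in lebesgue. g x = h x"
      by (auto simp: eq_L2_def)
    then have "AE x in lebesgue. f x = h x" by eventually_elim simp
    ultimately show "eq_L2 f h" by (auto simp: eq_L2_def)
  qed
  show "symp (eq_L2 :: ('a \<Rightarrow> 'b) \<Rightarrow> _)"
    by (rule sympI) (auto simp: eq_L2_def elim: eventually_mono)
qed

lemma rep_L2: "square_integrable (rep_L2 x)"
  using Quotient3_rep_reflp[OF Quotient3_L2, of x] by (simp add: eq_L2_def)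

lemmas rep_L2_measurable [measurable] = rep_L2[THEN square_integrable_measurable]

lemma abs_rep_L2 [simp]: "abs_L2 (rep_L2 x) = x"
  by (rule Quotient3_abs_rep[OF Quotient3_L2])

lemma abs_L2_eqI:
  "square_integrable f \<Longrightarrow> square_integrable g \<Longrightarrow> AE x in lebesgue. f x = g x \<Longrightarrow> abs_L2 f = abs_L2 g"
  by (rule Quotient3_rel_abs[OF Quotient3_L2]) (simp add: eq_L2_def)

lemma rep_abs_L2:
  assumes "square_integrable f"
  shows "AE x in lebesgue. rep_L2 (abs_L2 f) x = f x"
proof -
  have "abs_L2 (rep_L2 (abs_L2 f)) = abs_L2 f" by simp
  then show ?thesis
    using Quotient3_rel[OF Quotient3_L2, of "rep_L2 (abs_L2 f)" f] assms rep_L2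
    by (auto simp: eq_L2_def)
qed

lemma L2_eqI: "AE t in lebesgue. rep_L2 x t = rep_L2 y t \<Longrightarrow> x = y"
  using abs_L2_eqI[OF rep_L2 rep_L2, of x y] by simp

section \<open>Vector space and inner product of the quotient\<close>

instantiation L2 :: (euclidean_space, euclidean_space) real_vector
begin
definition zero_L2 :: "('a, 'b) L2" where "zero_L2 = abs_L2 (\<lambda>t. 0)"
definition plus_L2 :: "('a, 'b) L2 \<Rightarrow> ('a, 'b) L2 \<Rightarrow> ('a, 'b) L2" where
  "plus_L2 x y = abs_L2 (\<lambda>t. rep_L2 x t + rep_L2 y t)"
definition minus_L2 :: "('a, 'b) L2 \<Rightarrow> ('a, 'b) L2 \<Rightarrow> ('a, 'b) L2" where
  "minus_L2 x y = abs_L2 (\<lambda>t. rep_L2 x t - rep_L2 y t)"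
definition uminus_L2 :: "('a, 'b) L2 \<Rightarrow> ('a, 'b) L2" where
  "uminus_L2 x = abs_L2 (\<lambda>t. - rep_L2 x t)"
definition scaleR_L2 :: "real \<Rightarrow> ('a, 'b) L2 \<Rightarrow> ('a, 'b) L2" where
  "scaleR_L2 c x = abs_L2 (\<lambda>t. c *\<^sub>R rep_L2 x t)"

lemma rep_zero_L2: "AE t in lebesgue. rep_L2 (0 :: ('a, 'b) L2) t = 0"
  unfolding zero_L2_def by (rule rep_abs_L2[OF square_integrable_zero])
lemma rep_plus_L2: "AE t in lebesgue. rep_L2 (x + y :: ('a, 'b) L2) t = rep_L2 x t + rep_L2 y t"
  unfolding plus_L2_def by (rule rep_abs_L2[OF square_integrable_add[OF rep_L2 rep_L2]])
lemma rep_minus_L2: "AE t in lebesgue. rep_L2 (x - y :: ('a, 'b) L2) t = rep_L2 x t - rep_L2 y t"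
  unfolding minus_L2_def by (rule rep_abs_L2[OF square_integrable_diff[OF rep_L2 rep_L2]])
lemma rep_uminus_L2: "AE t in lebesgue. rep_L2 (- x :: ('a, 'b) L2) t = - rep_L2 x t"
  unfolding uminus_L2_def by (rule rep_abs_L2[OF square_integrable_uminus[OF rep_L2]])
lemma rep_scaleR_L2: "AE t in lebesgue. rep_L2 (c *\<^sub>R x :: ('a, 'b) L2) t = c *\<^sub>R rep_L2 x t"
  unfolding scaleR_L2_def by (rule rep_abs_L2[OF square_integrable_scaleR[OF rep_L2]])

instance
proof
  fix x y z :: "('a, 'b) L2" and a b :: real
  show "x + y + z = x + (y + z)"
    by (rule L2_eqI) (use rep_plus_L2[of "x + y" z] rep_plus_L2[of x y] rep_plus_L2[of x "y + z"] rep_plus_L2[of y z] in \<open>eventually_elim, simp add: algebra_simps\<close>)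
  show "x + y = y + x"
    by (rule L2_eqI) (use rep_plus_L2[of x y] rep_plus_L2[of y x] in \<open>eventually_elim, simp\<close>)
  show "0 + x = x"
    by (rule L2_eqI) (use rep_plus_L2[of 0 x] rep_zero_L2 in \<open>eventually_elim, simp\<close>)
  show "- x + x = 0"
    by (rule L2_eqI) (use rep_plus_L2[of "- x" x] rep_uminus_L2[of x] rep_zero_L2 in \<open>eventually_elim, simp\<close>)
  show "x - y = x + - y"
    by (rule L2_eqI) (use rep_minus_L2[of x y] rep_plus_L2[of x "- y"] rep_uminus_L2[of y] in \<open>eventually_elim, simp\<close>)
  show "a *\<^sub>R (x + y) = a *\<^sub>R x + a *\<^sub>R y"
    by (rule L2_eqI) (use rep_scaleR_L2[of a "x + y"] rep_plus_L2[of x y] rep_plus_L2[of "a *\<^sub>R x" "a *\<^sub>R y"]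
      rep_scaleR_L2[of a x] rep_scaleR_L2[of a y] in \<open>eventually_elim, simp add: scaleR_add_right\<close>)
  show "(a + b) *\<^sub>R x = a *\<^sub>R x + b *\<^sub>R x"
    by (rule L2_eqI) (use rep_scaleR_L2[of "a + b" x] rep_plus_L2[of "a *\<^sub>R x" "b *\<^sub>R x"]
      rep_scaleR_L2[of a x] rep_scaleR_L2[of b x] in \<open>eventually_elim, simp add: scaleR_add_left\<close>)
  show "a *\<^sub>R b *\<^sub>R x = (a * b) *\<^sub>R x"
    by (rule L2_eqI) (use rep_scaleR_L2[of a "b *\<^sub>R x"] rep_scaleR_L2[of b x] rep_scaleR_L2[of "a * b" x] in \<open>eventually_elim, simp\<close>)
  show "1 *\<^sub>R x = x"
    by (rule L2_eqI) (use rep_scaleR_L2[of 1 x] in \<open>eventually_elim, simp\<close>)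
qed
end

instantiation L2 :: (euclidean_space, euclidean_space) real_inner
begin
definition inner_L2 :: "('a, 'b) L2 \<Rightarrow> ('a, 'b) L2 \<Rightarrow> real" where
  "inner_L2 x y = (LINT t|lebesgue. rep_L2 x t \<bullet> rep_L2 y t)"
definition norm_L2 :: "('a, 'b) L2 \<Rightarrow> real" where "norm_L2 x = sqrt (x \<bullet> x)"
definition dist_L2 :: "('a, 'b) L2 \<Rightarrow> ('a, 'b) L2 \<Rightarrow> real" where "dist_L2 x y = norm (x - y)"
definition sgn_L2 :: "('a, 'b) L2 \<Rightarrow> ('a, 'b) L2" where "sgn_L2 x = x /\<^sub>R norm x"
definition uniformity_L2 :: "(('a, 'b) L2 \<times> ('a, 'b) L2) filter" where
  "uniformity_L2 = (INF e\<in>{0<..}. principal {(x, y). dist x y < e})"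
definition open_L2 :: "('a, 'b) L2 set \<Rightarrow> bool" where
  "open_L2 S = (\<forall>x\<in>S. \<forall>\<^sub>F (x', y) in uniformity. x' = x \<longrightarrow> y \<in> S)"

lemma integrable_inner_rep_L2:
  "integrable lebesgue (\<lambda>t. rep_L2 (x :: ('a, 'b) L2) t \<bullet> rep_L2 y t)"
  by (rule square_integrable_inner[OF rep_L2 rep_L2])

instance
proof
  fix x y z :: "('a, 'b) L2" and r :: real and S :: "('a, 'b) L2 set"
  show "dist x y = norm (x - y)" by (simp add: dist_L2_def)
  show "sgn x = x /\<^sub>R norm x" by (simp add: sgn_L2_def)
  show "uniformity = (INF e\<in>{0<..}. principal {(x :: ('a, 'b) L2, y). dist x y < e})"
    by (simp add: uniformity_L2_def)
  show "open S = (\<forall>x\<in>S. \<forall>\<^sub>F (x', y) in uniformity. x' = x \<longrightarrow> y \<in> S)"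
    by (simp add: open_L2_def)
  show "x \<bullet> y = y \<bullet> x" by (simp add: inner_L2_def inner_commute)
  show "(x + y) \<bullet> z = x \<bullet> z + y \<bullet> z"
  proof -
    have "(x + y) \<bullet> z = (LINT t|lebesgue. rep_L2 x t \<bullet> rep_L2 z t + rep_L2 y t \<bullet> rep_L2 z t)"
      unfolding inner_L2_def using rep_plus_L2[of x y]
      by (intro integral_cong_AE) (auto intro!: borel_measurable_inner rep_L2_measurable
          borel_measurable_add simp: inner_add_left elim: eventually_mono)
    then show ?thesis
      by (simp add: inner_L2_def integrable_inner_rep_L2)
  qed
  show "(r *\<^sub>R x) \<bullet> y = r * (x \<bullet> y)"
  proof -
    have "(r *\<^sub>R x) \<bullet> y = (LINT t|lebesgue. r * (rep_L2 x t \<bullet> rep_L2 y t))"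
      unfolding inner_L2_def using rep_scaleR_L2[of r x]
      by (intro integral_cong_AE) (auto intro!: borel_measurable_inner rep_L2_measurable
          borel_measurable_times elim: eventually_mono)
    then show ?thesis
      by (simp add: inner_L2_def)
  qed
  show "0 \<le> x \<bullet> x" by (simp add: inner_L2_def)
  show "x \<bullet> x = 0 \<longleftrightarrow> x = 0"
  proof
    assume "x \<bullet> x = 0"
    then have *: "AE t in lebesgue. rep_L2 x t \<bullet> rep_L2 x t = 0"
      unfolding inner_L2_def
      by (subst (asm) integral_nonneg_eq_0_iff_AE) (auto intro: integrable_inner_rep_L2)
    show "x = 0"
      by (rule L2_eqI) (use * rep_zero_L2 in \<open>eventually_elim, simp\<close>)
  next
    assume "x = 0"
    have "AE t in lebesgue. rep_L2 (0 :: ('a, 'b) L2) t \<bullet> rep_L2 (0 :: ('a, 'b) L2) t = 0"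
      using rep_zero_L2[where 'a='a and 'b='b] by eventually_elim simp
    then have "(0 :: ('a, 'b) L2) \<bullet> 0 = 0"
      unfolding inner_L2_def by (rule integral_eq_zero_AE)
    then show "x \<bullet> x = 0" using \<open>x = 0\<close> by simp
  qed
  show "norm x = sqrt (x \<bullet> x)" by (simp add: norm_L2_def)
qed
end

lemma norm_sq_L2: "(norm x)\<^sup>2 = (LINT t|lebesgue. (norm (rep_L2 x t))\<^sup>2)"
  by (simp add: power2_norm_eq_inner inner_L2_def)

lemma nn_integral_norm_sq_L2: "(\<integral>\<^sup>+t. ennreal ((norm (rep_L2 x t))\<^sup>2) \<partial>lebesgue) = ennreal ((norm x)\<^sup>2)"
  unfolding norm_sq_L2
  by (rule nn_integral_eq_integral) (auto intro: square_integrable_integrable[OF rep_L2])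

lemma nn_integral_norm_diff_sq_L2:
  "(\<integral>\<^sup>+t. ennreal ((norm (rep_L2 x t - rep_L2 y t))\<^sup>2) \<partial>lebesgue) = ennreal ((norm (x - y))\<^sup>2)"
proof -
  have "(\<integral>\<^sup>+t. ennreal ((norm (rep_L2 x t - rep_L2 y t))\<^sup>2) \<partial>lebesgue)
      = (\<integral>\<^sup>+t. ennreal ((norm (rep_L2 (x - y) t))\<^sup>2) \<partial>lebesgue)"
    by (rule nn_integral_cong_AE) (use rep_minus_L2[of x y] in \<open>eventually_elim, simp\<close>)
  then show ?thesis by (simp add: nn_integral_norm_sq_L2)
qed

lemma inner_abs_L2:
  assumes "square_integrable f" "square_integrable g"
  shows "abs_L2 f \<bullet> abs_L2 g = (LINT t|lebesgue. f t \<bullet> g t)"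
  unfolding inner_L2_def
  using rep_abs_L2[OF assms(1)] rep_abs_L2[OF assms(2)] assms[THEN square_integrable_measurable]
  by (intro integral_cong_AE) (auto intro!: borel_measurable_inner rep_L2_measurable elim: eventually_elim2)

lemma norm_sq_abs_L2:
  assumes "square_integrable f"
  shows "(norm (abs_L2 f))\<^sup>2 = (LINT t|lebesgue. (norm (f t))\<^sup>2)"
  using inner_abs_L2[OF assms assms] by (simp add: power2_norm_eq_inner)


lemma abs_L2_add:
  assumes "square_integrable f" "square_integrable g"
  shows "abs_L2 (\<lambda>t. f t + g t) = abs_L2 f + abs_L2 g"
  by (rule L2_eqI)
     (use rep_abs_L2[OF assms(1)] rep_abs_L2[OF assms(2)] rep_plus_L2[of "abs_L2 f" "abs_L2 g"]
        rep_abs_L2[OF square_integrable_add[OF assms]] in \<open>eventually_elim, simp\<close>)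

lemma abs_L2_scaleR:
  assumes "square_integrable f"
  shows "abs_L2 (\<lambda>t. c *\<^sub>R f t) = c *\<^sub>R abs_L2 f"
  by (rule L2_eqI)
     (use rep_abs_L2[OF assms] rep_scaleR_L2[of c "abs_L2 f"]
        rep_abs_L2[OF square_integrable_scaleR[OF assms]] in \<open>eventually_elim, simp\<close>)

text \<open>Weighted by 2^n, the squared increments still have summable integrals, at most 2^n 4^(-
  n). Hence at almost every point the n-th increment is eventually below (1/2)^(n / 2), which is
  summable.\<close>

lemma L2_AE_Cauchy:
  fixes X :: "nat \<Rightarrow> ('a::euclidean_space, 'b::euclidean_space) L2"
  assumes X: "\<And>n. norm (X (Suc n) - X n) \<le> (1/2) ^ n"
  shows "AE t in lebesgue. Cauchy (\<lambda>n. rep_L2 (X n) t)"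
proof -
  define D where "D n t = (norm (rep_L2 (X (Suc n)) t - rep_L2 (X n) t))\<^sup>2" for n t
  have [measurable]: "D n \<in> borel_measurable lebesgue" for n
    unfolding D_def by measurable
  have "(\<integral>\<^sup>+t. (\<Sum>n. ennreal (2 ^ n * D n t)) \<partial>lebesgue) = (\<Sum>n. \<integral>\<^sup>+t. ennreal (2 ^ n * D n t) \<partial>lebesgue)"
    by (rule nn_integral_suminf) measurable
  also have "\<dots> \<le> (\<Sum>n. ennreal ((1/2) ^ n))"
  proof (rule suminf_le)
    fix n
    have "(\<integral>\<^sup>+t. ennreal (2 ^ n * D n t) \<partial>lebesgue) = ennreal (2 ^ n) * (\<integral>\<^sup>+t. ennreal (D n t) \<partial>lebesgue)"
      by (simp add: ennreal_mult' nn_integral_cmult)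
    also have "(\<integral>\<^sup>+t. ennreal (D n t) \<partial>lebesgue) = ennreal ((norm (X (Suc n) - X n))\<^sup>2)"
      unfolding D_def by (rule nn_integral_norm_diff_sq_L2)
    also have "ennreal (2 ^ n) * \<dots> \<le> ennreal (2 ^ n) * ennreal (((1/2) ^ n)\<^sup>2)"
      using X[of n] by (intro mult_left_mono ennreal_leI power_mono) auto
    also have "\<dots> = ennreal ((1/2) ^ n)"
      by (simp add: field_simps power2_eq_square flip: ennreal_mult')
    finally show "(\<integral>\<^sup>+t. ennreal (2 ^ n * D n t) \<partial>lebesgue) \<le> ennreal ((1/2) ^ n)" .
  qed auto
  also have "\<dots> = ennreal (\<Sum>n. (1/2) ^ n)"
    by (rule suminf_ennreal2) (auto intro: summable_geometric)
  also have "\<dots> < \<infinity>" by simp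
  finally have "AE t in lebesgue. (\<Sum>n. ennreal (2 ^ n * D n t)) \<noteq> \<infinity>"
    by (intro nn_integral_PInf_AE) (auto simp: less_top)
  then show ?thesis
  proof eventually_elim
    case (elim t)
    have "summable (\<lambda>n. 2 ^ n * D n t)"
      using elim by (intro summable_suminf_not_top) (auto simp: D_def)
    then have "(\<lambda>n. 2 ^ n * D n t) \<longlonglongrightarrow> 0" by (rule summable_LIMSEQ_zero)
    then have "eventually (\<lambda>n. 2 ^ n * D n t < 1) sequentially"
      by (rule order_tendstoD) simp
    then obtain N where N: "\<And>n. n \<ge> N \<Longrightarrow> 2 ^ n * D n t < 1"
      by (auto simp: eventually_sequentially)
    define r where "r = sqrt (1/2)"
    have r: "0 < r" "r < 1" "r\<^sup>2 = 1/2" by (auto simp: r_def real_sqrt_lt_1_iff)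
    have "norm (rep_L2 (X (Suc n)) t - rep_L2 (X n) t) \<le> r ^ n" if "n \<ge> N" for n
    proof (rule power2_le_imp_le)
      have "(r ^ n)\<^sup>2 = (1/2) ^ n" by (metis power_commutes power_mult r(3) mult.commute)
      moreover have "D n t \<le> (1/2) ^ n" using N[OF that] by (simp add: field_simps)
      ultimately show "(norm (rep_L2 (X (Suc n)) t - rep_L2 (X n) t))\<^sup>2 \<le> (r ^ n)\<^sup>2"
        by (simp add: D_def)
    qed (use r in auto)
    moreover have "summable (\<lambda>n. r ^ n)" using r by (intro summable_geometric) auto
    ultimately have "summable (\<lambda>n. rep_L2 (X (Suc n)) t - rep_L2 (X n) t)"
      using summable_comparison_test'[of "\<lambda>n. r ^ n" N "\<lambda>n. rep_L2 (X (Suc n)) t - rep_L2 (X n) t"] by blast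
    then have "convergent (\<lambda>n. \<Sum>k<n. rep_L2 (X (Suc k)) t - rep_L2 (X k) t)"
      by (simp add: summable_iff_convergent)
    then have "convergent (\<lambda>n. rep_L2 (X n) t - rep_L2 (X 0) t)"
      by (simp add: sum_lessThan_telescope[of "\<lambda>n. rep_L2 (X n) t"])
    then obtain l where "(\<lambda>n. rep_L2 (X n) t - rep_L2 (X 0) t) \<longlonglongrightarrow> l" by (auto simp: convergent_def)
    from tendsto_add[OF this tendsto_const[of "rep_L2 (X 0) t"]]
    show ?case by (auto intro!: LIMSEQ_imp_Cauchy)
  qed
qed

text \<open>Riesz-Fischer: a subsequence with geometrically small increments converges almost
  everywhere, and Fatou's lemma turns the pointwise limit into a limit in norm.\<close>

instance L2 :: (euclidean_space, euclidean_space) banach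
proof
  fix X :: "nat \<Rightarrow> ('a, 'b) L2"
  assume "Cauchy X"
  have "\<exists>r. strict_mono r \<and> (\<forall>n. norm (X (r (Suc n)) - X (r n)) \<le> (1/2) ^ n)"
  proof -
    have "\<exists>M. \<forall>m\<ge>M. \<forall>n\<ge>M. dist (X m) (X n) < (1/2) ^ k" for k
      using \<open>Cauchy X\<close> by (auto simp: Cauchy_def)
    then obtain M where M: "\<And>k m n. m \<ge> M k \<Longrightarrow> n \<ge> M k \<Longrightarrow> dist (X m) (X n) < (1/2) ^ k"
      by metis
    define r where "r = rec_nat (M 0) (\<lambda>k m. max (Suc m) (M (Suc k)))"
    have r: "r (Suc k) = max (Suc (r k)) (M (Suc k))" "r 0 = M 0" for k by (auto simp: r_def)
    have rM: "r k \<ge> M k" for k by (cases k) (auto simp: r)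
    have "strict_mono r" by (rule strict_mono_Suc_iff[THEN iffD2]) (auto simp: r)
    moreover have "norm (X (r (Suc n)) - X (r n)) \<le> (1/2) ^ n" for n
    proof -
      have "M n \<le> r (Suc n)" using rM[of n] r(1)[of n] by linarith
      from M[OF this rM[of n]] show ?thesis by (simp add: dist_norm)
    qed
    ultimately show ?thesis by blast
  qed
  then obtain r where r: "strict_mono r" "\<And>n. norm (X (r (Suc n)) - X (r n)) \<le> (1/2) ^ n" by blast
  define f where "f n = rep_L2 (X (r n))" for n
  have [measurable]: "f n \<in> borel_measurable lebesgue" for n unfolding f_def by measurable
  have Cau: "AE t in lebesgue. Cauchy (\<lambda>n. f n t)"
    unfolding f_def using L2_AE_Cauchy[of "\<lambda>n. X (r n)"] r by simp
  define g where "g t = lim (\<lambda>n. f n t)" for t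
  have [measurable]: "g \<in> borel_measurable lebesgue"
    unfolding g_def by measurable
  have lim: "AE t in lebesgue. (\<lambda>n. f n t) \<longlonglongrightarrow> g t"
    using Cau by eventually_elim (auto simp: g_def Cauchy_convergent_iff convergent_LIMSEQ_iff)
  \<comment> \<open>Fatou's lemma, stated for integrals with values in [0, \<infinity>] because g is
    not yet known to be square integrable.\<close>
  have bound: "(\<integral>\<^sup>+t. ennreal ((norm (g t - f m t))\<^sup>2) \<partial>lebesgue) \<le> ennreal (e\<^sup>2)"
    if e: "\<And>n. n \<ge> m \<Longrightarrow> norm (X (r n) - X (r m)) \<le> e" for m e
  proof -
    have "(\<integral>\<^sup>+t. ennreal ((norm (g t - f m t))\<^sup>2) \<partial>lebesgue)
        = (\<integral>\<^sup>+t. liminf (\<lambda>n. ennreal ((norm (f n t - f m t))\<^sup>2)) \<partial>lebesgue)"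
    proof (rule nn_integral_cong_AE, use lim in eventually_elim)
      case (elim t)
      then have "(\<lambda>n. ennreal ((norm (f n t - f m t))\<^sup>2)) \<longlonglongrightarrow> ennreal ((norm (g t - f m t))\<^sup>2)"
        by (intro tendsto_intros)
      then show ?case by (rule lim_imp_Liminf[OF sequentially_bot, THEN sym])
    qed
    also have "\<dots> \<le> liminf (\<lambda>n. \<integral>\<^sup>+t. ennreal ((norm (f n t - f m t))\<^sup>2) \<partial>lebesgue)"
      by (rule nn_integral_liminf) measurable
    also have "\<dots> = liminf (\<lambda>n. ennreal ((norm (X (r n) - X (r m)))\<^sup>2))"
      unfolding f_def by (simp add: nn_integral_norm_diff_sq_L2)
    also have "\<dots> \<le> limsup (\<lambda>n. ennreal ((norm (X (r n) - X (r m)))\<^sup>2))"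
      by (rule Liminf_le_Limsup) simp
    also have "\<dots> \<le> ennreal (e\<^sup>2)"
      by (rule Limsup_bounded, rule eventually_sequentiallyI[of m])
         (use e in \<open>auto intro!: ennreal_leI power_mono\<close>)
    finally show ?thesis .
  qed
  have small: "\<exists>N. \<forall>m\<ge>N. \<forall>n\<ge>m. norm (X (r n) - X (r m)) \<le> e" if "e > 0" for e
  proof -
    obtain M where M: "\<And>m n. m \<ge> M \<Longrightarrow> n \<ge> M \<Longrightarrow> norm (X m - X n) < e"
      using \<open>Cauchy X\<close> \<open>e > 0\<close> unfolding Cauchy_def dist_norm by blast
    have "norm (X (r n) - X (r m)) \<le> e" if "m \<ge> M" "n \<ge> m" for m n
      using M[of "r n" "r m"] seq_suble[OF r(1), of n] seq_suble[OF r(1), of m] that by simp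
    then show ?thesis by blast
  qed
  have sq: "square_integrable (\<lambda>t. g t - f m t)" if "\<And>n. n \<ge> m \<Longrightarrow> norm (X (r n) - X (r m)) \<le> 1" for m
  proof -
    have "(\<integral>\<^sup>+t. ennreal ((norm (g t - f m t))\<^sup>2) \<partial>lebesgue) < \<infinity>"
      using bound[of m 1] that by (auto simp: less_top[symmetric] top_unique)
    then have "integrable lebesgue (\<lambda>t. (norm (g t - f m t))\<^sup>2)"
      by (intro integrableI_bounded) auto
    then show ?thesis by (simp add: square_integrable_def)
  qed
  obtain N where N: "\<And>m n. m \<ge> N \<Longrightarrow> n \<ge> m \<Longrightarrow> norm (X (r n) - X (r m)) \<le> 1"
    using small[of 1] by auto
  \<comment> \<open>Membership of g follows from its finite distance to a single term of the
    sequence.\<close>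
  have "square_integrable (\<lambda>t. (g t - f N t) + f N t)"
    using N by (intro square_integrable_add sq) (auto simp: f_def rep_L2)
  then have g: "square_integrable g" by simp
  have "(\<lambda>n. X (r n)) \<longlonglongrightarrow> abs_L2 g"
  proof (rule LIMSEQ_I)
    fix e :: real assume "0 < e"
    then obtain N where N: "\<And>m n. m \<ge> N \<Longrightarrow> n \<ge> m \<Longrightarrow> norm (X (r n) - X (r m)) \<le> e / 2"
      using small[of "e / 2"] by auto
    have "norm (X (r n) - abs_L2 g) < e" if "n \<ge> N" for n
    proof -
      have "ennreal ((norm (abs_L2 g - X (r n)))\<^sup>2)
          = (\<integral>\<^sup>+t. ennreal ((norm (rep_L2 (abs_L2 g) t - f n t))\<^sup>2) \<partial>lebesgue)"
        unfolding f_def by (simp add: nn_integral_norm_diff_sq_L2)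
      also have "\<dots> = (\<integral>\<^sup>+t. ennreal ((norm (g t - f n t))\<^sup>2) \<partial>lebesgue)"
        by (rule nn_integral_cong_AE) (use rep_abs_L2[OF g] in \<open>eventually_elim, simp\<close>)
      also have "\<dots> \<le> ennreal ((e / 2)\<^sup>2)" using N that by (intro bound) auto
      finally have "(norm (abs_L2 g - X (r n)))\<^sup>2 \<le> (e / 2)\<^sup>2" by (simp add: ennreal_le_iff)
      then have "norm (abs_L2 g - X (r n)) \<le> e / 2" by (rule power2_le_imp_le) (use \<open>0 < e\<close> in simp)
      then show ?thesis using \<open>0 < e\<close> by (simp add: norm_minus_commute)
    qed
    then show "\<exists>no. \<forall>n\<ge>no. norm (X (r n) - abs_L2 g) < e" by blast
  qed
  then have "X \<longlonglongrightarrow> abs_L2 g"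
    using Cauchy_converges_subseq[OF \<open>Cauchy X\<close> r(1)] by (simp add: o_def)
  then show "convergent X" by (auto simp: convergent_def)
qed

text \<open>Convergence in norm means that the squared differences tend to zero in L^1, and L^1
  convergence has an almost everywhere convergent subsequence.\<close>

lemma L2_tendsto_AE_subseq:
  fixes X :: "nat \<Rightarrow> ('a::euclidean_space, 'b::euclidean_space) L2"
  assumes "X \<longlonglongrightarrow> x"
  shows "\<exists>r. strict_mono r \<and> (AE t in lebesgue. (\<lambda>n. rep_L2 (X (r n)) t) \<longlonglongrightarrow> rep_L2 x t)"
proof -
  define u where "u n t = (norm (rep_L2 (X n - x) t))\<^sup>2" for n t
  have "(\<lambda>n. (norm (X n - x))\<^sup>2) \<longlonglongrightarrow> 0\<^sup>2"
    using assms by (intro tendsto_intros) (simp add: tendsto_norm_zero_iff LIM_zero_iff)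
  then have "(\<lambda>n. LINT t|lebesgue. norm (u n t)) \<longlonglongrightarrow> 0"
    by (simp add: u_def norm_sq_L2)
  moreover have "integrable lebesgue (u n)" for n
    unfolding u_def[abs_def] by (rule square_integrable_integrable[OF rep_L2])
  ultimately obtain r where r: "strict_mono r" "AE t in lebesgue. (\<lambda>n. u (r n) t) \<longlonglongrightarrow> 0"
    using tendsto_L1_AE_subseq[of lebesgue u] by blast
  have "AE t in lebesgue. \<forall>n. rep_L2 (X (r n) - x) t = rep_L2 (X (r n)) t - rep_L2 x t"
    by (subst AE_all_countable) (auto intro: rep_minus_L2)
  with r(2) have "AE t in lebesgue. (\<lambda>n. rep_L2 (X (r n)) t) \<longlonglongrightarrow> rep_L2 x t"
  proof eventually_elim
    case (elim t)
    then have "(\<lambda>n. sqrt ((norm (rep_L2 (X (r n)) t - rep_L2 x t))\<^sup>2)) \<longlonglongrightarrow> sqrt 0"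
      by (intro tendsto_real_sqrt) (simp add: u_def)
    then show ?case by (simp add: tendsto_norm_zero_iff LIM_zero_iff)
  qed
  then show ?thesis using r by blast
qed

section \<open>Orthogonal projection and Riesz representation\<close>

text \<open>A minimising sequence for the distance is Cauchy by the parallelogram law; orthogonality
  of the remainder is the vanishing first variation at the minimum.\<close>

lemma subspace_nearest_point:
  fixes S :: "'h::{real_inner,banach} set"
  assumes S: "subspace S" "closed S"
  shows "\<exists>y\<in>S. \<forall>w\<in>S. (x - y) \<bullet> w = 0"
proof -
  define D where "D = (INF y\<in>S. (norm (x - y))\<^sup>2)"
  have bdd: "bdd_below ((\<lambda>y. (norm (x - y))\<^sup>2) ` S)"
    by (rule bdd_belowI[of _ 0]) auto
  have D: "D \<le> (norm (x - y))\<^sup>2" if "y \<in> S" for y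
    unfolding D_def by (rule cINF_lower[OF bdd that])
  have "\<exists>y\<in>S. (norm (x - y))\<^sup>2 < D + 1 / Suc n" for n
  proof -
    have "S \<noteq> {}" using subspace_0[OF S(1)] by blast
    moreover have "(INF y\<in>S. (norm (x - y))\<^sup>2) < D + 1 / Suc n"
      by (simp add: D_def)
    ultimately show ?thesis using cINF_less_iff[OF _ bdd] by blast
  qed
  then obtain y where y: "\<And>n. y n \<in> S" "\<And>n. (norm (x - y n))\<^sup>2 < D + 1 / Suc n" by metis
  have par: "(norm (u - v))\<^sup>2 \<le> 2 * ((norm (x - u))\<^sup>2 - D) + 2 * ((norm (x - v))\<^sup>2 - D)"
    if "u \<in> S" "v \<in> S" for u v
  proof -
    have "(1/2) *\<^sub>R (u + v) \<in> S" using S that by (intro subspace_scale subspace_add)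
    then have "D \<le> (norm (x - (1/2) *\<^sub>R (u + v)))\<^sup>2" by (rule D)
    moreover have "(norm (u - v))\<^sup>2 = 2 * (norm (x - u))\<^sup>2 + 2 * (norm (x - v))\<^sup>2 - 4 * (norm (x - (1/2) *\<^sub>R (u + v)))\<^sup>2"
      by (simp add: power2_norm_eq_inner inner_simps inner_commute algebra_simps)
    ultimately show ?thesis by simp
  qed
  \<comment> \<open>Pure arithmetic for the Cauchy estimate: both excesses over D are below C < E /
    4.\<close>
  have aux: "X < E" if "A \<le> C" "B \<le> C" "X \<le> 2 * (P - D) + 2 * (Q - D)" "P < D + A" "Q < D + B" "C < E / 4"
    for A B C X P Q E :: real
    using that unfolding right_diff_distrib by linarith
  have "Cauchy y"
  proof (rule CauchyI)
    fix e :: real assume "0 < e"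
    then obtain N where N: "1 / Suc N < e\<^sup>2 / 4"
      using reals_Archimedean[of "e\<^sup>2 / 4"] by (auto simp: inverse_eq_divide)
    have "norm (y m - y n) < e" if "m \<ge> N" "n \<ge> N" for m n
    proof -
      have "1 / real (Suc m) \<le> 1 / Suc N" "1 / real (Suc n) \<le> 1 / Suc N"
        using that by (auto intro!: divide_left_mono)
      then have "(norm (y m - y n))\<^sup>2 < e\<^sup>2"
        by (rule aux[OF _ _ par[OF y(1)[of m] y(1)[of n]] y(2)[of m] y(2)[of n] N])
      then show ?thesis using \<open>0 < e\<close> by (metis power_less_imp_less_base order_less_imp_le)
    qed
    then show "\<exists>M. \<forall>m\<ge>M. \<forall>n\<ge>M. norm (y m - y n) < e" by blast
  qed
  then obtain l where l: "y \<longlonglongrightarrow> l" using Cauchy_convergent convergent_def by blast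
  have lS: "l \<in> S" using closed_sequentially[OF S(2)] y(1) l by blast
  have "(norm (x - l))\<^sup>2 \<le> D"
  proof (rule LIMSEQ_le)
    show "(\<lambda>n. (norm (x - y n))\<^sup>2) \<longlonglongrightarrow> (norm (x - l))\<^sup>2" by (intro tendsto_intros l)
    have "(\<lambda>n. D + 1 / Suc n) \<longlonglongrightarrow> D + 0"
      using LIMSEQ_inverse_real_of_nat by (intro tendsto_add tendsto_const) (simp add: inverse_eq_divide)
    then show "(\<lambda>n. D + 1 / Suc n) \<longlonglongrightarrow> D" by simp
  qed (use y(2) less_imp_le in blast)
  then have min: "(norm (x - l))\<^sup>2 \<le> (norm (x - z))\<^sup>2" if "z \<in> S" for z using D[OF that] by linarith
  have "(x - l) \<bullet> w = 0" if w: "w \<in> S" for w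
  proof (cases "w = 0")
    case False
    \<comment> \<open>The multiple of w closest to x - l; minimality of l forces the gain c ((x - l)
      \<bullet> w) to be nonpositive.\<close>
    define c where "c = ((x - l) \<bullet> w) / (w \<bullet> w)"
    have "l + c *\<^sub>R w \<in> S" using S lS w by (intro subspace_add subspace_scale)
    from min[OF this] have le: "(norm (x - l))\<^sup>2 \<le> (norm ((x - l) - c *\<^sub>R w))\<^sup>2"
      by (simp add: diff_diff_eq)
    have exp: "(norm (u - c *\<^sub>R w))\<^sup>2 = (norm u)\<^sup>2 - 2 * (c * (u \<bullet> w)) + c * c * (w \<bullet> w)" for u
      by (simp add: power2_norm_eq_inner inner_diff_left inner_diff_right inner_commute)
    have pos: "0 < w \<bullet> w" using False by simp
    then have "c * c * (w \<bullet> w) = c * ((x - l) \<bullet> w)" by (simp add: c_def)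
    then have "c * ((x - l) \<bullet> w) \<le> 0" using le unfolding exp by linarith
    then have "((x - l) \<bullet> w) * ((x - l) \<bullet> w) \<le> 0"
      unfolding c_def times_divide_eq_left divide_le_0_iff using pos by linarith
    then have "((x - l) \<bullet> w)\<^sup>2 \<le> 0" by (simp add: power2_eq_square)
    then show ?thesis by simp
  qed simp
  then show ?thesis using lS by blast
qed

text \<open>Linearity follows from the uniqueness of the point with orthogonal remainder,
  boundedness from Cauchy-Schwarz applied to |P x|^2 = x \<bullet> P x.\<close>

lemma orthogonal_projection:
  fixes S :: "'h::{real_inner,banach} set"
  assumes S: "subspace S" "closed S"
  obtains P where "bounded_linear P" "\<And>x. P x \<in> S" "\<And>x. x \<in> S \<Longrightarrow> P x = x"
    "\<And>x w. w \<in> S \<Longrightarrow> P x \<bullet> w = x \<bullet> w"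
proof -
  obtain P where P: "\<And>x. P x \<in> S" and orth: "\<And>x w. w \<in> S \<Longrightarrow> (x - P x) \<bullet> w = 0"
    using subspace_nearest_point[OF S] by metis
  have uniq: "P x = y" if "y \<in> S" "\<And>w. w \<in> S \<Longrightarrow> (x - y) \<bullet> w = 0" for x y
  proof -
    have "P x - y \<in> S" using S P that by (intro subspace_diff)
    then have "(P x - y) \<bullet> (P x - y) = 0"
      using orth[of "P x - y" x] that(2)[of "P x - y"] by (simp add: inner_diff_left inner_diff_right)
    then show ?thesis by simp
  qed
  have "bounded_linear P"
  proof (rule bounded_linear_intro[where K=1])
    show "P (x + y) = P x + P y" for x y
    proof (rule uniq)
      show "P x + P y \<in> S" using S P by (intro subspace_add)
      show "(x + y - (P x + P y)) \<bullet> w = 0" if "w \<in> S" for w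
        using orth[OF that, of x] orth[OF that, of y] by (simp add: inner_diff_left inner_add_left)
    qed
    show "P (c *\<^sub>R x) = c *\<^sub>R P x" for c x
    proof (rule uniq)
      show "c *\<^sub>R P x \<in> S" using S P by (intro subspace_scale)
      show "(c *\<^sub>R x - c *\<^sub>R P x) \<bullet> w = 0" if "w \<in> S" for w
        using orth[OF that, of x] by (simp flip: scaleR_diff_right)
    qed
    show "norm (P x) \<le> norm x * 1" for x
    proof -
      have "(norm (P x))\<^sup>2 = x \<bullet> P x"
        using orth[OF P, of x x] by (simp add: power2_norm_eq_inner inner_diff_left inner_diff_right)
      also have "\<dots> \<le> norm x * norm (P x)" by (rule norm_cauchy_schwarz)
      finally show ?thesis by (cases "P x = 0") (auto simp: power2_eq_square)
    qed
  qed
  moreover have "P x = x" if "x \<in> S" for x by (rule uniq) (use that in auto)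
  moreover have "P x \<bullet> w = x \<bullet> w" if "w \<in> S" for x w
    using orth[OF that, of x] by (simp add: inner_diff_left inner_diff_right)
  ultimately show ?thesis using that P by blast
qed

text \<open>The kernel has a nonzero normal vector z, and x - (f x / f z) z lies in the kernel;
  pairing it with z exhibits the representing multiple of z.\<close>

theorem Riesz_representation:
  fixes f :: "'h::{real_inner,banach} \<Rightarrow> real"
  assumes f: "bounded_linear f"
  obtains y where "\<And>x. f x = y \<bullet> x"
proof (cases "\<exists>u. f u \<noteq> 0")
  case True
  then obtain u where u: "f u \<noteq> 0" by blast
  interpret f: bounded_linear f by (rule f)
  define S where "S = {x. f x = 0}"
  have "subspace S" by (auto simp: S_def subspace_def f.zero f.add f.scaleR)
  moreover have "closed S"
    unfolding S_def by (intro closed_Collect_eq continuous_intros f.continuous_on continuous_on_id)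
  ultimately obtain v where v: "v \<in> S" and orth: "\<And>w. w \<in> S \<Longrightarrow> (u - v) \<bullet> w = 0"
    using subspace_nearest_point[of S u] by blast
  define z where "z = u - v"
  have fz: "f z \<noteq> 0" using u v by (simp add: z_def f.diff S_def)
  then have z0: "z \<bullet> z \<noteq> 0" by (auto simp: f.zero)
  have "f x = ((f z / (z \<bullet> z)) *\<^sub>R z) \<bullet> x" for x
  proof -
    have "x - (f x / f z) *\<^sub>R z \<in> S" using fz by (simp add: S_def f.diff f.scaleR)
    then have "z \<bullet> (x - (f x / f z) *\<^sub>R z) = 0" using orth by (simp add: z_def)
    then show ?thesis using fz z0 by (simp add: inner_diff_right field_simps)
  qed
  then show ?thesis by (rule that)
next
  case False
  then show ?thesis by (intro that[of 0]) auto
qed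

section \<open>Test functions\<close>

lemma Ck_on_imp_continuous_on: "Ck_on k S f \<Longrightarrow> continuous_on S f"
  by (cases k) (auto intro!: continuous_at_imp_continuous_on intro: has_derivative_continuous)

text \<open>This monotonicity is not built into the recursive definition, but the product rule
  relies on it: the derivative of a product still contains the undifferentiated factors.\<close>

lemma Ck_on_SucD: "Ck_on (Suc k) S f \<Longrightarrow> Ck_on k S f"
proof (induction k arbitrary: f)
  case 0
  then show ?case using Ck_on_imp_continuous_on by (metis Ck_on.simps(1))
next
  case (Suc k)
  then show ?case by (metis Ck_on.simps(2))
qed

lemma Ck_on_const: "Ck_on k S (\<lambda>x. c)"
proof (induction k arbitrary: c)
  case (Suc k)
  then show ?case
    by (auto intro!: exI[of _ "\<lambda>x h. 0"])
qed simp

lemma Ck_on_add: "Ck_on k S f \<Longrightarrow> Ck_on k S g \<Longrightarrow> Ck_on k S (\<lambda>x. f x + g x)"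
proof (induction k arbitrary: f g)
  case (Suc k)
  then obtain f' g' where
    "\<forall>x\<in>S. (f has_derivative f' x) (at x)" "\<forall>b\<in>Basis. Ck_on k S (\<lambda>x. f' x b)"
    "\<forall>x\<in>S. (g has_derivative g' x) (at x)" "\<forall>b\<in>Basis. Ck_on k S (\<lambda>x. g' x b)"
    by auto
  with Suc.IH show ?case
    by (auto intro!: exI[of _ "\<lambda>x h. f' x h + g' x h"] has_derivative_add)
qed (auto intro: continuous_on_add)

lemma Ck_on_mult: "Ck_on k S f \<Longrightarrow> Ck_on k S g \<Longrightarrow> Ck_on k S (\<lambda>x. f x * g x)"
proof (induction k arbitrary: f g)
  case (Suc k)
  then obtain f' g' where *:
    "\<forall>x\<in>S. (f has_derivative f' x) (at x)" "\<forall>b\<in>Basis. Ck_on k S (\<lambda>x. f' x b)"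
    "\<forall>x\<in>S. (g has_derivative g' x) (at x)" "\<forall>b\<in>Basis. Ck_on k S (\<lambda>x. g' x b)"
    by auto
  have "Ck_on k S f" "Ck_on k S g" using Suc.prems Ck_on_SucD by blast+
  with * Suc.IH show ?case
    by (auto intro!: exI[of _ "\<lambda>x h. f x * g' x h + f' x h * g x"] has_derivative_mult Ck_on_add)
qed (auto intro: continuous_on_mult)

lemma Ck_on_inner_const: "Ck_on k S (\<lambda>x. x \<bullet> c)"
proof (cases k)
  case (Suc k)
  then show ?thesis
    by (auto intro!: exI[of _ "\<lambda>x h. h \<bullet> c"] Ck_on_const derivative_eq_intros)
qed (auto intro!: continuous_intros)

lemma smooth_const: "smooth (\<lambda>x. c)"
  and smooth_add: "smooth f \<Longrightarrow> smooth g \<Longrightarrow> smooth (\<lambda>x. f x + g x)"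
  and smooth_mult: "smooth f \<Longrightarrow> smooth g \<Longrightarrow> smooth (\<lambda>x. f x * g x)"
  and smooth_inner_const: "smooth (\<lambda>x. x \<bullet> a)"
  by (simp_all add: smooth_def Ck_on_const Ck_on_add Ck_on_mult Ck_on_inner_const)

lemma smooth_diff: "smooth f \<Longrightarrow> smooth g \<Longrightarrow> smooth (\<lambda>x. f x - g x)"
  using smooth_add[of f "\<lambda>x. (- 1) * g x"] smooth_mult[OF smooth_const[of "- 1"], of g] by simp

lemma smooth_prod: "(\<And>i. i \<in> I \<Longrightarrow> smooth (f i)) \<Longrightarrow> smooth (\<lambda>x. \<Prod>i\<in>I. f i x)"
  by (induction I rule: infinite_finite_induct) (auto intro: smooth_const smooth_mult)

lemma smooth_has_derivative:
  assumes "smooth f"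
  shows "(f has_derivative frechet_derivative f (at x)) (at x)"
proof -
  have "Ck_on (Suc 0) UNIV f" using assms by (simp only: smooth_def)
  then have "f differentiable at x" by (auto simp: differentiable_def)
  then show ?thesis by (simp add: frechet_derivative_works)
qed

lemma smooth_frechet_derivative:
  assumes "smooth f" "b \<in> Basis"
  shows "smooth (\<lambda>x. frechet_derivative f (at x) b)"
  unfolding smooth_def
proof
  fix k
  have "Ck_on (Suc k) UNIV f" using assms by (simp only: smooth_def)
  then obtain f' where f': "\<forall>x. (f has_derivative f' x) (at x)" "\<forall>b\<in>Basis. Ck_on k UNIV (\<lambda>x. f' x b)"
    by auto
  then have "f' x = frechet_derivative f (at x)" for x
    by (intro frechet_derivative_at) auto
  then show "Ck_on k UNIV (\<lambda>x. frechet_derivative f (at x) b)" using f' assms by simp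
qed

lemma smooth_continuous_on: "smooth f \<Longrightarrow> continuous_on S f"
  unfolding smooth_def using Ck_on_imp_continuous_on[of 0 UNIV f] continuous_on_subset by blast

lemma smooth_borel_measurable: "smooth f \<Longrightarrow> f \<in> borel_measurable borel"
  by (intro borel_measurable_continuous_onI smooth_continuous_on)

text \<open>The power (1 / s)^m makes the family closed under differentiation, so that smoothness of
  exp (- 1 / s), extended by zero, becomes an induction over the order.\<close>

definition flat_exp :: "nat \<Rightarrow> real \<Rightarrow> real" where
  "flat_exp m s = (if 0 < s then (1 / s) ^ m * exp (- (1 / s)) else 0)"

text \<open>Substituting u = 1 / s reduces the right-hand limit to that of u^m / exp u at
  infinity.\<close>

lemma flat_exp_tendsto_0: "(flat_exp m \<longlongrightarrow> 0) (at 0)"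
proof (rule filterlim_split_at)
  have "((\<lambda>s. inverse s ^ m / exp (inverse s)) \<longlongrightarrow> 0) (at_right (0::real))"
    using filterlim_compose[OF tendsto_power_div_exp_0 filterlim_inverse_at_top_right] .
  then show "(flat_exp m \<longlongrightarrow> 0) (at_right 0)"
    by (rule Lim_transform_eventually)
       (auto simp: eventually_at_filter flat_exp_def inverse_eq_divide exp_minus)
  have "((\<lambda>s. 0) \<longlongrightarrow> 0) (at_left (0::real))" by simp
  then show "(flat_exp m \<longlongrightarrow> 0) (at_left 0)"
    by (rule Lim_transform_eventually) (auto simp: eventually_at_filter flat_exp_def)
qed

text \<open>At s = 0 the difference quotient of \<open>flat_exp m\<close> is
  \<open>flat_exp (Suc m)\<close>, so the derivative there is the limit of the next member of the
  family.\<close>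

lemma flat_exp_DERIV:
  "(flat_exp m has_real_derivative (- real m * flat_exp (Suc m) s + flat_exp (Suc (Suc m)) s)) (at s)"
proof -
  consider "0 < s" | "s < 0" | "s = 0" by linarith
  then show ?thesis
  proof cases
    case 1
    have "((\<lambda>s. (1 / s) ^ m * exp (- (1 / s))) has_real_derivative
        (- real m * flat_exp (Suc m) s + flat_exp (Suc (Suc m)) s)) (at s)"
    proof -
      let ?u = "1 / s"
      have "((\<lambda>u. u ^ m * exp (- u)) has_real_derivative
          (real m * ?u ^ (m - 1) * exp (- ?u) - ?u ^ m * exp (- ?u))) (at ?u)"
        by (auto intro!: derivative_eq_intros)
      moreover have "((\<lambda>s. 1 / s) has_real_derivative - (?u * ?u)) (at s)"
        using 1 by (auto intro!: derivative_eq_intros)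
      ultimately have "((\<lambda>s. (1 / s) ^ m * exp (- (1 / s))) has_real_derivative
          (real m * ?u ^ (m - 1) * exp (- ?u) - ?u ^ m * exp (- ?u)) * - (?u * ?u)) (at s)"
        by (rule DERIV_chain2)
      moreover have "(real m * u ^ (m - 1) * e - u ^ m * e) * - (u * u)
          = - real m * (u ^ Suc m * e) + u ^ Suc (Suc m) * e" for u e :: real
        by (cases m) (auto simp: algebra_simps)
      ultimately have "((\<lambda>s. (1 / s) ^ m * exp (- (1 / s))) has_real_derivative
          (- real m * (?u ^ Suc m * exp (- ?u)) + ?u ^ Suc (Suc m) * exp (- ?u))) (at s)"
        by (simp only:)
      then show ?thesis by (simp only: flat_exp_def 1 if_True)
    qed
    then show ?thesis
      by (rule has_field_derivative_transform_within_open[of _ _ _ "{0<..}"])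
         (use 1 in \<open>auto simp: flat_exp_def\<close>)
  next
    case 2
    have "((\<lambda>s. 0) has_real_derivative (- real m * flat_exp (Suc m) s + flat_exp (Suc (Suc m)) s)) (at s)"
      using 2 by (auto simp: flat_exp_def)
    then show ?thesis
      by (rule has_field_derivative_transform_within_open[of _ _ _ "{..<0}"])
         (use 2 in \<open>auto simp: flat_exp_def\<close>)
  next
    case 3
    have "((\<lambda>h. flat_exp m h / h) \<longlongrightarrow> 0) (at 0)"
      using flat_exp_tendsto_0[of "Suc m"]
      by (rule Lim_transform_eventually) (auto simp: eventually_at_filter flat_exp_def)
    then show ?thesis
      by (simp add: 3 DERIV_def) (simp add: flat_exp_def)
  qed
qed

text \<open>The induction over the order leaves m free, since each derivative is a combination of
  later members of the family times a derivative of q.\<close>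

lemma smooth_flat_exp_compose:
  assumes "smooth q"
  shows "smooth (\<lambda>x. flat_exp m (q x))"
proof -
  have "Ck_on k UNIV (\<lambda>x. flat_exp m (q x))" for k
  proof (induction k arbitrary: m)
    case 0
    have "continuous_on UNIV (flat_exp m)"
      using flat_exp_DERIV DERIV_isCont by (blast intro: continuous_at_imp_continuous_on)
    then show ?case
      using continuous_on_compose2 smooth_continuous_on[OF assms, of UNIV] by fastforce
  next
    case (Suc k)
    let ?D = "\<lambda>x h. (- real m * flat_exp (Suc m) (q x) + flat_exp (Suc (Suc m)) (q x)) * frechet_derivative q (at x) h"
    have "((\<lambda>x. flat_exp m (q x)) has_derivative ?D x) (at x)" for x
      using has_derivative_compose[OF smooth_has_derivative[OF assms, of x]
          flat_exp_DERIV[unfolded has_field_derivative_def, of m "q x"]] by simp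
    moreover have "Ck_on k UNIV (\<lambda>x. ?D x b)" if "b \<in> Basis" for b
      using smooth_frechet_derivative[OF assms that]
      by (intro Ck_on_mult Ck_on_add Ck_on_const Suc.IH) (simp add: smooth_def)
    ultimately show ?case by (auto intro!: exI[of _ ?D])
  qed
  then show ?thesis by (simp add: smooth_def)
qed

section \<open>Test functions: closure properties and integration by parts\<close>

lemma test_functionsI:
  assumes "smooth \<phi>" "compact K" "K \<subseteq> U" "\<And>x. x \<notin> K \<Longrightarrow> \<phi> x = 0"
  shows "\<phi> \<in> test_functions U"
proof -
  have "closure {x. \<phi> x \<noteq> 0} \<subseteq> K"
    using assms by (intro closure_minimal compact_imp_closed) auto
  moreover from this have "compact (closure {x. \<phi> x \<noteq> 0})"
    using assms(2) closed_closure compact_Int_closed by (metis inf.absorb_iff2)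
  ultimately show ?thesis using assms by (auto simp: test_functions_def)
qed

text \<open>K is the closed support; its complement is open, so the derivative vanishes there
  together with the function.\<close>

lemma test_functionsE:
  assumes "\<phi> \<in> test_functions U"
  obtains K where "smooth \<phi>" "compact K" "K \<subseteq> U" "\<And>x. x \<notin> K \<Longrightarrow> \<phi> x = 0"
    "\<And>x. x \<notin> K \<Longrightarrow> frechet_derivative \<phi> (at x) = (\<lambda>h. 0)"
proof (rule that[of "closure {x. \<phi> x \<noteq> 0}"])
  show "smooth \<phi>" "compact (closure {x. \<phi> x \<noteq> 0})" "closure {x. \<phi> x \<noteq> 0} \<subseteq> U"
    using assms by (auto simp: test_functions_def)
  fix x assume x: "x \<notin> closure {x. \<phi> x \<noteq> 0}"
  show "\<phi> x = 0" using x closure_subset[of "{x. \<phi> x \<noteq> 0}"] by auto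
  have "((\<lambda>x. 0) has_derivative (\<lambda>h. 0)) (at x)" by simp
  then have "(\<phi> has_derivative (\<lambda>h. 0)) (at x)"
    by (rule has_derivative_transform_within_open[of _ _ _ _ "- closure {x. \<phi> x \<noteq> 0}"])
       (use x closure_subset[of "{x. \<phi> x \<noteq> 0}"] in auto)
  then show "frechet_derivative \<phi> (at x) = (\<lambda>h. 0)"
    using frechet_derivative_at by metis
qed

lemma test_functions_deriv:
  assumes "\<phi> \<in> test_functions U" "b \<in> Basis"
  shows "(\<lambda>x. frechet_derivative \<phi> (at x) b) \<in> test_functions U"
  using assms(1)
proof (rule test_functionsE)
  fix K assume "smooth \<phi>" "compact K" "K \<subseteq> U" "\<And>x. x \<notin> K \<Longrightarrow> frechet_derivative \<phi> (at x) = (\<lambda>h. 0)"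
  then show ?thesis using assms(2) by (intro test_functionsI[of _ K] smooth_frechet_derivative) auto
qed

lemma test_functions_mult:
  assumes "\<phi> \<in> test_functions U" "smooth \<psi>"
  shows "(\<lambda>x. \<phi> x * \<psi> x) \<in> test_functions U"
  using assms(1)
proof (rule test_functionsE)
  fix K assume "smooth \<phi>" "compact K" "K \<subseteq> U" "\<And>x. x \<notin> K \<Longrightarrow> \<phi> x = 0"
  then show ?thesis using assms(2) by (intro test_functionsI[of _ K] smooth_mult) auto
qed

lemma test_functions_cmult: "\<phi> \<in> test_functions U \<Longrightarrow> (\<lambda>x. c * \<phi> x) \<in> test_functions U"
  using test_functions_mult[OF _ smooth_const[of c]] by (simp add: mult.commute)

lemma test_functions_add:
  assumes "\<phi> \<in> test_functions U" "\<psi> \<in> test_functions U"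
  shows "(\<lambda>x. \<phi> x + \<psi> x) \<in> test_functions U"
proof -
  obtain K where K: "smooth \<phi>" "compact K" "K \<subseteq> U" "\<And>x. x \<notin> K \<Longrightarrow> \<phi> x = 0"
    using test_functionsE[OF assms(1)] by metis
  obtain L where L: "smooth \<psi>" "compact L" "L \<subseteq> U" "\<And>x. x \<notin> L \<Longrightarrow> \<psi> x = 0"
    using test_functionsE[OF assms(2)] by metis
  show ?thesis
    using K L by (intro test_functionsI[of _ "K \<union> L"] smooth_add) auto
qed

lemma test_functions_zero: "(\<lambda>x. 0) \<in> test_functions U"
  by (rule test_functionsI[of _ "{}"]) (auto intro: smooth_const)

lemma test_functions_smooth: "\<phi> \<in> test_functions U \<Longrightarrow> smooth \<phi>"
  by (simp add: test_functions_def)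

lemma test_functions_outside: "\<phi> \<in> test_functions U \<Longrightarrow> x \<notin> U \<Longrightarrow> \<phi> x = 0"
  using closure_subset[of "{x. \<phi> x \<noteq> 0}"] by (auto simp: test_functions_def)

lemma test_functions_bounded:
  assumes "\<phi> \<in> test_functions U"
  obtains B where "0 \<le> B" "\<And>x. \<bar>\<phi> x\<bar> \<le> B"
  using assms
proof (rule test_functionsE)
  fix K assume K: "smooth \<phi>" "compact K" "\<And>x. x \<notin> K \<Longrightarrow> \<phi> x = 0"
  have "bounded (\<phi> ` K)"
    by (intro compact_imp_bounded compact_continuous_image smooth_continuous_on K)
  then obtain B where B: "\<And>x. x \<in> K \<Longrightarrow> \<bar>\<phi> x\<bar> \<le> B" by (auto simp: bounded_iff)
  have "\<bar>\<phi> x\<bar> \<le> max B 0" for x using B[of x] K(3)[of x] by (cases "x \<in> K") auto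
  then show ?thesis by (intro that[of "max B 0"]) auto
qed

lemma test_functions_integrable:
  assumes "\<phi> \<in> test_functions U"
  shows "integrable lborel \<phi>"
  using assms
proof (rule test_functionsE)
  fix K assume K: "smooth \<phi>" "compact K" "\<And>x. x \<notin> K \<Longrightarrow> \<phi> x = 0"
  have "integrable lborel (\<lambda>x. indicator K x *\<^sub>R \<phi> x)"
    by (intro borel_integrable_compact smooth_continuous_on K)
  moreover have "(\<lambda>x. indicator K x *\<^sub>R \<phi> x) = \<phi>"
    using K(3) by (intro ext) (auto split: split_indicator)
  ultimately show ?thesis by simp
qed

text \<open>Difference quotients have integral zero by translation invariance of Lebesgue measure,
  and dominated convergence passes to the derivative.\<close>

lemma integral_test_functions_deriv:
  assumes \<phi>: "\<phi> \<in> test_functions U" and b: "b \<in> Basis"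
  shows "(LINT x|lborel. frechet_derivative \<phi> (at x) b) = 0"
proof -
  let ?D = "\<lambda>x. frechet_derivative \<phi> (at x) b"
  obtain K where K: "smooth \<phi>" "compact K" "\<And>x. x \<notin> K \<Longrightarrow> \<phi> x = 0"
    using test_functionsE[OF \<phi>] by metis
  obtain B where B: "0 \<le> B" "\<And>x. \<bar>?D x\<bar> \<le> B"
    using test_functions_bounded[OF test_functions_deriv[OF \<phi> b]] by metis
  obtain R where R: "\<And>x. x \<in> K \<Longrightarrow> norm x \<le> R"
    using compact_imp_bounded[OF K(2)] by (auto simp: bounded_iff)
  define s where "s n x = (\<phi> (x + inverse (real (Suc n)) *\<^sub>R b) - \<phi> x) / inverse (real (Suc n))" for n x
  have D: "((\<lambda>t. \<phi> (x + t *\<^sub>R b)) has_real_derivative ?D (x + t *\<^sub>R b)) (at t)" for x t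
  proof -
    have "((\<lambda>t. x + t *\<^sub>R b) has_derivative (\<lambda>h. h *\<^sub>R b)) (at t)"
      by (auto intro!: derivative_eq_intros)
    then have "((\<lambda>t. \<phi> (x + t *\<^sub>R b)) has_derivative (\<lambda>h. frechet_derivative \<phi> (at (x + t *\<^sub>R b)) (h *\<^sub>R b))) (at t)"
      by (rule has_derivative_compose) (rule smooth_has_derivative[OF K(1)])
    moreover have "linear (frechet_derivative \<phi> (at (x + t *\<^sub>R b)))"
      using smooth_has_derivative[OF K(1)] has_derivative_linear by blast
    ultimately show ?thesis
      by (simp add: has_field_derivative_def linear_scale mult.commute[of _ "?D (x + t *\<^sub>R b)"])
  qed
  have int: "integrable lborel \<phi>" by (rule test_functions_integrable[OF \<phi>])
  have shift: "integrable lborel (\<lambda>x. \<phi> (x + c))" "(LINT x|lborel. \<phi> (x + c)) = (LINT x|lborel. \<phi> x)" for c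
  proof -
    have [measurable]: "\<phi> \<in> borel_measurable borel" by (rule smooth_borel_measurable[OF K(1)])
    have "integrable (distr lborel borel ((+) c)) \<phi>" using int by (simp add: lborel_distr_plus)
    then show "integrable lborel (\<lambda>x. \<phi> (x + c))"
      by (subst (asm) integrable_distr_eq) (auto simp: add.commute)
    have "(LINT x|lborel. \<phi> x) = (LINT x|distr lborel borel ((+) c). \<phi> x)" by (simp add: lborel_distr_plus)
    also have "\<dots> = (LINT x|lborel. \<phi> (x + c))"
      by (subst integral_distr) (auto simp: add.commute)
    finally show "(LINT x|lborel. \<phi> (x + c)) = (LINT x|lborel. \<phi> x)" by simp
  qed
  have s0: "(LINT x|lborel. s n x) = 0" for n
    unfolding s_def using shift int by (simp add: Bochner_Integration.integral_diff)
  \<comment> \<open>By the mean value theorem the quotients are bounded by a bound of the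
    derivative; they vanish outside radius R + 1, since the shifts have length at most 1.\<close>
  have "(\<lambda>n. LINT x|lborel. s n x) \<longlonglongrightarrow> (LINT x|lborel. ?D x)"
  proof (rule integral_dominated_convergence[where w="\<lambda>x. indicator (cball 0 (R + 1)) x *\<^sub>R B"])
    show "?D \<in> borel_measurable lborel"
      using smooth_borel_measurable[OF smooth_frechet_derivative[OF K(1) b]] by simp
    show "s n \<in> borel_measurable lborel" for n
      unfolding s_def using smooth_borel_measurable[OF K(1)] shift(1) int
      by (intro borel_measurable_divide borel_measurable_diff) (auto dest: borel_measurable_integrable)
    show "integrable lborel (\<lambda>x. indicator (cball 0 (R + 1)) x *\<^sub>R B)"
      by (intro borel_integrable_compact) auto
    show "AE x in lborel. (\<lambda>n. s n x) \<longlonglongrightarrow> ?D x"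
    proof (rule AE_I2)
      fix x
      have "((\<lambda>h. (\<phi> (x + h *\<^sub>R b) - \<phi> x) / h) \<longlongrightarrow> ?D x) (at 0)"
        using D[of x 0] by (simp add: DERIV_def)
      moreover have "filterlim (\<lambda>n. inverse (real (Suc n))) (at 0) sequentially"
        using LIMSEQ_inverse_real_of_nat by (auto simp: filterlim_at)
      ultimately show "(\<lambda>n. s n x) \<longlonglongrightarrow> ?D x"
        unfolding s_def by (rule filterlim_compose)
    qed
    show "AE x in lborel. norm (s n x) \<le> indicator (cball 0 (R + 1)) x *\<^sub>R B" for n
    proof (rule AE_I2)
      fix x
      define h where "h = inverse (real (Suc n))"
      have h: "0 < h" "h \<le> 1" by (auto simp: h_def field_simps)
      show "norm (s n x) \<le> indicator (cball 0 (R + 1)) x *\<^sub>R B"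
      proof (cases "x \<in> cball 0 (R + 1)")
        case True
        obtain z where "\<phi> (x + h *\<^sub>R b) - \<phi> (x + 0 *\<^sub>R b) = (h - 0) * ?D (x + z *\<^sub>R b)"
          using MVT2[of 0 h "\<lambda>t. \<phi> (x + t *\<^sub>R b)" "\<lambda>t. ?D (x + t *\<^sub>R b)"] D h by auto
        then have "s n x = ?D (x + z *\<^sub>R b)" using h by (simp add: s_def h_def)
        then show ?thesis using True B by simp
      next
        case False
        then have "x \<notin> K" using R[of x] by auto
        moreover have "x + h *\<^sub>R b \<notin> K"
        proof
          assume "x + h *\<^sub>R b \<in> K"
          then have "norm (x + h *\<^sub>R b) \<le> R" by (rule R)
          moreover have "norm x \<le> norm (x + h *\<^sub>R b) + norm (h *\<^sub>R b)"
            using norm_triangle_ineq4[of "x + h *\<^sub>R b" "h *\<^sub>R b"] by simp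
          ultimately show False using False h b by (simp add: mem_cball)
        qed
        ultimately have "s n x = 0" using K(3) by (simp add: s_def h_def)
        then show ?thesis using False by simp
      qed
    qed
  qed
  then show ?thesis using s0 by (simp add: LIMSEQ_const_iff)
qed

lemma frechet_derivative_mult:
  fixes f g :: "'a::euclidean_space \<Rightarrow> real"
  assumes "smooth f" "smooth g"
  shows "frechet_derivative (\<lambda>x. f x * g x) (at x) b
    = f x * frechet_derivative g (at x) b + frechet_derivative f (at x) b * g x"
  using frechet_derivative_at[OF has_derivative_mult[OF smooth_has_derivative[OF assms(1)]
        smooth_has_derivative[OF assms(2)]], of x] by metis

lemma integral_by_parts_test_functions:
  assumes \<phi>: "\<phi> \<in> test_functions U" and \<psi>: "smooth \<psi>" and b: "b \<in> Basis"
  shows "(LINT x|lborel. \<phi> x * frechet_derivative \<psi> (at x) b) = - (LINT x|lborel. frechet_derivative \<phi> (at x) b * \<psi> x)"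
proof -
  have "(LINT x|lborel. \<phi> x * frechet_derivative \<psi> (at x) b + frechet_derivative \<phi> (at x) b * \<psi> x) = 0"
    using integral_test_functions_deriv[OF test_functions_mult[OF \<phi> \<psi>] b]
    by (simp add: frechet_derivative_mult[OF test_functions_smooth[OF \<phi>] \<psi>])
  moreover have "integrable lborel (\<lambda>x. \<phi> x * frechet_derivative \<psi> (at x) b)"
    by (rule test_functions_integrable[OF test_functions_mult[OF \<phi> smooth_frechet_derivative[OF \<psi> b]]])
  moreover have "integrable lborel (\<lambda>x. frechet_derivative \<phi> (at x) b * \<psi> x)"
    by (rule test_functions_integrable[OF test_functions_mult[OF test_functions_deriv[OF \<phi> b] \<psi>]])
  ultimately show ?thesis by (simp add: Bochner_Integration.integral_add)
qed

section \<open>Smooth approximation of boxes and the fundamental lemma\<close>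

lemma flat_exp_0_bounds: "0 \<le> flat_exp 0 s" "flat_exp 0 s \<le> 1"
  by (auto simp: flat_exp_def)

lemma flat_exp_0_tendsto_1:
  assumes "0 < s"
  shows "(\<lambda>n. flat_exp 0 (real (Suc n) * s)) \<longlonglongrightarrow> 1"
proof -
  have "(\<lambda>n. exp (- (inverse (real (Suc n)) * (1 / s)))) \<longlonglongrightarrow> exp (- (0 * (1 / s)))"
    by (intro tendsto_intros LIMSEQ_inverse_real_of_nat)
  moreover have "exp (- (inverse (real (Suc n)) * (1 / s))) = flat_exp 0 (real (Suc n) * s)" for n
    using assms by (simp add: flat_exp_def inverse_eq_divide add_pos_nonneg)
  ultimately show ?thesis by simp
qed


text \<open>On a nondegenerate box this is the product of exp (- 1 / ((n + 1) (x_i - a_i) (b_i -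
  x_i))). It is smooth as \<open>flat_exp 0\<close> of polynomials, and the growing factor n + 1
  drives it to the indicator of the open box.\<close>

definition box_bump :: "'a::euclidean_space \<Rightarrow> 'a \<Rightarrow> nat \<Rightarrow> 'a \<Rightarrow> real" where
  "box_bump a b n x = (\<Prod>i\<in>Basis. flat_exp 0 (real (Suc n) * ((x \<bullet> i - a \<bullet> i) * (b \<bullet> i - x \<bullet> i))))"

lemma smooth_box_bump: "smooth (box_bump a b n)"
  unfolding box_bump_def[abs_def]
  by (intro smooth_prod smooth_flat_exp_compose smooth_mult smooth_diff smooth_const smooth_inner_const)

lemma box_bump_bounds: "0 \<le> box_bump a b n x" "box_bump a b n x \<le> 1"
  unfolding box_bump_def by (auto intro!: prod_nonneg prod_le_1 simp: flat_exp_0_bounds)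

text \<open>The product (x_i - a_i) (b_i - x_i) could be positive outside the interval only if both
  factors were negative, that is b_i < x_i < a_i, which the assumption on the corners
  excludes.\<close>

lemma box_bump_outside:
  assumes ab: "\<And>i. i \<in> Basis \<Longrightarrow> a \<bullet> i < b \<bullet> i" and x: "x \<notin> box a b"
  shows "box_bump a b n x = 0"
proof -
  obtain i where i: "i \<in> Basis" "x \<bullet> i \<le> a \<bullet> i \<or> b \<bullet> i \<le> x \<bullet> i"
    using x by (auto simp: mem_box not_less)
  then have "(x \<bullet> i - a \<bullet> i) * (b \<bullet> i - x \<bullet> i) \<le> 0"
    using ab[OF i(1)] by (auto simp: mult_le_0_iff)
  then have "\<not> 0 < real (Suc n) * ((x \<bullet> i - a \<bullet> i) * (b \<bullet> i - x \<bullet> i))"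
    unfolding not_less by (intro mult_nonneg_nonpos[of "real (Suc n)"]) auto
  then have "flat_exp 0 (real (Suc n) * ((x \<bullet> i - a \<bullet> i) * (b \<bullet> i - x \<bullet> i))) = 0"
    unfolding flat_exp_def by (rule if_not_P)
  then show ?thesis unfolding box_bump_def using i(1) by (intro prod_zero) auto
qed

lemma box_bump_tendsto_1:
  assumes "x \<in> box a b"
  shows "(\<lambda>n. box_bump a b n x) \<longlonglongrightarrow> 1"
proof -
  have "(\<lambda>n. box_bump a b n x) \<longlonglongrightarrow> (\<Prod>i\<in>(Basis::'a set). 1)"
    unfolding box_bump_def
    by (rule tendsto_prod) (use assms in \<open>intro flat_exp_0_tendsto_1, auto simp: mem_box\<close>)
  then show ?thesis by simp
qed

lemma box_bump_test_function:
  assumes "\<And>i. i \<in> Basis \<Longrightarrow> a \<bullet> i < b \<bullet> i" "cbox a b \<subseteq> U"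
  shows "box_bump a b n \<in> test_functions U"
proof (rule test_functionsI[of _ "cbox a b"])
  fix x assume "x \<notin> cbox a b"
  then have "x \<notin> box a b" using box_subset_cbox by blast
  with assms(1) show "box_bump a b n x = 0" by (rule box_bump_outside)
qed (use assms(2) in \<open>simp_all add: smooth_box_bump compact_cbox\<close>)

text \<open>The coercion \<open>ennreal\<close> cuts off negative values, so h and - h are densities
  of the positive and of the negative part. The two measures agree on boxes, an intersection-stable
  generator, hence everywhere, and densities are unique almost everywhere.\<close>

lemma AE_zero_if_box_integrals_zero:
  fixes h :: "'a::euclidean_space \<Rightarrow> real"
  assumes h: "integrable lborel h" and zero: "\<And>a b. (LINT x|lborel. indicator (box a b) x * h x) = 0"
  shows "AE x in lborel. h x = 0"
proof -
  have [measurable]: "h \<in> borel_measurable borel" using h by auto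
  define M where "M f = density lborel (\<lambda>x. ennreal (f x))" for f :: "'a \<Rightarrow> real"
  have fin: "integrable lborel (\<lambda>x. indicator A x * h x)" if "A \<in> sets borel" for A
    using integrable_mult_indicator[OF _ h, of A] that by simp
  have enn2real_inj: "s = t" if "s \<noteq> \<infinity>" "t \<noteq> \<infinity>" "enn2real s = enn2real t" for s t :: ennreal
    using that by (cases s; cases t) auto
  have box: "emeasure (M h) (box a b) = emeasure (M (\<lambda>x. - h x)) (box a b)"
    and finite: "emeasure (M h) (box a b) \<noteq> \<infinity>" for a b
  proof -
    let ?g = "\<lambda>x. indicator (box a b) x * h x"
    have g: "integrable lborel ?g" by (rule fin) simp
    have 1: "emeasure (M h) (box a b) = (\<integral>\<^sup>+x. ennreal (?g x) \<partial>lborel)"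
      unfolding M_def by (subst emeasure_density) (auto intro!: nn_integral_cong split: split_indicator)
    have 2: "emeasure (M (\<lambda>x. - h x)) (box a b) = (\<integral>\<^sup>+x. ennreal (- ?g x) \<partial>lborel)"
      unfolding M_def by (subst emeasure_density) (auto intro!: nn_integral_cong split: split_indicator)
    have f1: "(\<integral>\<^sup>+x. ennreal (?g x) \<partial>lborel) \<noteq> \<infinity>" and f2: "(\<integral>\<^sup>+x. ennreal (- ?g x) \<partial>lborel) \<noteq> \<infinity>"
      using g unfolding real_integrable_def by auto
    have "enn2real (\<integral>\<^sup>+x. ennreal (?g x) \<partial>lborel) - enn2real (\<integral>\<^sup>+x. ennreal (- ?g x) \<partial>lborel) = 0"
      using real_lebesgue_integral_def[OF g] zero[of a b] by simp
    then have "enn2real (\<integral>\<^sup>+x. ennreal (?g x) \<partial>lborel) = enn2real (\<integral>\<^sup>+x. ennreal (- ?g x) \<partial>lborel)"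
      by simp
    then have "(\<integral>\<^sup>+x. ennreal (?g x) \<partial>lborel) = (\<integral>\<^sup>+x. ennreal (- ?g x) \<partial>lborel)"
      by (rule enn2real_inj[OF f1 f2])
    then show "emeasure (M h) (box a b) = emeasure (M (\<lambda>x. - h x)) (box a b)" using 1 2 by simp
    show "emeasure (M h) (box a b) \<noteq> \<infinity>" using 1 f1 by simp
  qed
  have "M h = M (\<lambda>x. - h x)"
  proof (rule measure_eqI_generator_eq)
    let ?E = "range (\<lambda>(a, b). box a b :: 'a set)"
    show "Int_stable ?E" by (auto simp: Int_stable_def box_Int_box)
    show "?E \<subseteq> Pow UNIV" by auto
    show "sets (M h) = sigma_sets UNIV ?E" "sets (M (\<lambda>x. - h x)) = sigma_sets UNIV ?E"
      by (simp_all add: M_def borel_eq_box)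
    let ?A = "\<lambda>n::nat. box (- (real n *\<^sub>R One)) (real n *\<^sub>R One) :: 'a set"
    show "range ?A \<subseteq> ?E" "(\<Union>i. ?A i) = UNIV"
      unfolding UN_box_eq_UNIV by auto
    show "emeasure (M h) X = emeasure (M (\<lambda>x. - h x)) X" if "X \<in> ?E" for X using that box by auto
    show "emeasure (M h) (?A i) \<noteq> \<infinity>" for i by (rule finite)
  qed
  then have "AE x in lborel. ennreal (h x) = ennreal (- h x)"
    unfolding M_def
    by (rule iffD1[OF sigma_finite_measure.density_unique_iff[OF sigma_finite_lborel], rotated 2]) measurable
  then show ?thesis
  proof eventually_elim
    case (elim x)
    show ?case
    proof (cases "0 \<le> h x")
      case True
      then have "ennreal (- h x) = 0" by (simp add: ennreal_neg)
      with elim have "ennreal (h x) = 0" by (rule trans)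
      then show ?thesis using True by (simp add: ennreal_eq_0_iff)
    next
      case False
      then have "ennreal (h x) = 0" by (simp add: ennreal_neg)
      with elim have "ennreal (- h x) = 0" by (metis)
      then show ?thesis using False by (simp add: ennreal_eq_0_iff)
    qed
  qed
qed

lemma locally_integrable_cbox:
  assumes "locally_integrable U g" "cbox c d \<subseteq> U"
  shows "integrable lebesgue (\<lambda>x. indicator (cbox c d) x *\<^sub>R g x)"
proof -
  have "integrable (lebesgue_on (cbox c d)) g"
    using assms by (simp add: locally_integrable_def compact_cbox)
  then show ?thesis by (subst (asm) integrable_restrict_space) auto
qed

text \<open>Bump functions approximate indicators of boxes, so the integral of g over every box
  inside U vanishes. This determines g almost everywhere on each box, and countably many boxes cover
  U.\<close>

theorem fundamental_lemma_calculus_of_variations: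
  fixes g :: "'a::euclidean_space \<Rightarrow> real"
  assumes U: "open U" and g: "locally_integrable U g"
    and zero: "\<And>\<phi>. \<phi> \<in> test_functions U \<Longrightarrow> (LINT x|lebesgue_on U. g x * \<phi> x) = 0"
  shows "AE x in lebesgue. x \<in> U \<longrightarrow> g x = 0"
proof -
  have Us: "U \<in> sets lebesgue" using U by auto
  have int0: "(LINT x|lebesgue. indicator (box a b) x * g x) = 0" if ab: "cbox a b \<subseteq> U" for a b
  proof (cases "\<forall>i\<in>Basis. a \<bullet> i < b \<bullet> i")
    case False
    then have "box a b = {}" by (auto simp: box_eq_empty not_less)
    then show ?thesis by simp
  next
    case True
    have gi: "integrable lebesgue (\<lambda>x. indicator (cbox a b) x *\<^sub>R g x)"
      by (rule locally_integrable_cbox[OF g ab])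
    have gm: "(\<lambda>x. indicator (cbox a b) x *\<^sub>R g x) \<in> borel_measurable lebesgue"
      using gi by (rule borel_measurable_integrable)
    have in_cbox: "x \<in> cbox a b" if "x \<in> box a b" for x using that box_subset_cbox by blast
    have out: "box_bump a b n x = 0" if "x \<notin> box a b" for n x
      using box_bump_outside[of a b] True that by blast
    have "(\<lambda>n. LINT x|lebesgue. box_bump a b n x * (indicator (cbox a b) x *\<^sub>R g x))
        \<longlonglongrightarrow> (LINT x|lebesgue. indicator (box a b) x * (indicator (cbox a b) x *\<^sub>R g x))"
    proof (rule integral_dominated_convergence[where w="\<lambda>x. norm (indicator (cbox a b) x *\<^sub>R g x)"])
      show "integrable lebesgue (\<lambda>x. norm (indicator (cbox a b) x *\<^sub>R g x))" using gi by (rule integrable_norm)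
      show "(\<lambda>x. indicator (box a b) x * (indicator (cbox a b) x *\<^sub>R g x)) \<in> borel_measurable lebesgue"
        by (intro borel_measurable_times gm borel_measurable_indicator) auto
      show "(\<lambda>x. box_bump a b n x * (indicator (cbox a b) x *\<^sub>R g x)) \<in> borel_measurable lebesgue" for n
        by (intro borel_measurable_times gm measurable_completion)
           (use smooth_borel_measurable[OF smooth_box_bump] in simp)
      show "AE x in lebesgue. (\<lambda>n. box_bump a b n x * (indicator (cbox a b) x *\<^sub>R g x))
          \<longlonglongrightarrow> indicator (box a b) x * (indicator (cbox a b) x *\<^sub>R g x)"
      proof (rule AE_I2, rule tendsto_mult_right)
        fix x
        show "(\<lambda>n. box_bump a b n x) \<longlonglongrightarrow> indicator (box a b) x"
          by (cases "x \<in> box a b") (simp_all add: out box_bump_tendsto_1)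
      qed
      show "AE x in lebesgue. norm (box_bump a b n x * (indicator (cbox a b) x *\<^sub>R g x))
          \<le> norm (indicator (cbox a b) x *\<^sub>R g x)" for n
        using box_bump_bounds[of a b n] by (intro AE_I2) (simp add: abs_mult mult_left_le_one_le)
    qed
    moreover have "(LINT x|lebesgue. box_bump a b n x * (indicator (cbox a b) x *\<^sub>R g x)) = 0" for n
    proof -
      have "(LINT x|lebesgue. box_bump a b n x * (indicator (cbox a b) x *\<^sub>R g x))
          = (LINT x|lebesgue. indicator U x *\<^sub>R (g x * box_bump a b n x))"
      proof (intro Bochner_Integration.integral_cong refl)
        fix x
        show "box_bump a b n x * (indicator (cbox a b) x *\<^sub>R g x) = indicator U x *\<^sub>R (g x * box_bump a b n x)"
        proof (cases "x \<in> box a b")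
          case True
          then have "x \<in> cbox a b" "x \<in> U" using in_cbox ab by auto
          then show ?thesis by simp
        qed (simp add: out)
      qed
      also have "\<dots> = (LINT x|lebesgue_on U. g x * box_bump a b n x)"
        using Us by (subst integral_restrict_space) auto
      also have "\<dots> = 0" using True ab by (intro zero box_bump_test_function) auto
      finally show ?thesis .
    qed
    ultimately have "(LINT x|lebesgue. indicator (box a b) x * (indicator (cbox a b) x *\<^sub>R g x)) = 0"
      by (simp add: LIMSEQ_const_iff)
    moreover have "indicator (box a b) x * (indicator (cbox a b) x *\<^sub>R g x) = indicator (box a b) x * g x" for x
      using in_cbox by (auto split: split_indicator)
    ultimately show ?thesis by (simp only:)
  qed
  have boxAE: "AE x in lebesgue. x \<in> box c d \<longrightarrow> g x = 0" if cd: "cbox c d \<subseteq> U" for c d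
  proof -
    let ?g = "\<lambda>x. indicator (box c d) x * g x"
    have "integrable lebesgue (\<lambda>x. indicator (box c d) x *\<^sub>R (indicator (cbox c d) x *\<^sub>R g x))"
      by (rule integrable_mult_indicator[OF _ locally_integrable_cbox[OF g cd]]) auto
    moreover have "indicator (box c d) x *\<^sub>R (indicator (cbox c d) x *\<^sub>R g x) = ?g x" for x
      using box_subset_cbox[of c d] by (auto split: split_indicator)
    ultimately have gint: "integrable lebesgue ?g" by (simp only:)
    \<comment> \<open>The criterion by box integrals speaks about \<open>lborel\<close>, so the
      Lebesgue measurable integrand is replaced by a Borel version.\<close>
    then obtain h where h: "h \<in> borel_measurable lborel" "AE x in lborel. ?g x = h x"
      using completion_ex_borel_measurable_real[of ?g lborel] by (auto dest: borel_measurable_integrable)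
    have h': "AE x in lebesgue. ?g x = h x" using h(2) by (rule AE_completion)
    have hm: "h \<in> borel_measurable lebesgue" using h(1) by (rule measurable_completion)
    have "integrable lebesgue h" by (rule integrable_cong_AE_imp[OF gint hm h'])
    then have hint: "integrable lborel h" using h(1) by (simp add: integrable_completion)
    have "(LINT x|lborel. indicator (box a b) x * h x) = 0" for a b
    proof -
      have "(LINT x|lborel. indicator (box a b) x * h x) = (LINT x|lebesgue. indicator (box a b) x * h x)"
        using h(1) by (subst integral_completion) auto
      also have "\<dots> = (LINT x|lebesgue. indicator (box a b) x * ?g x)"
        using h' by (intro integral_cong_AE borel_measurable_times borel_measurable_indicator hm
            borel_measurable_integrable[OF gint]) auto
      also have "\<dots> = (LINT x|lebesgue. indicator (box a b \<inter> box c d) x * g x)"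
        by (intro Bochner_Integration.integral_cong refl) (auto split: split_indicator)
      also have "\<dots> = 0"
      proof -
        define u where "u = (\<Sum>i\<in>Basis. max (a \<bullet> i) (c \<bullet> i) *\<^sub>R i)"
        define v where "v = (\<Sum>i\<in>Basis. min (b \<bullet> i) (d \<bullet> i) *\<^sub>R i)"
        have "box a b \<inter> box c d = box u v" by (simp add: box_Int_box u_def v_def)
        moreover have "cbox u v \<subseteq> cbox c d" by (auto simp: u_def v_def mem_box)
        ultimately show ?thesis using int0[of u v] cd by simp
      qed
      finally show ?thesis .
    qed
    then have "AE x in lborel. h x = 0" by (rule AE_zero_if_box_integrals_zero[OF hint])
    then have "AE x in lebesgue. h x = 0" by (rule AE_completion)
    with h' show ?thesis by eventually_elim (auto split: split_indicator_asm)
  qed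
  obtain \<D> where D: "countable \<D>" "\<D> \<subseteq> Pow U" "\<And>X. X \<in> \<D> \<Longrightarrow> \<exists>a b. X = cbox a b" "\<Union>\<D> = U"
    using open_countable_Union_open_cbox[OF U] by metis
  have "AE x in lebesgue. \<forall>X\<in>\<D>. x \<in> X \<longrightarrow> g x = 0"
  proof (subst AE_ball_countable[OF D(1)], rule ballI)
    fix X assume "X \<in> \<D>"
    then obtain c d where X: "X = cbox c d" "cbox c d \<subseteq> U" using D(2,3) by blast
    \<comment> \<open>The cover consists of closed boxes while the argument above treats open ones;
      the difference is a null set.\<close>
    have "cbox c d - box c d \<in> null_sets lebesgue"
      using negligible_frontier_interval by (simp add: negligible_iff_null_sets)
    then have "AE x in lebesgue. x \<notin> cbox c d - box c d" by (rule AE_not_in)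
    with boxAE[OF X(2)] show "AE x in lebesgue. x \<in> X \<longrightarrow> g x = 0"
      by eventually_elim (auto simp: X)
  qed
  then show ?thesis using D(4) by (auto elim: eventually_mono)
qed

section \<open>Weak gradients and the space \<open>H01\<close>\<close>

lemma Lspace_2_iff: "f \<in> Lspace U 2 \<longleftrightarrow>
    f \<in> borel_measurable (lebesgue_on U) \<and> integrable (lebesgue_on U) (\<lambda>x. (norm (f x))\<^sup>2)"
  by (simp add: Lspace_def)

lemma Lnorm_2_eq: "Lnorm U 2 f = sqrt (LINT x|lebesgue_on U. (norm (f x))\<^sup>2)"
  by (simp add: Lnorm_def powr_half_sqrt)

lemma Lnorm_2_sq: "(Lnorm U 2 f)\<^sup>2 = (LINT x|lebesgue_on U. (norm (f x))\<^sup>2)"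
  by (simp add: Lnorm_2_eq)

lemma Lnorm_nonneg: "0 \<le> Lnorm U q f"
  by (simp add: Lnorm_def)

lemma square_integrable_zero_extension:
  assumes "U \<in> sets lebesgue"
  shows "square_integrable (\<lambda>x. if x \<in> U then f x else 0) \<longleftrightarrow> f \<in> Lspace U 2"
proof -
  have "(\<lambda>x. (norm (if x \<in> U then f x else 0))\<^sup>2) = (\<lambda>x. if x \<in> U then (norm (f x))\<^sup>2 else 0)"
    by auto
  then show ?thesis
    using assms by (simp add: square_integrable_def Lspace_2_iff borel_measurable_if
        Lebesgue_Measure.integrable_restrict_UNIV)
qed

lemma integrable_lebesgue_on_compact_support:
  fixes f :: "'a::euclidean_space \<Rightarrow> 'b::euclidean_space"
  assumes f: "locally_integrable U f" and U: "U \<in> sets lebesgue" and \<phi>: "\<phi> \<in> test_functions U"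
  shows "integrable (lebesgue_on U) (\<lambda>x. \<phi> x *\<^sub>R f x)"
proof -
  obtain K where K: "smooth \<phi>" "compact K" "K \<subseteq> U" "\<And>x. x \<notin> K \<Longrightarrow> \<phi> x = 0"
    using test_functionsE[OF \<phi>] by metis
  obtain B where B: "0 \<le> B" "\<And>x. \<bar>\<phi> x\<bar> \<le> B" using test_functions_bounded[OF \<phi>] by metis
  have Ks: "K \<in> sets lebesgue" using K(2) by (simp add: compact_imp_closed)
  have fK: "integrable lebesgue (\<lambda>x. if x \<in> K then f x else 0)"
    using f K Lebesgue_Measure.integrable_restrict_UNIV[OF Ks] by (auto simp: locally_integrable_def)
  have \<phi>m: "\<phi> \<in> borel_measurable lebesgue"
    by (rule measurable_completion) (use smooth_borel_measurable[OF K(1)] in simp)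
  have "integrable lebesgue (\<lambda>x. \<phi> x *\<^sub>R (if x \<in> K then f x else 0))"
  proof (rule Bochner_Integration.integrable_bound)
    show "integrable lebesgue (\<lambda>x. B *\<^sub>R (if x \<in> K then f x else 0))"
      by (rule integrable_scaleR_right) (rule fK)
    show "(\<lambda>x. \<phi> x *\<^sub>R (if x \<in> K then f x else 0)) \<in> borel_measurable lebesgue"
      by (rule borel_measurable_scaleR[OF \<phi>m borel_measurable_integrable[OF fK]])
    show "AE x in lebesgue. norm (\<phi> x *\<^sub>R (if x \<in> K then f x else 0)) \<le> norm (B *\<^sub>R (if x \<in> K then f x else 0))"
      using B by (intro AE_I2) (auto intro!: mult_right_mono)
  qed
  moreover have "\<phi> x *\<^sub>R (if x \<in> K then f x else 0) = (if x \<in> U then \<phi> x *\<^sub>R f x else 0)" for x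
    using K by auto
  ultimately show ?thesis
    using Lebesgue_Measure.integrable_restrict_UNIV[OF U, of "\<lambda>x. \<phi> x *\<^sub>R f x"] by (simp only:)
qed

text \<open>Constants are integrable on compact sets, so the bound |y| \<le> 1 + |y|^2
  suffices.\<close>

lemma Lspace_2_locally_integrable:
  fixes f :: "'a::euclidean_space \<Rightarrow> 'b::euclidean_space"
  assumes f: "f \<in> Lspace U 2" and U: "U \<in> sets lebesgue"
  shows "locally_integrable U f"
  unfolding locally_integrable_def
proof (intro allI impI, elim conjE)
  fix K assume K: "compact K" "K \<subseteq> U"
  have Ks: "K \<in> sets lebesgue" using K(1) by (simp add: compact_imp_closed)
  have Uf: "integrable lebesgue (\<lambda>x. if x \<in> U then (norm (f x))\<^sup>2 else 0)"
    using f Lebesgue_Measure.integrable_restrict_UNIV[OF U, of "\<lambda>x. (norm (f x))\<^sup>2"] by (simp add: Lspace_2_iff)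
  have fm: "(\<lambda>x. if x \<in> U then f x else 0) \<in> borel_measurable lebesgue"
    using f borel_measurable_if[OF U, of f] by (simp add: Lspace_2_iff)
  have "integrable lebesgue (\<lambda>x. indicator K x *\<^sub>R (if x \<in> U then f x else 0))"
  proof (rule Bochner_Integration.integrable_bound)
    have "integrable lborel (\<lambda>x. indicator K x *\<^sub>R (1::real))" by (rule borel_integrable_compact) (use K in auto)
    then have "integrable lebesgue (\<lambda>x. indicator K x *\<^sub>R (1::real))"
      by (subst integrable_completion) auto
    then show "integrable lebesgue (\<lambda>x. indicator K x *\<^sub>R (1::real) + (if x \<in> U then (norm (f x))\<^sup>2 else 0))"
      using Uf by (rule Bochner_Integration.integrable_add)
    show "(\<lambda>x. indicator K x *\<^sub>R (if x \<in> U then f x else 0)) \<in> borel_measurable lebesgue"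
      by (intro borel_measurable_scaleR fm borel_measurable_indicator Ks)
    have "norm y \<le> 1 + (norm y)\<^sup>2" for y :: 'b
    proof -
      have "2 * norm y \<le> (norm y)\<^sup>2 + 1" using sum_squares_bound[of "norm y" 1] by simp
      then show ?thesis using norm_ge_zero[of y] by linarith
    qed
    then show "AE x in lebesgue. norm (indicator K x *\<^sub>R (if x \<in> U then f x else 0))
        \<le> norm (indicator K x *\<^sub>R (1::real) + (if x \<in> U then (norm (f x))\<^sup>2 else 0))"
      by (intro AE_I2) (auto split: split_indicator)
  qed
  moreover have "indicator K x *\<^sub>R (if x \<in> U then f x else 0) = (if x \<in> K then f x else 0)" for x
    using K by (auto split: split_indicator)
  ultimately show "integrable (lebesgue_on K) f"
    using Lebesgue_Measure.integrable_restrict_UNIV[OF Ks, of f] by (simp only:)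
qed

lemma locally_integrable_add:
  "locally_integrable U f \<Longrightarrow> locally_integrable U g \<Longrightarrow> locally_integrable U (\<lambda>x. f x + g x)"
  by (simp add: locally_integrable_def)

lemma locally_integrable_scaleR:
  "locally_integrable U f \<Longrightarrow> locally_integrable U (\<lambda>x. c *\<^sub>R f x)"
  by (simp add: locally_integrable_def)

lemma locally_integrable_inner:
  "locally_integrable U f \<Longrightarrow> locally_integrable U (\<lambda>x. f x \<bullet> c)"
  by (simp add: locally_integrable_def)

lemma is_weak_gradientD:
  assumes "is_weak_gradient U v g" "\<phi> \<in> test_functions U" "b \<in> Basis"
  shows "(LINT x|lebesgue_on U. v x * frechet_derivative \<phi> (at x) b) = - (LINT x|lebesgue_on U. (g x \<bullet> b) * \<phi> x)"
  using assms by (simp add: is_weak_gradient_def)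

lemma is_weak_gradient_lin:
  assumes U: "U \<in> sets lebesgue" and v: "is_weak_gradient U v g" and w: "is_weak_gradient U w h"
  shows "is_weak_gradient U (\<lambda>x. v x + c * w x) (\<lambda>x. g x + c *\<^sub>R h x)"
  unfolding is_weak_gradient_def
proof (intro conjI ballI)
  have lv: "locally_integrable U v" "locally_integrable U g" "locally_integrable U w" "locally_integrable U h"
    using v w by (auto simp: is_weak_gradient_def)
  show "locally_integrable U (\<lambda>x. v x + c * w x)"
    using locally_integrable_add[OF lv(1) locally_integrable_scaleR[OF lv(3), of c]] by simp
  show "locally_integrable U (\<lambda>x. g x + c *\<^sub>R h x)"
    by (intro locally_integrable_add locally_integrable_scaleR lv)
  fix \<phi> and b :: 'a assume \<phi>: "\<phi> \<in> test_functions U" and b: "b \<in> Basis"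
  let ?D = "\<lambda>x. frechet_derivative \<phi> (at x) b"
  have i: "integrable (lebesgue_on U) (\<lambda>x. u x * ?D x)" if "locally_integrable U u" for u
    using integrable_lebesgue_on_compact_support[OF that U test_functions_deriv[OF \<phi> b]] by (simp add: mult.commute)
  have j: "integrable (lebesgue_on U) (\<lambda>x. (u x \<bullet> b) * \<phi> x)" if "locally_integrable U u" for u :: "'a \<Rightarrow> 'a"
    using integrable_lebesgue_on_compact_support[OF locally_integrable_inner[OF that] U \<phi>, of b] by (simp add: mult.commute)
  have "(LINT x|lebesgue_on U. (v x + c * w x) * ?D x) = (LINT x|lebesgue_on U. v x * ?D x + c * (w x * ?D x))"
    by (simp add: algebra_simps)
  also have "\<dots> = (LINT x|lebesgue_on U. v x * ?D x) + c * (LINT x|lebesgue_on U. w x * ?D x)"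
    using i[OF lv(1)] i[OF lv(3)] by (simp add: Bochner_Integration.integral_add)
  also have "\<dots> = - ((LINT x|lebesgue_on U. (g x \<bullet> b) * \<phi> x) + c * (LINT x|lebesgue_on U. (h x \<bullet> b) * \<phi> x))"
    by (simp add: is_weak_gradientD[OF v \<phi> b] is_weak_gradientD[OF w \<phi> b])
  also have "(LINT x|lebesgue_on U. (g x \<bullet> b) * \<phi> x) + c * (LINT x|lebesgue_on U. (h x \<bullet> b) * \<phi> x)
      = (LINT x|lebesgue_on U. (g x \<bullet> b) * \<phi> x + c * ((h x \<bullet> b) * \<phi> x))"
    using j[OF lv(2)] j[OF lv(4)] by (simp add: Bochner_Integration.integral_add)
  also have "\<dots> = (LINT x|lebesgue_on U. ((g x + c *\<^sub>R h x) \<bullet> b) * \<phi> x)"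
    by (simp add: inner_simps algebra_simps)
  finally show "(LINT x|lebesgue_on U. (v x + c * w x) * ?D x) = - (LINT x|lebesgue_on U. ((g x + c *\<^sub>R h x) \<bullet> b) * \<phi> x)" .
qed

text \<open>The difference of the two gradients is a weak gradient of a function that vanishes
  almost everywhere on U, so each of its components annihilates all test functions.\<close>

lemma is_weak_gradient_unique:
  assumes U: "open U" and v: "is_weak_gradient U v g" and w: "is_weak_gradient U w h"
    and eq: "AE x in lebesgue. x \<in> U \<longrightarrow> v x = w x"
  shows "AE x in lebesgue. x \<in> U \<longrightarrow> g x = h x"
proof -
  have Us: "U \<in> sets lebesgue" using U by auto
  have d: "is_weak_gradient U (\<lambda>x. v x + (-1) * w x) (\<lambda>x. g x + (-1) *\<^sub>R h x)"
    by (rule is_weak_gradient_lin[OF Us v w])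
  have "AE x in lebesgue. x \<in> U \<longrightarrow> (g x + (-1) *\<^sub>R h x) \<bullet> b = 0" if b: "b \<in> Basis" for b
  proof (rule fundamental_lemma_calculus_of_variations[OF U])
    show "locally_integrable U (\<lambda>x. (g x + (-1) *\<^sub>R h x) \<bullet> b)"
      by (rule locally_integrable_inner) (use d in \<open>simp add: is_weak_gradient_def\<close>)
    fix \<phi> assume \<phi>: "\<phi> \<in> test_functions U"
    have "AE x in lebesgue_on U. (v x + (-1) * w x) * frechet_derivative \<phi> (at x) b = 0"
      using eq Us by (subst AE_restrict_space_iff) auto
    then have "(LINT x|lebesgue_on U. (v x + (-1) * w x) * frechet_derivative \<phi> (at x) b) = 0"
      by (rule integral_eq_zero_AE)
    then show "(LINT x|lebesgue_on U. (g x + (-1) *\<^sub>R h x) \<bullet> b * \<phi> x) = 0"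
      using is_weak_gradientD[OF d \<phi> b] by simp
  qed
  then have "AE x in lebesgue. \<forall>b\<in>Basis. x \<in> U \<longrightarrow> (g x + (-1) *\<^sub>R h x) \<bullet> b = 0"
    by (subst AE_ball_countable) (auto intro: countable_finite)
  then show ?thesis
  proof eventually_elim
    case (elim x)
    then show ?case by (auto intro!: euclidean_eqI[of "g x" "h x"] simp: inner_diff_left)
  qed
qed

definition gradient :: "('a::euclidean_space \<Rightarrow> real) \<Rightarrow> 'a \<Rightarrow> 'a" where
  "gradient \<phi> x = (\<Sum>b\<in>Basis. frechet_derivative \<phi> (at x) b *\<^sub>R b)"

lemma gradient_inner: "b \<in> Basis \<Longrightarrow> gradient \<phi> x \<bullet> b = frechet_derivative \<phi> (at x) b"
  by (simp add: gradient_def)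

lemma lebesgue_on_integral_test_function:
  fixes f :: "'a::euclidean_space \<Rightarrow> real"
  assumes "U \<in> sets lebesgue" "f \<in> test_functions U"
  shows "integrable (lebesgue_on U) f" "(LINT x|lebesgue_on U. f x) = (LINT x|lborel. f x)"
proof -
  have eq: "(\<lambda>x. if x \<in> U then f x else 0) = f" using test_functions_outside[OF assms(2)] by auto
  have m: "f \<in> borel_measurable lborel" using smooth_borel_measurable[OF test_functions_smooth[OF assms(2)]] by simp
  have i: "integrable lebesgue f" using test_functions_integrable[OF assms(2)] m by (subst integrable_completion) auto
  show "integrable (lebesgue_on U) f"
    using i Lebesgue_Measure.integrable_restrict_UNIV[OF assms(1), of f] eq by simp
  show "(LINT x|lebesgue_on U. f x) = (LINT x|lborel. f x)"
    using Lebesgue_Measure.integral_restrict_UNIV[OF assms(1), of f] eq m by (simp add: integral_completion)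
qed

lemma test_function_measurable_on: "\<phi> \<in> test_functions V \<Longrightarrow> \<phi> \<in> borel_measurable (lebesgue_on U)"
  by (intro measurable_restrict_space1 measurable_completion)
     (use smooth_borel_measurable[OF test_functions_smooth, of \<phi> V] in simp)

lemma test_function_Lspace:
  assumes U: "U \<in> sets lebesgue" and \<phi>: "\<phi> \<in> test_functions U"
  shows "\<phi> \<in> Lspace U 2"
  using lebesgue_on_integral_test_function(1)[OF U test_functions_mult[OF \<phi> test_functions_smooth[OF \<phi>]]]
  by (simp add: Lspace_2_iff test_function_measurable_on[OF \<phi>] power2_eq_square)

lemma Lspace_2_add:
  assumes "U \<in> sets lebesgue" "f \<in> Lspace U 2" "g \<in> Lspace U 2"
  shows "(\<lambda>x. f x + g x) \<in> Lspace U 2"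
proof -
  have "(\<lambda>x. (if x \<in> U then f x else 0) + (if x \<in> U then g x else 0)) = (\<lambda>x. if x \<in> U then f x + g x else 0)"
    by auto
  then show ?thesis
    using square_integrable_add[of "\<lambda>x. if x \<in> U then f x else 0" "\<lambda>x. if x \<in> U then g x else 0"] assms
    by (simp add: square_integrable_zero_extension)
qed

lemma Lspace_2_scaleR: "f \<in> Lspace U 2 \<Longrightarrow> (\<lambda>x. c *\<^sub>R f x) \<in> Lspace U 2"
  by (auto simp: Lspace_2_iff power_mult_distrib intro: borel_measurable_scaleR)

lemma Lspace_2_diff:
  assumes "U \<in> sets lebesgue" "f \<in> Lspace U 2" "g \<in> Lspace U 2"
  shows "(\<lambda>x. f x - g x) \<in> Lspace U 2"
  using Lspace_2_add[OF assms(1,2) Lspace_2_scaleR[OF assms(3), of "-1"]] by simp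

lemma Lspace_2_sum:
  assumes "U \<in> sets lebesgue" "\<And>i. i \<in> I \<Longrightarrow> f i \<in> Lspace U 2"
  shows "(\<lambda>x. \<Sum>i\<in>I. f i x) \<in> Lspace U 2"
  using assms(2)
proof (induction I rule: infinite_finite_induct)
  case (insert i I)
  then show ?case using Lspace_2_add[OF assms(1), of "f i" "\<lambda>x. \<Sum>i\<in>I. f i x"] by simp
qed (auto simp: Lspace_2_iff)

lemma gradient_Lspace:
  assumes U: "U \<in> sets lebesgue" and \<phi>: "\<phi> \<in> test_functions U"
  shows "gradient \<phi> \<in> Lspace U 2"
proof -
  have "(\<lambda>x. frechet_derivative \<phi> (at x) b *\<^sub>R b) \<in> Lspace U 2" if b: "b \<in> Basis" for b
    using test_function_Lspace[OF U test_functions_deriv[OF \<phi> b]] b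
    by (auto simp: Lspace_2_iff)
  then show ?thesis
    unfolding gradient_def[abs_def] by (intro Lspace_2_sum[OF U])
qed

lemma is_weak_gradient_test_function:
  assumes U: "U \<in> sets lebesgue" and \<phi>: "\<phi> \<in> test_functions U"
  shows "is_weak_gradient U \<phi> (gradient \<phi>)"
  unfolding is_weak_gradient_def
proof (intro conjI ballI)
  show "locally_integrable U \<phi>" "locally_integrable U (gradient \<phi>)"
    by (intro Lspace_2_locally_integrable test_function_Lspace gradient_Lspace U \<phi>)+
  fix \<psi> and b :: 'a assume \<psi>: "\<psi> \<in> test_functions U" and b: "b \<in> Basis"
  have "(LINT x|lebesgue_on U. \<phi> x * frechet_derivative \<psi> (at x) b) = (LINT x|lborel. \<phi> x * frechet_derivative \<psi> (at x) b)"
    by (rule lebesgue_on_integral_test_function(2)[OF U test_functions_mult[OF \<phi> smooth_frechet_derivative[OF test_functions_smooth[OF \<psi>] b]]])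
  also have "\<dots> = - (LINT x|lborel. frechet_derivative \<phi> (at x) b * \<psi> x)"
    by (rule integral_by_parts_test_functions[OF \<phi> test_functions_smooth[OF \<psi>] b])
  also have "(LINT x|lborel. frechet_derivative \<phi> (at x) b * \<psi> x) = (LINT x|lebesgue_on U. frechet_derivative \<phi> (at x) b * \<psi> x)"
    by (rule lebesgue_on_integral_test_function(2)[OF U test_functions_mult[OF test_functions_deriv[OF \<phi> b] test_functions_smooth[OF \<psi>]], symmetric])
  finally show "(LINT x|lebesgue_on U. \<phi> x * frechet_derivative \<psi> (at x) b) = - (LINT x|lebesgue_on U. gradient \<phi> x \<bullet> b * \<psi> x)"
    by (simp add: gradient_inner[OF b])
qed

lemma wgrad_works: "is_weak_gradient U v g \<Longrightarrow> is_weak_gradient U v (wgrad U v)"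
  unfolding wgrad_def by (rule someI[of "is_weak_gradient U v"])

lemma wgrad_eq:
  assumes "open U" "is_weak_gradient U v g"
  shows "AE x in lebesgue. x \<in> U \<longrightarrow> wgrad U v x = g x"
  using is_weak_gradient_unique[OF assms(1) wgrad_works[OF assms(2)] assms(2)] by simp

lemma Lspace_2_cong_AE:
  fixes f g :: "'a::euclidean_space \<Rightarrow> 'b::euclidean_space"
  assumes U: "U \<in> sets lebesgue" and f: "f \<in> Lspace U 2" and eq: "AE x in lebesgue. x \<in> U \<longrightarrow> f x = g x"
  shows "g \<in> Lspace U 2"
proof -
  let ?f = "\<lambda>x. if x \<in> U then f x else 0" and ?g = "\<lambda>x. if x \<in> U then g x else 0"
  have f': "square_integrable ?f" using f by (simp add: square_integrable_zero_extension[OF U])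
  have eq': "AE x in lebesgue. ?f x = ?g x" using eq by eventually_elim simp
  have "?g \<in> borel_measurable lebesgue"
    using square_integrable_measurable[OF f'] eq' by (rule borel_measurable_AE)
  then have "square_integrable ?g" using square_integrable_cong_AE[OF f' _ eq'] by blast
  then show ?thesis by (simp add: square_integrable_zero_extension[OF U])
qed

lemma Lspace_2_Pair:
  assumes v: "v \<in> Lspace U 2" and g: "g \<in> Lspace U 2"
  shows "(\<lambda>x. (v x, g x)) \<in> Lspace U 2"
proof -
  have "(norm (a, b))\<^sup>2 = (norm a)\<^sup>2 + (norm b)\<^sup>2" for a :: 'b and b :: 'c
    by (simp add: norm_Pair)
  then show ?thesis
    using v g by (simp add: Lspace_2_iff borel_measurable_Pair)
qed

lemma L2inner_integrable:
  assumes U: "U \<in> sets lebesgue" and f: "f \<in> Lspace U 2" and g: "g \<in> Lspace U 2"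
  shows "integrable (lebesgue_on U) (\<lambda>x. f x \<bullet> g x)"
proof -
  have "integrable lebesgue (\<lambda>x. (if x \<in> U then f x else 0) \<bullet> (if x \<in> U then g x else 0))"
    using f g by (intro square_integrable_inner) (simp_all add: square_integrable_zero_extension[OF U])
  moreover have "(\<lambda>x. (if x \<in> U then f x else 0) \<bullet> (if x \<in> U then g x else 0)) = (\<lambda>x. if x \<in> U then f x \<bullet> g x else 0)"
    by auto
  ultimately show ?thesis
    using Lebesgue_Measure.integrable_restrict_UNIV[OF U, of "\<lambda>x. f x \<bullet> g x"] by (simp only:)
qed

text \<open>A function on \<open>U\<close> together with its gradient, as one square integrable function; in this
  form the \<open>H1\<close> inner product is the inner product of \<open>L2\<close>.\<close>

definition h1pair :: "'a::euclidean_space set \<Rightarrow> ('a \<Rightarrow> real) \<Rightarrow> ('a \<Rightarrow> 'a) \<Rightarrow> ('a, real \<times> 'a) L2" where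
  "h1pair U v g = abs_L2 (\<lambda>x. if x \<in> U then (v x, g x) else 0)"

lemma h1pair_square_integrable:
  assumes "U \<in> sets lebesgue" "v \<in> Lspace U 2" "g \<in> Lspace U 2"
  shows "square_integrable (\<lambda>x. if x \<in> U then (v x, g x) else 0)"
  using Lspace_2_Pair[OF assms(2,3)] by (simp add: square_integrable_zero_extension[OF assms(1)])

lemma h1pair_inner:
  assumes U: "U \<in> sets lebesgue" and "v \<in> Lspace U 2" "g \<in> Lspace U 2" "w \<in> Lspace U 2" "h \<in> Lspace U 2"
  shows "h1pair U v g \<bullet> h1pair U w h = L2inner U v w + L2inner U g h"
proof -
  have "h1pair U v g \<bullet> h1pair U w h =
      (LINT x|lebesgue. (if x \<in> U then (v x, g x) else 0) \<bullet> (if x \<in> U then (w x, h x) else 0))"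
    unfolding h1pair_def using assms by (intro inner_abs_L2 h1pair_square_integrable)
  also have "\<dots> = (LINT x|lebesgue. (if x \<in> U then v x \<bullet> w x + g x \<bullet> h x else 0))"
    by (intro Bochner_Integration.integral_cong) auto
  also have "\<dots> = (LINT x|lebesgue_on U. v x \<bullet> w x + g x \<bullet> h x)"
    by (rule Lebesgue_Measure.integral_restrict_UNIV[OF U])
  also have "\<dots> = L2inner U v w + L2inner U g h"
    unfolding L2inner_def using assms
    by (intro Bochner_Integration.integral_add L2inner_integrable)
  finally show ?thesis .
qed

lemma h1pair_norm_sq:
  assumes U: "U \<in> sets lebesgue" and "v \<in> Lspace U 2" "g \<in> Lspace U 2"
  shows "(norm (h1pair U v g))\<^sup>2 = (Lnorm U 2 v)\<^sup>2 + (Lnorm U 2 g)\<^sup>2"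
  using h1pair_inner[OF assms assms(2,3)]
  by (simp add: power2_norm_eq_inner[symmetric] Lnorm_2_sq L2inner_def power2_eq_square[where 'a=real, symmetric])

lemma h1pair_cong:
  assumes U: "U \<in> sets lebesgue" and "v \<in> Lspace U 2" "g \<in> Lspace U 2" "w \<in> Lspace U 2" "h \<in> Lspace U 2"
    and eq: "AE x in lebesgue. x \<in> U \<longrightarrow> v x = w x" "AE x in lebesgue. x \<in> U \<longrightarrow> g x = h x"
  shows "h1pair U v g = h1pair U w h"
  unfolding h1pair_def
proof (rule abs_L2_eqI)
  show "AE x in lebesgue. (if x \<in> U then (v x, g x) else 0) = (if x \<in> U then (w x, h x) else 0)"
    using eq by eventually_elim auto
qed (use assms in \<open>auto intro: h1pair_square_integrable\<close>)

lemma h1pair_lin: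
  assumes U: "U \<in> sets lebesgue" and "v \<in> Lspace U 2" "g \<in> Lspace U 2" "w \<in> Lspace U 2" "h \<in> Lspace U 2"
  shows "h1pair U (\<lambda>x. v x + c * w x) (\<lambda>x. g x + c *\<^sub>R h x) = h1pair U v g + c *\<^sub>R h1pair U w h"
proof -
  have "h1pair U v g + c *\<^sub>R h1pair U w h =
      abs_L2 (\<lambda>x. (if x \<in> U then (v x, g x) else 0) + c *\<^sub>R (if x \<in> U then (w x, h x) else 0))"
    unfolding h1pair_def using assms
    by (simp add: abs_L2_add abs_L2_scaleR h1pair_square_integrable square_integrable_scaleR)
  also have "(\<lambda>x. (if x \<in> U then (v x, g x) else 0) + c *\<^sub>R (if x \<in> U then (w x, h x) else 0))
      = (\<lambda>x. if x \<in> U then (v x + c * w x, g x + c *\<^sub>R h x) else 0)" by auto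
  finally show ?thesis by (simp add: h1pair_def)
qed

lemma h1pair_diff:
  assumes U: "U \<in> sets lebesgue" and "v \<in> Lspace U 2" "g \<in> Lspace U 2" "w \<in> Lspace U 2" "h \<in> Lspace U 2"
  shows "h1pair U (\<lambda>x. v x - w x) (\<lambda>x. g x - h x) = h1pair U v g - h1pair U w h"
  using h1pair_lin[OF assms, of "-1"] by simp

text \<open>\<open>H1norm\<close> refers to a chosen weak gradient; here any square integrable weak
  gradient may take its place.\<close>

lemma H1norm_eq_h1pair:
  assumes U: "open U" and u: "u \<in> Lspace U 2" "h \<in> Lspace U 2" "is_weak_gradient U u h"
  shows "wgrad U u \<in> Lspace U 2" "h1pair U u (wgrad U u) = h1pair U u h" "H1norm U u = norm (h1pair U u h)"
proof -
  have Us: "U \<in> sets lebesgue" using U by auto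
  have eq: "AE x in lebesgue. x \<in> U \<longrightarrow> wgrad U u x = h x" by (rule wgrad_eq[OF U u(3)])
  then have eq': "AE x in lebesgue. x \<in> U \<longrightarrow> h x = wgrad U u x" by eventually_elim simp
  show w: "wgrad U u \<in> Lspace U 2" by (rule Lspace_2_cong_AE[OF Us u(2) eq'])
  show e: "h1pair U u (wgrad U u) = h1pair U u h"
    using w u eq by (intro h1pair_cong[OF Us]) auto
  have "H1norm U u = sqrt ((norm (h1pair U u (wgrad U u)))\<^sup>2)"
    unfolding H1norm_def by (simp only: h1pair_norm_sq[OF Us u(1) w])
  then show "H1norm U u = norm (h1pair U u h)" by (simp add: e)
qed

section \<open>The closed subspace that models \<open>H01\<close>\<close>

lemma subspace_closure_normed:
  fixes S :: "'h::real_normed_vector set"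
  assumes "subspace S"
  shows "subspace (closure S)"
  unfolding subspace_def
proof (intro conjI ballI allI)
  show "0 \<in> closure S" using subspace_0[OF assms] closure_subset by blast
  show "x + y \<in> closure S" if xy: "x \<in> closure S" "y \<in> closure S" for x y
  proof -
    obtain f where f: "\<And>n. f n \<in> S" "f \<longlonglongrightarrow> x" using xy(1) unfolding closure_sequential by blast
    obtain g where g: "\<And>n. g n \<in> S" "g \<longlonglongrightarrow> y" using xy(2) unfolding closure_sequential by blast
    have "(\<lambda>n. f n + g n) \<longlonglongrightarrow> x + y" by (intro tendsto_add f g)
    moreover have "f n + g n \<in> S" for n using assms f g by (intro subspace_add)
    ultimately show ?thesis unfolding closure_sequential by (intro exI[of _ "\<lambda>n. f n + g n"]) simp
  qed
  show "c *\<^sub>R x \<in> closure S" if x: "x \<in> closure S" for c x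
  proof -
    obtain f where f: "\<And>n. f n \<in> S" "f \<longlonglongrightarrow> x" using x unfolding closure_sequential by blast
    have "(\<lambda>n. c *\<^sub>R f n) \<longlonglongrightarrow> c *\<^sub>R x" by (intro tendsto_scaleR tendsto_const f)
    moreover have "c *\<^sub>R f n \<in> S" for n using assms f by (intro subspace_scale)
    ultimately show ?thesis unfolding closure_sequential by (intro exI[of _ "\<lambda>n. c *\<^sub>R f n"]) simp
  qed
qed

text \<open>Its closure in \<open>L2\<close> is the Hilbert space that stands for
  \<open>H01 U\<close>: it is complete as a closed set, and its norm is the H1 norm.\<close>

definition test_space :: "'a::euclidean_space set \<Rightarrow> ('a, real \<times> 'a) L2 set" where
  "test_space U = (\<lambda>\<phi>. h1pair U \<phi> (gradient \<phi>)) ` test_functions U"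

lemma gradient_lin:
  assumes "\<phi> \<in> test_functions U" "\<psi> \<in> test_functions U"
  shows "gradient (\<lambda>x. \<phi> x + c * \<psi> x) x = gradient \<phi> x + c *\<^sub>R gradient \<psi> x"
proof -
  have "((\<lambda>x. \<phi> x + c * \<psi> x) has_derivative (\<lambda>h. frechet_derivative \<phi> (at x) h + c * frechet_derivative \<psi> (at x) h)) (at x)"
    by (intro has_derivative_add has_derivative_mult_right smooth_has_derivative test_functions_smooth[OF assms(1)]
        test_functions_smooth[OF assms(2)])
  from frechet_derivative_at[OF this, symmetric] show ?thesis
    by (simp add: gradient_def scaleR_sum_right sum.distrib scaleR_add_left)
qed

lemma subspace_test_space:
  assumes U: "U \<in> sets lebesgue"
  shows "subspace (test_space U)"
proof -
  have lin: "h1pair U \<phi> (gradient \<phi>) + c *\<^sub>R h1pair U \<psi> (gradient \<psi>) \<in> test_space U"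
    if \<phi>: "\<phi> \<in> test_functions U" and \<psi>: "\<psi> \<in> test_functions U" for \<phi> \<psi> c
  proof -
    have "gradient (\<lambda>x. \<phi> x + c * \<psi> x) = (\<lambda>x. gradient \<phi> x + c *\<^sub>R gradient \<psi> x)"
      using gradient_lin[OF \<phi> \<psi>] by blast
    then have "h1pair U (\<lambda>x. \<phi> x + c * \<psi> x) (gradient (\<lambda>x. \<phi> x + c * \<psi> x))
        = h1pair U \<phi> (gradient \<phi>) + c *\<^sub>R h1pair U \<psi> (gradient \<psi>)"
      using h1pair_lin[OF U test_function_Lspace[OF U \<phi>] gradient_Lspace[OF U \<phi>]
          test_function_Lspace[OF U \<psi>] gradient_Lspace[OF U \<psi>]] by simp
    moreover have "(\<lambda>x. \<phi> x + c * \<psi> x) \<in> test_functions U"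
      by (intro test_functions_add test_functions_cmult \<phi> \<psi>)
    ultimately show ?thesis by (force simp: test_space_def)
  qed
  have zero: "0 \<in> test_space U"
  proof -
    have "gradient (\<lambda>x. 0) = (\<lambda>x::'a. 0)" by (simp add: gradient_def fun_eq_iff)
    moreover have "(\<lambda>x. if x \<in> U then (0::real, 0::'a) else 0) = (\<lambda>x. 0)"
      by (auto simp: zero_prod_def)
    ultimately have "h1pair U (\<lambda>x. 0) (gradient (\<lambda>x. 0)) = 0"
      by (simp add: h1pair_def zero_L2_def)
    then show ?thesis using test_functions_zero[of U] unfolding test_space_def by (metis imageI)
  qed
  have add: "x + c *\<^sub>R y \<in> test_space U" if "x \<in> test_space U" "y \<in> test_space U" for x y c
    using that lin by (auto simp: test_space_def)
  show ?thesis
    unfolding subspace_def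
    using zero add[of _ _ 1] add[OF zero] by auto
qed

lemma H01_weak_gradient:
  assumes "v \<in> H01 U" "open U"
  shows "v \<in> Lspace U 2" "is_weak_gradient U v (wgrad U v)" "wgrad U v \<in> Lspace U 2"
proof -
  obtain g where g: "v \<in> Lspace U 2" "g \<in> Lspace U 2" "is_weak_gradient U v g"
    using assms by (auto simp: H01_def H1_def)
  then show "v \<in> Lspace U 2" "is_weak_gradient U v (wgrad U v)" "wgrad U v \<in> Lspace U 2"
    using wgrad_works H1norm_eq_h1pair(1)[OF assms(2)] by auto
qed

lemma h1pair_test_diff:
  assumes U: "open U" and \<phi>: "\<phi> \<in> test_functions U"
    and v: "v \<in> Lspace U 2" "g \<in> Lspace U 2" "is_weak_gradient U v g"
  shows "H1norm U (\<lambda>x. \<phi> x - v x) = norm (h1pair U \<phi> (gradient \<phi>) - h1pair U v g)"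
proof -
  have Us: "U \<in> sets lebesgue" using U by auto
  note \<phi>' = test_function_Lspace[OF Us \<phi>] gradient_Lspace[OF Us \<phi>]
  have "is_weak_gradient U (\<lambda>x. \<phi> x - v x) (\<lambda>x. gradient \<phi> x - g x)"
    using is_weak_gradient_lin[OF Us is_weak_gradient_test_function[OF Us \<phi>] v(3), of "-1"] by simp
  then have "H1norm U (\<lambda>x. \<phi> x - v x) = norm (h1pair U (\<lambda>x. \<phi> x - v x) (\<lambda>x. gradient \<phi> x - g x))"
    using Lspace_2_diff[OF Us \<phi>'(1) v(1)] Lspace_2_diff[OF Us \<phi>'(2) v(2)]
    by (intro H1norm_eq_h1pair(3)[OF U])
  then show ?thesis by (simp add: h1pair_diff[OF Us \<phi>' v(1,2)])
qed

lemma h1pair_H01_mem: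
  assumes U: "open U" and v: "v \<in> H01 U"
  shows "h1pair U v (wgrad U v) \<in> closure (test_space U)"
proof -
  obtain \<phi> where \<phi>: "\<And>k::nat. \<phi> k \<in> test_functions U" "(\<lambda>k. H1norm U (\<lambda>x. \<phi> k x - v x)) \<longlonglongrightarrow> 0"
    using v by (auto simp: H01_def)
  have "(\<lambda>k. norm (h1pair U (\<phi> k) (gradient (\<phi> k)) - h1pair U v (wgrad U v))) \<longlonglongrightarrow> 0"
    using \<phi>(2) by (simp add: h1pair_test_diff[OF U \<phi>(1) H01_weak_gradient(1,3,2)[OF v U]])
  then have "(\<lambda>k. h1pair U (\<phi> k) (gradient (\<phi> k))) \<longlonglongrightarrow> h1pair U v (wgrad U v)"
    by (simp add: tendsto_norm_zero_iff LIM_zero_iff)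
  moreover have "h1pair U (\<phi> k) (gradient (\<phi> k)) \<in> test_space U" for k using \<phi>(1) by (auto simp: test_space_def)
  ultimately show ?thesis unfolding closure_sequential
    by (intro exI[of _ "\<lambda>k. h1pair U (\<phi> k) (gradient (\<phi> k))"]) simp
qed

lemma rep_L2_Lspace:
  fixes x :: "('a::euclidean_space, real \<times> 'a) L2"
  assumes U: "U \<in> sets lebesgue"
  shows "(\<lambda>t. fst (rep_L2 x t)) \<in> Lspace U 2" "(\<lambda>t. snd (rep_L2 x t)) \<in> Lspace U 2"
proof -
  have m: "rep_L2 x \<in> borel_measurable (lebesgue_on U)"
    by (rule measurable_restrict_space1) (rule rep_L2_measurable)
  have i: "integrable (lebesgue_on U) (\<lambda>t. (norm (rep_L2 x t))\<^sup>2)"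
    using integrable_mult_indicator[OF U square_integrable_integrable[OF rep_L2, of x]] U
    by (subst integrable_restrict_space) auto
  have 1: "(fst z)\<^sup>2 \<le> (norm z)\<^sup>2" and 2: "norm (snd z) \<le> norm z" for z :: "real \<times> 'a"
    by (cases z, simp add: norm_Pair)+
  show "(\<lambda>t. fst (rep_L2 x t)) \<in> Lspace U 2"
    unfolding Lspace_2_iff
  proof
    show m1: "(\<lambda>t. fst (rep_L2 x t)) \<in> borel_measurable (lebesgue_on U)"
      using m by (rule borel_measurable_continuous_on[rotated]) (intro continuous_intros)
    show "integrable (lebesgue_on U) (\<lambda>t. (norm (fst (rep_L2 x t)))\<^sup>2)"
      by (rule Bochner_Integration.integrable_bound[OF i])
         (use m1 in \<open>auto intro!: AE_I2 power_mono 1 borel_measurable_power borel_measurable_norm simp: power2_abs\<close>)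
  qed
  show "(\<lambda>t. snd (rep_L2 x t)) \<in> Lspace U 2"
    unfolding Lspace_2_iff
  proof
    show m1: "(\<lambda>t. snd (rep_L2 x t)) \<in> borel_measurable (lebesgue_on U)"
      using m by (rule borel_measurable_continuous_on[rotated]) (intro continuous_intros)
    show "integrable (lebesgue_on U) (\<lambda>t. (norm (snd (rep_L2 x t)))\<^sup>2)"
      by (rule Bochner_Integration.integrable_bound[OF i])
         (use m1 in \<open>auto intro!: AE_I2 power_mono 2 borel_measurable_power borel_measurable_norm\<close>)
  qed
qed

lemma H01I:
  assumes U: "open U" and v: "v \<in> Lspace U 2" "g \<in> Lspace U 2" "is_weak_gradient U v g"
    and mem: "h1pair U v g \<in> closure (test_space U)"
  shows "v \<in> H01 U"
proof -
  obtain y where y: "\<And>n. y n \<in> test_space U" "y \<longlonglongrightarrow> h1pair U v g"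
    using mem unfolding closure_sequential by blast
  have "\<exists>\<phi>. \<forall>n. \<phi> n \<in> test_functions U \<and> y n = h1pair U (\<phi> n) (gradient (\<phi> n))"
    using y(1) unfolding test_space_def by (intro choice) blast
  then obtain \<phi> where \<phi>: "\<And>n. \<phi> n \<in> test_functions U" and y\<phi>: "\<And>n. y n = h1pair U (\<phi> n) (gradient (\<phi> n))"
    by blast
  have "(\<lambda>n. H1norm U (\<lambda>t. \<phi> n t - v t)) \<longlonglongrightarrow> 0"
    using y(2) by (simp add: h1pair_test_diff[OF U \<phi> v] y\<phi>[symmetric] tendsto_norm_zero_iff LIM_zero_iff)
  then show ?thesis unfolding H01_def H1_def using v \<phi> by blast
qed

text \<open>A limit of test pairs vanishes outside U, and the weak gradient identity survives the
  limit because both sides are continuous linear functionals of the pair. With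
  \<open>h1pair_H01_mem\<close> this identifies \<open>H01 U\<close>, up to almost everywhere
  equality on U, with the closure.\<close>

lemma closure_test_space:
  assumes U: "open U" and x: "x \<in> closure (test_space U)"
  shows "h1pair U (\<lambda>t. fst (rep_L2 x t)) (\<lambda>t. snd (rep_L2 x t)) = x"
    and "is_weak_gradient U (\<lambda>t. fst (rep_L2 x t)) (\<lambda>t. snd (rep_L2 x t))"
    and "(\<lambda>t. fst (rep_L2 x t)) \<in> H01 U"
proof -
  have Us: "U \<in> sets lebesgue" using U by auto
  let ?v = "\<lambda>t. fst (rep_L2 x t)" and ?g = "\<lambda>t. snd (rep_L2 x t)"
  note vg = rep_L2_Lspace[OF Us, of x]
  obtain y where y: "\<And>n. y n \<in> test_space U" "y \<longlonglongrightarrow> x" using x unfolding closure_sequential by blast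
  have "\<exists>\<phi>. \<forall>n. \<phi> n \<in> test_functions U \<and> y n = h1pair U (\<phi> n) (gradient (\<phi> n))"
    using y(1) unfolding test_space_def by (intro choice) blast
  then obtain \<phi> where \<phi>: "\<And>n. \<phi> n \<in> test_functions U" and y\<phi>: "\<And>n. y n = h1pair U (\<phi> n) (gradient (\<phi> n))"
    by blast
  note \<phi>' = test_function_Lspace[OF Us \<phi>] gradient_Lspace[OF Us \<phi>]
  \<comment> \<open>Cutting x off outside U can only bring it closer to y n, which vanishes there.
    So y also converges to the cut-off version of x, and limits are unique.\<close>
  have le: "norm (y n - h1pair U ?v ?g) \<le> norm (y n - x)" for n
  proof (rule power2_le_imp_le)
    let ?d = "\<lambda>t. (if t \<in> U then (\<phi> n t - ?v t, gradient (\<phi> n) t - ?g t) else 0)"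
    have sq: "square_integrable ?d"
      using Lspace_2_diff[OF Us \<phi>'(1) vg(1)] Lspace_2_diff[OF Us \<phi>'(2) vg(2)]
      by (intro h1pair_square_integrable[OF Us])
    have "y n - h1pair U ?v ?g = h1pair U (\<lambda>t. \<phi> n t - ?v t) (\<lambda>t. gradient (\<phi> n) t - ?g t)"
      unfolding y\<phi> by (rule h1pair_diff[OF Us \<phi>' vg, symmetric])
    then have "y n - h1pair U ?v ?g = abs_L2 ?d" by (simp add: h1pair_def)
    then have "(norm (y n - h1pair U ?v ?g))\<^sup>2 = (LINT t|lebesgue. (norm (?d t))\<^sup>2)"
      using norm_sq_abs_L2[OF sq] by simp
    also have "\<dots> \<le> (LINT t|lebesgue. (norm (rep_L2 (y n - x) t))\<^sup>2)"
    proof (rule integral_mono_AE)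
      show "integrable lebesgue (\<lambda>t. (norm (?d t))\<^sup>2)" by (rule square_integrable_integrable[OF sq])
      show "integrable lebesgue (\<lambda>t. (norm (rep_L2 (y n - x) t))\<^sup>2)" by (rule square_integrable_integrable[OF rep_L2])
      have "AE t in lebesgue. rep_L2 (y n) t = (if t \<in> U then (\<phi> n t, gradient (\<phi> n) t) else 0)"
        unfolding y\<phi> h1pair_def by (intro rep_abs_L2 h1pair_square_integrable[OF Us] \<phi>')
      with rep_minus_L2[of "y n" x] show "AE t in lebesgue. (norm (?d t))\<^sup>2 \<le> (norm (rep_L2 (y n - x) t))\<^sup>2"
      proof eventually_elim
        case (elim t)
        show ?case
        proof (cases "t \<in> U")
          case True
          then have "?d t = rep_L2 (y n - x) t" using elim by (simp add: prod_eq_iff)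
          then show ?thesis by simp
        qed simp
      qed
    qed
    also have "\<dots> = (norm (y n - x))\<^sup>2" by (simp add: norm_sq_L2)
    finally show "(norm (y n - h1pair U ?v ?g))\<^sup>2 \<le> (norm (y n - x))\<^sup>2" .
  qed simp
  have "(\<lambda>n. norm (y n - x)) \<longlonglongrightarrow> 0" using y(2) by (simp add: tendsto_norm_zero_iff LIM_zero_iff)
  then have "(\<lambda>n. y n - h1pair U ?v ?g) \<longlonglongrightarrow> 0"
    by (rule Lim_null_comparison[rotated]) (use le in auto)
  then have ylim: "y \<longlonglongrightarrow> h1pair U ?v ?g" by (simp add: LIM_zero_iff)
  show xeq: "h1pair U ?v ?g = x" by (rule LIMSEQ_unique[OF ylim y(2)])
  show wg: "is_weak_gradient U ?v ?g"
    unfolding is_weak_gradient_def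
  proof (intro conjI ballI)
    show "locally_integrable U ?v" "locally_integrable U ?g"
      by (intro Lspace_2_locally_integrable vg Us)+
    fix \<psi> and b :: 'a assume \<psi>: "\<psi> \<in> test_functions U" and b: "b \<in> Basis"
    have D: "(\<lambda>t. frechet_derivative \<psi> (at t) b) \<in> Lspace U 2"
      by (rule test_function_Lspace[OF Us test_functions_deriv[OF \<psi> b]])
    have zero: "(\<lambda>t. 0) \<in> Lspace U 2" by (simp add: Lspace_2_iff)
    have \<psi>b: "(\<lambda>t. \<psi> t *\<^sub>R b) \<in> Lspace U 2"
      using test_function_Lspace[OF Us \<psi>] by (auto simp: Lspace_2_iff power_mult_distrib)
    \<comment> \<open>Inner products with A and B are, up to sign, the two sides of the weak
      gradient identity for the test function \<psi> and the direction b.\<close>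
    define A where "A = h1pair U (\<lambda>t. frechet_derivative \<psi> (at t) b) (\<lambda>t. 0)"
    define B where "B = h1pair U (\<lambda>t. 0) (\<lambda>t. \<psi> t *\<^sub>R b)"
    have A: "h1pair U v g \<bullet> A = (LINT t|lebesgue_on U. v t * frechet_derivative \<psi> (at t) b)"
      and B: "h1pair U v g \<bullet> B = (LINT t|lebesgue_on U. (g t \<bullet> b) * \<psi> t)"
      if "v \<in> Lspace U 2" "g \<in> Lspace U 2" for v g
      unfolding A_def B_def h1pair_inner[OF Us that D zero] h1pair_inner[OF Us that zero \<psi>b]
      by (simp_all add: L2inner_def mult.commute)
    have "y n \<bullet> A = - (y n \<bullet> B)" for n
      unfolding y\<phi> A[OF \<phi>'] B[OF \<phi>']
      by (rule is_weak_gradientD[OF is_weak_gradient_test_function[OF Us \<phi>] \<psi> b])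
    moreover have "(\<lambda>n. y n \<bullet> A) \<longlonglongrightarrow> x \<bullet> A" "(\<lambda>n. - (y n \<bullet> B)) \<longlonglongrightarrow> - (x \<bullet> B)"
      by (intro tendsto_intros y(2))+
    ultimately have "x \<bullet> A = - (x \<bullet> B)" using LIMSEQ_unique by simp
    then show "(LINT t|lebesgue_on U. ?v t * frechet_derivative \<psi> (at t) b) = - (LINT t|lebesgue_on U. ?g t \<bullet> b * \<psi> t)"
      using A[OF vg] B[OF vg] xeq by simp
  qed
  show "?v \<in> H01 U" by (rule H01I[OF U vg wg]) (use xeq x in simp)
qed

section \<open>The nonlinearity\<close>

definition nonlin :: "real \<Rightarrow> real \<Rightarrow> real" where
  "nonlin p s = s * \<bar>s\<bar> powr (p - 1) * ln \<bar>s\<bar>"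

definition nonlin_deriv :: "real \<Rightarrow> real \<Rightarrow> real" where
  "nonlin_deriv p s = \<bar>s\<bar> powr (p - 1) * (p * ln \<bar>s\<bar> + 1)"

text \<open>The primitive of \<open>nonlin p\<close> that vanishes at 0; the energy is half the
  Dirichlet integral minus the integral of this function.\<close>

definition nonlin_prim :: "real \<Rightarrow> real \<Rightarrow> real" where
  "nonlin_prim p s = \<bar>s\<bar> powr (1 + p) * ln \<bar>s\<bar> / (1 + p) - \<bar>s\<bar> powr (1 + p) / (1 + p)\<^sup>2"

text \<open>Controls the derivative of the nonlinearity. Unlike ln |s|, the factor 1 + ln (1 + |s|)
  is positive and increasing in |s|, so that the weight is monotone and can be compared at
  intermediate points.\<close>

definition weight :: "real \<Rightarrow> real \<Rightarrow> real" where
  "weight p s = \<bar>s\<bar> powr (p - 1) * (1 + ln (1 + \<bar>s\<bar>))"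

text \<open>Equal to |s|^(p + 1) (1 + ln (1 + |s|)). It plays the role of a Young function for
  products of the weight with two further functions.\<close>

definition young :: "real \<Rightarrow> real \<Rightarrow> real" where
  "young p s = s\<^sup>2 * weight p s"

text \<open>Apply ln y \<le> y - 1 to y = s^(- a).\<close>

lemma powr_mult_ln_le:
  fixes s a :: real
  assumes "0 < s" "s \<le> 1" "0 < a"
  shows "s powr a * \<bar>ln s\<bar> \<le> 1 / a"
proof -
  have "ln (s powr (- a)) \<le> s powr (- a) - 1"
    using assms by (intro ln_le_minus_one) auto
  then have "a * \<bar>ln s\<bar> \<le> s powr (- a)"
    using assms by (simp add: ln_powr)
  then have "s powr a * (a * \<bar>ln s\<bar>) \<le> s powr a * s powr (- a)"
    by (rule mult_left_mono) simp
  also have "\<dots> = 1" using assms by (simp flip: powr_add)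
  finally show ?thesis using assms by (simp add: field_simps)
qed

lemma DERIV_zero_if_superlinear:
  fixes G :: "real \<Rightarrow> real"
  assumes "0 < e" "G 0 = 0" and G: "\<And>h. h \<noteq> 0 \<Longrightarrow> \<bar>h\<bar> \<le> 1 \<Longrightarrow> \<bar>G h\<bar> \<le> C * (\<bar>h\<bar> * \<bar>h\<bar> powr e)"
  shows "(G has_real_derivative 0) (at 0)"
proof -
  have "((\<lambda>h. \<bar>h\<bar> powr e) \<longlongrightarrow> 0) (at (0::real))"
    by (rule tendsto_zero_powrI[OF tendsto_rabs_zero[OF tendsto_ident_at] tendsto_const _ assms(1)]) auto
  then have "((\<lambda>h. C * \<bar>h\<bar> powr e) \<longlongrightarrow> 0) (at (0::real))"
    using tendsto_mult_right_zero by blast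
  moreover have "\<forall>\<^sub>F h in at 0. norm (G h / h) \<le> C * \<bar>h\<bar> powr e"
  proof -
    have "norm (G h / h) \<le> C * \<bar>h\<bar> powr e" if "h \<noteq> 0" "dist h 0 < 1" for h
      using G[of h] that by (simp add: abs_divide field_simps)
    then show ?thesis unfolding eventually_at by (intro exI[of _ 1]) auto
  qed
  ultimately have "((\<lambda>h. G h / h) \<longlongrightarrow> 0) (at 0)"
    by (rule Lim_null_comparison[rotated])
  then show ?thesis using assms(2) by (simp add: DERIV_def)
qed

text \<open>The exponent is split as q = 1 + e + e with e = (q - 1) / 2: one factor |h|^e absorbs
  the logarithm, the other remains as superlinear gain.\<close>

lemma abs_powr_mult_ln_superlinear:
  fixes h q :: real
  assumes "1 < q" "h \<noteq> 0" "\<bar>h\<bar> \<le> 1"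
  shows "\<bar>\<bar>h\<bar> powr q * ln \<bar>h\<bar>\<bar> \<le> 2 / (q - 1) * (\<bar>h\<bar> * \<bar>h\<bar> powr ((q - 1) / 2))"
proof -
  let ?e = "(q - 1) / 2"
  have "\<bar>h\<bar> powr q = \<bar>h\<bar> powr (1 + ?e + ?e)" by (simp add: field_simps)
  also have "\<dots> = \<bar>h\<bar> * \<bar>h\<bar> powr ?e * \<bar>h\<bar> powr ?e"
    unfolding powr_add using assms by simp
  finally have "\<bar>\<bar>h\<bar> powr q * ln \<bar>h\<bar>\<bar> = (\<bar>h\<bar> * \<bar>h\<bar> powr ?e) * (\<bar>h\<bar> powr ?e * \<bar>ln \<bar>h\<bar>\<bar>)"
    by (simp add: abs_mult)
  also have "\<dots> \<le> (\<bar>h\<bar> * \<bar>h\<bar> powr ?e) * (1 / ?e)"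
    using assms by (intro mult_left_mono powr_mult_ln_le) auto
  finally show ?thesis by (simp add: mult.commute)
qed

lemma abs_powr_superlinear:
  fixes h q :: real
  assumes "1 < q" "h \<noteq> 0" "\<bar>h\<bar> \<le> 1"
  shows "\<bar>\<bar>h\<bar> powr q\<bar> \<le> \<bar>h\<bar> * \<bar>h\<bar> powr ((q - 1) / 2)"
proof -
  have "\<bar>h\<bar> powr q \<le> \<bar>h\<bar> powr (1 + (q - 1) / 2)"
  proof (rule powr_mono')
    show "1 + (q - 1) / 2 \<le> q" using assms by (simp add: field_simps)
  qed (use assms in auto)
  then show ?thesis using assms by (simp add: powr_add)
qed

lemma nonlin_DERIV_pos:
  assumes "0 < s"
  shows "((\<lambda>s. s * s powr (p - 1) * ln s) has_real_derivative nonlin_deriv p s) (at s)"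
proof -
  have "((\<lambda>s. s powr p * ln s) has_real_derivative p * s powr (p - 1) * ln s + s powr p * (1 / s)) (at s)"
    using assms by (auto intro!: derivative_eq_intros simp: powr_diff)
  moreover have "s powr p * (1 / s) = s powr (p - 1)" using assms by (simp add: powr_diff)
  ultimately have "((\<lambda>s. s powr p * ln s) has_real_derivative nonlin_deriv p s) (at s)"
    using assms by (simp add: nonlin_deriv_def algebra_simps)
  then show ?thesis
    by (rule has_field_derivative_transform_within_open[of _ _ _ "{0<..}"])
       (use assms in \<open>auto simp: powr_diff\<close>)
qed

lemma nonlin_prim_DERIV_pos:
  assumes "0 < s" "1 < p"
  shows "((\<lambda>s. s powr (1 + p) * ln s / (1 + p) - s powr (1 + p) / (1 + p)\<^sup>2) has_real_derivative nonlin p s) (at s)"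
proof -
  have D: "((\<lambda>s. s powr (1 + p)) has_real_derivative (1 + p) * s powr p) (at s)"
    using has_real_derivative_powr[of s "1 + p"] assms by simp
  have L: "(ln has_real_derivative 1 / s) (at s)" using assms(1) by (rule DERIV_ln_divide)
  have "((\<lambda>s. s powr (1 + p) * ln s / (1 + p) - s powr (1 + p) / (1 + p)\<^sup>2) has_real_derivative
      ((1 + p) * s powr p * ln s + s powr (1 + p) * (1 / s)) / (1 + p) - (1 + p) * s powr p / (1 + p)\<^sup>2) (at s)"
    by (intro DERIV_diff DERIV_cdivide D) (use DERIV_mult[OF D L] in \<open>simp add: add.commute mult.commute\<close>)
  moreover have "s powr (1 + p) * (1 / s) = s powr p" using assms by (simp add: powr_add)
  moreover have "(1 + p) * s powr p / (1 + p)\<^sup>2 = s powr p / (1 + p)"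
    using assms by (simp add: power2_eq_square)
  moreover have "((1 + p) * s powr p * ln s + s powr p) / (1 + p) - s powr p / (1 + p) = s powr p * ln s"
    using assms by (simp add: add_divide_distrib)
  moreover have "s powr p * ln s = nonlin p s"
    using assms by (simp add: nonlin_def powr_diff)
  ultimately show ?thesis by (simp only:)
qed

text \<open>Negative arguments reduce to positive ones by oddness. At 0 the condition p > 1 makes
  the function superlinear in spite of the logarithm, so the derivative is 0;
  \<open>nonlin_deriv p 0\<close> has this value because \<open>powr\<close> with base 0 is
  0.\<close>

lemma nonlin_has_derivative:
  assumes p: "1 < p"
  shows "(nonlin p has_real_derivative nonlin_deriv p s) (at s)"
proof -
  consider "0 < s" | "s < 0" | "s = 0" by linarith
  then show ?thesis
  proof cases
    case 1
    from nonlin_DERIV_pos[OF 1] show ?thesis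
      by (rule has_field_derivative_transform_within_open[of _ _ _ "{0<..}"])
         (use 1 in \<open>auto simp: nonlin_def\<close>)
  next
    case 2
    have "((\<lambda>s. - ((- s) * (- s) powr (p - 1) * ln (- s))) has_real_derivative - (nonlin_deriv p (- s) * (- 1))) (at s)"
      by (rule DERIV_minus, rule DERIV_chain2[OF nonlin_DERIV_pos]) (use 2 in \<open>auto intro!: derivative_eq_intros\<close>)
    moreover have "- (nonlin_deriv p (- s) * (- 1)) = nonlin_deriv p s" by (simp add: nonlin_deriv_def)
    ultimately have "((\<lambda>s. - ((- s) * (- s) powr (p - 1) * ln (- s))) has_real_derivative nonlin_deriv p s) (at s)"
      by (simp only:)
    then show ?thesis
      by (rule has_field_derivative_transform_within_open[of _ _ _ "{..<0}"])
         (use 2 in \<open>auto simp: nonlin_def\<close>)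
  next
    case 3
    have "(nonlin p has_real_derivative 0) (at 0)"
    proof (rule DERIV_zero_if_superlinear[of "(p - 1) / 2" _ "2 / (p - 1)"])
      fix h :: real assume h: "h \<noteq> 0" "\<bar>h\<bar> \<le> 1"
      have "\<bar>nonlin p h\<bar> = \<bar>\<bar>h\<bar> powr p * ln \<bar>h\<bar>\<bar>"
        using h by (simp add: nonlin_def abs_mult powr_diff)
      then show "\<bar>nonlin p h\<bar> \<le> 2 / (p - 1) * (\<bar>h\<bar> * \<bar>h\<bar> powr ((p - 1) / 2))"
        using abs_powr_mult_ln_superlinear[OF p h] by simp
    qed (use p in \<open>auto simp: nonlin_def\<close>)
    moreover have "nonlin_deriv p 0 = 0" by (simp add: nonlin_deriv_def)
    ultimately show ?thesis using 3 by simp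
  qed
qed

lemma nonlin_prim_has_derivative:
  assumes p: "1 < p"
  shows "(nonlin_prim p has_real_derivative nonlin p s) (at s)"
proof -
  consider "0 < s" | "s < 0" | "s = 0" by linarith
  then show ?thesis
  proof cases
    case 1
    from nonlin_prim_DERIV_pos[OF 1 p] show ?thesis
      by (rule has_field_derivative_transform_within_open[of _ _ _ "{0<..}"])
         (use 1 in \<open>auto simp: nonlin_prim_def\<close>)
  next
    case 2
    have "((\<lambda>s. (- s) powr (1 + p) * ln (- s) / (1 + p) - (- s) powr (1 + p) / (1 + p)\<^sup>2) has_real_derivative nonlin p (- s) * (- 1)) (at s)"
      by (rule DERIV_chain2[OF nonlin_prim_DERIV_pos[OF _ p]]) (use 2 in \<open>auto intro!: derivative_eq_intros\<close>)
    moreover have "nonlin p (- s) * (- 1) = nonlin p s" by (simp add: nonlin_def)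
    ultimately have "((\<lambda>s. (- s) powr (1 + p) * ln (- s) / (1 + p) - (- s) powr (1 + p) / (1 + p)\<^sup>2) has_real_derivative nonlin p s) (at s)"
      by (simp only:)
    then show ?thesis
      by (rule has_field_derivative_transform_within_open[of _ _ _ "{..<0}"])
         (use 2 in \<open>auto simp: nonlin_prim_def\<close>)
  next
    case 3
    have "(nonlin_prim p has_real_derivative 0) (at 0)"
    proof (rule DERIV_zero_if_superlinear[of "p / 2" _ "2 / p + 1"])
      fix h :: real assume h: "h \<noteq> 0" "\<bar>h\<bar> \<le> 1"
      let ?A = "\<bar>h\<bar> powr (1 + p) * ln \<bar>h\<bar>" and ?B = "\<bar>h\<bar> powr (1 + p)" and ?R = "\<bar>h\<bar> * \<bar>h\<bar> powr (p / 2)"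
      have A: "\<bar>?A\<bar> \<le> 2 / p * ?R" and B: "\<bar>?B\<bar> \<le> ?R"
        using abs_powr_mult_ln_superlinear[of "1 + p", OF _ h] abs_powr_superlinear[of "1 + p", OF _ h] p by auto
      have "\<bar>nonlin_prim p h\<bar> \<le> \<bar>?A\<bar> / (1 + p) + \<bar>?B\<bar> / (1 + p)\<^sup>2"
        unfolding nonlin_prim_def using p abs_triangle_ineq4[of "?A / (1 + p)" "?B / (1 + p)\<^sup>2"] by simp
      also have "\<bar>?A\<bar> / (1 + p) \<le> \<bar>?A\<bar> / 1" using p by (intro divide_left_mono) auto
      also have "\<bar>?B\<bar> / (1 + p)\<^sup>2 \<le> \<bar>?B\<bar> / 1"
      proof (rule divide_left_mono)
        show "1 \<le> (1 + p)\<^sup>2" using p by (intro one_le_power) simp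
        show "0 < (1 + p)\<^sup>2 * 1" using p by simp
      qed simp
      finally show "\<bar>nonlin_prim p h\<bar> \<le> (2 / p + 1) * (\<bar>h\<bar> * \<bar>h\<bar> powr (p / 2))"
        using A B by (simp add: algebra_simps)
    qed (use p in \<open>auto simp: nonlin_prim_def\<close>)
    then show ?thesis using 3 by (simp add: nonlin_def)
  qed
qed

section \<open>Growth estimates for the weight and the nonlinearity\<close>

lemma weight_nonneg: "0 \<le> weight p s"
  by (simp add: weight_def)

lemma young_nonneg: "0 \<le> young p s"
  by (simp add: young_def weight_nonneg)

lemma weight_0 [simp]: "weight p 0 = 0"
  by (simp add: weight_def)

lemma weight_mono: "1 < p \<Longrightarrow> \<bar>s\<bar> \<le> \<bar>t\<bar> \<Longrightarrow> weight p s \<le> weight p t"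
  unfolding weight_def by (intro mult_mono powr_mono2 add_left_mono ln_mono) auto

lemma young_abs [simp]: "young p \<bar>s\<bar> = young p s" and weight_abs [simp]: "weight p \<bar>s\<bar> = weight p s"
  by (auto simp: young_def weight_def)

text \<open>The largest of the three arguments dominates the product.\<close>
lemma weight_mult_le_young:
  assumes p: "1 < p"
  shows "weight p a * (\<bar>z\<bar> * \<bar>w\<bar>) \<le> young p a + young p z + young p w"
proof -
  define M where "M = max \<bar>a\<bar> (max \<bar>z\<bar> \<bar>w\<bar>)"
  have M: "\<bar>a\<bar> \<le> M" "\<bar>z\<bar> \<le> M" "\<bar>w\<bar> \<le> M"
    unfolding M_def by (rule max.cobounded1, metis max.cobounded1 max.cobounded2 order_trans,
        metis max.cobounded2 order_trans)
  have "0 \<le> M" using M(1) abs_ge_zero order_trans by blast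
  note M = M this
  have "weight p a * (\<bar>z\<bar> * \<bar>w\<bar>) \<le> weight p M * (M * M)"
    using M by (intro mult_mono weight_mono p) (simp_all add: weight_nonneg)
  also have "\<dots> = young p M" by (simp add: young_def power2_eq_square)
  also have "\<dots> \<le> young p a + young p z + young p w"
  proof -
    have "M = \<bar>a\<bar> \<or> M = \<bar>z\<bar> \<or> M = \<bar>w\<bar>" unfolding M_def max_def by metis
    then show ?thesis using young_nonneg[of p a] young_nonneg[of p z] young_nonneg[of p w]
      by (elim disjE) simp_all
  qed
  finally show ?thesis .
qed

lemma young_eq: "young p s = \<bar>s\<bar> powr (1 + p) * (1 + ln (1 + \<bar>s\<bar>))"
proof (cases "s = 0")
  case False
  have "\<bar>s\<bar> powr (1 + p) = \<bar>s\<bar> powr (2 + (p - 1))" by (simp add: add.commute)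
  also have "\<dots> = s\<^sup>2 * \<bar>s\<bar> powr (p - 1)"
    using False by (subst powr_add) simp
  finally show ?thesis by (simp add: young_def weight_def)
qed (simp add: young_def)

text \<open>The logarithm splits as ln (1 + c |s|) \<le> ln c + ln (1 + |s|). This control under
  dilation transfers bounds from a small ball to every ball.\<close>

lemma young_scale:
  assumes c: "1 \<le> c"
  shows "young p (c * s) \<le> c powr (1 + p) * (1 + ln c) * young p s"
proof -
  have "1 + \<bar>c * s\<bar> \<le> c * (1 + \<bar>s\<bar>)" using c by (simp add: abs_mult algebra_simps)
  then have "ln (1 + \<bar>c * s\<bar>) \<le> ln (c * (1 + \<bar>s\<bar>))" by (intro ln_mono) auto
  also have "\<dots> = ln c + ln (1 + \<bar>s\<bar>)" using c by (intro ln_mult_pos) auto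
  finally have le: "ln (1 + \<bar>c * s\<bar>) \<le> ln c + ln (1 + \<bar>s\<bar>)" .
  have "0 \<le> ln c * ln (1 + \<bar>s\<bar>)" using c by simp
  with le have "1 + ln (1 + \<bar>c * s\<bar>) \<le> (1 + ln c) + (1 + ln c) * ln (1 + \<bar>s\<bar>)"
    unfolding distrib_right by linarith
  also have "\<dots> = (1 + ln c) * (1 + ln (1 + \<bar>s\<bar>))" by (simp add: algebra_simps)
  finally have "young p (c * s) \<le> \<bar>c * s\<bar> powr (1 + p) * ((1 + ln c) * (1 + ln (1 + \<bar>s\<bar>)))"
    unfolding young_eq by (rule mult_left_mono) simp
  also have "\<dots> = c powr (1 + p) * (1 + ln c) * young p s"
    using c by (simp add: young_eq abs_mult powr_mult)
  finally show ?thesis .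
qed

lemma abs_powr_le_young: "\<bar>s\<bar> powr (1 + p) \<le> young p s"
  unfolding young_eq by (simp add: mult_le_cancel_left1)

text \<open>In |s|^(p + 1) = s^2 |s|^(p - 1) the second factor absorbs the logarithm, so the
  negative part of the logarithmic integrand is controlled by the square.\<close>

lemma neg_part_powr_ln_le:
  fixes p s :: real
  assumes p: "1 < p" and s: "\<bar>s\<bar> \<le> 1"
  shows "\<bar>\<bar>s\<bar> powr (1 + p) * ln \<bar>s\<bar>\<bar> \<le> s\<^sup>2 / (p - 1)"
proof (cases "s = 0")
  case False
  have "\<bar>s\<bar> powr (1 + p) = \<bar>s\<bar> powr (2 + (p - 1))" by (simp add: add.commute)
  also have "\<dots> = s\<^sup>2 * \<bar>s\<bar> powr (p - 1)" using False by (subst powr_add) simp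
  finally have "\<bar>\<bar>s\<bar> powr (1 + p) * ln \<bar>s\<bar>\<bar> = s\<^sup>2 * (\<bar>s\<bar> powr (p - 1) * \<bar>ln \<bar>s\<bar>\<bar>)"
    by (simp add: abs_mult)
  also have "\<dots> \<le> s\<^sup>2 * (1 / (p - 1))"
    using False s p by (intro mult_left_mono powr_mult_ln_le) auto
  finally show ?thesis by (simp only: times_divide_eq_right mult_1_right)
next
  case True
  then have "\<bar>s\<bar> powr (1 + p) = 0" by simp
  then show ?thesis using p by (simp only: mult_zero_left abs_zero) simp
qed

lemma abs_powr_ln_le_young:
  assumes p: "1 < p"
  shows "\<bar>\<bar>s\<bar> powr (1 + p) * ln \<bar>s\<bar>\<bar> \<le> young p s + s\<^sup>2 / (p - 1)"
proof (cases "\<bar>s\<bar> \<le> 1")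
  case True
  then show ?thesis using neg_part_powr_ln_le[OF p True] young_nonneg[of p s] by linarith
next
  case False
  then have "ln \<bar>s\<bar> \<le> ln (1 + \<bar>s\<bar>)" "0 \<le> ln \<bar>s\<bar>" by (simp_all add: ln_mono)
  then have "\<bar>ln \<bar>s\<bar>\<bar> \<le> 1 + ln (1 + \<bar>s\<bar>)" by linarith
  then have "\<bar>\<bar>s\<bar> powr (1 + p) * ln \<bar>s\<bar>\<bar> \<le> young p s"
    unfolding young_eq abs_mult by (intro mult_mono) auto
  moreover have "0 \<le> s\<^sup>2 / (p - 1)" using p by simp
  ultimately show ?thesis by linarith
qed

text \<open>A bound on the logarithmic integral, which is what the sign of \<open>I\<close>
  provides, thereby bounds the integral of \<open>young p\<close> up to the L2 norm. For |s| < 2 the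
  left side is at most a multiple of s^2, and 4 / (p - 1) compensates the negative part of the
  logarithm.\<close>

lemma young_le:
  assumes p: "1 < p"
  shows "young p s \<le> 4 * (\<bar>s\<bar> powr (1 + p) * ln \<bar>s\<bar>) + (4 * 2 powr (p - 1) + 4 / (p - 1)) * s\<^sup>2"
proof (cases "\<bar>s\<bar> < 2")
  case True
  have "weight p s \<le> 2 powr (p - 1) * 4"
    unfolding weight_def
  proof (rule mult_mono)
    show "\<bar>s\<bar> powr (p - 1) \<le> 2 powr (p - 1)" using True p by (intro powr_mono2) auto
    have "ln (1 + \<bar>s\<bar>) \<le> (1 + \<bar>s\<bar>) - 1" by (intro ln_le_minus_one) auto
    then show "1 + ln (1 + \<bar>s\<bar>) \<le> 4" using True by simp
  qed auto
  then have "s\<^sup>2 * weight p s \<le> s\<^sup>2 * (2 powr (p - 1) * 4)" by (rule mult_left_mono) simp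
  then have 1: "young p s \<le> 4 * 2 powr (p - 1) * s\<^sup>2" by (simp add: young_def mult.commute mult.left_commute)
  have "- (s\<^sup>2 / (p - 1)) \<le> \<bar>s\<bar> powr (1 + p) * ln \<bar>s\<bar>"
  proof (cases "\<bar>s\<bar> \<le> 1")
    case True
    then show ?thesis using neg_part_powr_ln_le[OF p True] by linarith
  next
    case False
    then have "0 \<le> \<bar>s\<bar> powr (1 + p) * ln \<bar>s\<bar>" by simp
    moreover have "0 \<le> s\<^sup>2 / (p - 1)" using p by simp
    ultimately show ?thesis by linarith
  qed
  then show ?thesis using 1 by (simp add: algebra_simps)
next
  case False
  \<comment> \<open>For |s| \<ge> 2 both summands of 1 + ln (1 + |s|) are at most 2 ln |s|: the
    first since ln 2 \<ge> 1/2, the second since 1 + |s| \<le> |s|^2.\<close>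
  have l2: "1 / 2 \<le> ln (2::real)" by (rule ln2_ge_two_thirds[THEN order_trans[rotated]]) simp
  have "ln 2 \<le> ln \<bar>s\<bar>" using False by (intro ln_mono) auto
  then have 1: "1 \<le> 2 * ln \<bar>s\<bar>" using l2 by linarith
  have "ln (1 + \<bar>s\<bar>) \<le> ln (\<bar>s\<bar> * \<bar>s\<bar>)"
    using False mult_mono[of 2 "\<bar>s\<bar>" "\<bar>s\<bar>" "\<bar>s\<bar>"] by (intro ln_mono) auto
  also have "\<dots> = 2 * ln \<bar>s\<bar>" using False by (subst ln_mult_pos) auto
  finally have "1 + ln (1 + \<bar>s\<bar>) \<le> 4 * ln \<bar>s\<bar>" using 1 by linarith
  then have "young p s \<le> \<bar>s\<bar> powr (1 + p) * (4 * ln \<bar>s\<bar>)"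
    unfolding young_eq by (rule mult_left_mono) simp
  moreover have "0 \<le> (4 * 2 powr (p - 1) + 4 / (p - 1)) * s\<^sup>2" using p by simp
  ultimately show ?thesis by (simp add: mult.commute mult.left_commute)
qed

text \<open>The sum of the bounds that occur: p / (p - 1) for p |s|^(p - 1) |ln |s|| and 1 for
  |s|^(p - 1) when |s| \<le> 1, and p as the multiple of the weight when |s| > 1.\<close>

definition nonlin_const :: "real \<Rightarrow> real" where
  "nonlin_const p = p + p / (p - 1) + 1"

lemma nonlin_const_pos: "1 < p \<Longrightarrow> 0 < nonlin_const p"
  unfolding nonlin_const_def by (intro add_pos_pos divide_pos_pos) auto

lemma nonlin_deriv_le:
  assumes p: "1 < p"
  shows "\<bar>nonlin_deriv p s\<bar> \<le> nonlin_const p * (1 + weight p s)"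
proof (cases "\<bar>s\<bar> \<le> 1")
  case True
  have "\<bar>s\<bar> powr (p - 1) * \<bar>ln \<bar>s\<bar>\<bar> \<le> 1 / (p - 1)"
  proof (cases "s = 0")
    case False
    then show ?thesis using p True by (intro powr_mult_ln_le) auto
  qed (use p in simp)
  then have A: "p * (\<bar>s\<bar> powr (p - 1) * \<bar>ln \<bar>s\<bar>\<bar>) \<le> p * (1 / (p - 1))"
    using p by (intro mult_left_mono) auto
  have B: "\<bar>s\<bar> powr (p - 1) \<le> 1" using p True powr_le1[of "p - 1" "\<bar>s\<bar>"] by simp
  have "\<bar>nonlin_deriv p s\<bar> = \<bar>p * (\<bar>s\<bar> powr (p - 1) * ln \<bar>s\<bar>) + \<bar>s\<bar> powr (p - 1)\<bar>"
    by (simp add: nonlin_deriv_def algebra_simps)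
  also have "\<dots> \<le> p * (\<bar>s\<bar> powr (p - 1) * \<bar>ln \<bar>s\<bar>\<bar>) + \<bar>s\<bar> powr (p - 1)"
    using abs_triangle_ineq[of "p * (\<bar>s\<bar> powr (p - 1) * ln \<bar>s\<bar>)" "\<bar>s\<bar> powr (p - 1)"] p by (simp add: abs_mult)
  also have "\<dots> \<le> nonlin_const p" using A B p by (simp add: nonlin_const_def)
  also have "\<dots> \<le> nonlin_const p * (1 + weight p s)"
    using weight_nonneg[of p s] nonlin_const_pos[OF p] by (simp add: mult_le_cancel_left1)
  finally show ?thesis .
next
  case False
  then have l: "0 \<le> ln \<bar>s\<bar>" "ln \<bar>s\<bar> \<le> ln (1 + \<bar>s\<bar>)" by (auto intro: ln_mono)
  have "\<bar>p * ln \<bar>s\<bar> + 1\<bar> = p * ln \<bar>s\<bar> + 1" using l p by simp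
  also have "\<dots> \<le> p * ln (1 + \<bar>s\<bar>) + p" using l p mult_left_mono[of "ln \<bar>s\<bar>" "ln (1 + \<bar>s\<bar>)" p] by linarith
  also have "\<dots> = p * (1 + ln (1 + \<bar>s\<bar>))" by (simp add: algebra_simps)
  finally have "\<bar>nonlin_deriv p s\<bar> \<le> \<bar>s\<bar> powr (p - 1) * (p * (1 + ln (1 + \<bar>s\<bar>)))"
    unfolding nonlin_deriv_def abs_mult by (intro mult_mono) auto
  also have "\<dots> = p * weight p s" by (simp add: weight_def)
  also have "\<dots> \<le> nonlin_const p * (1 + weight p s)"
    using p weight_nonneg[of p s] by (intro mult_mono) (auto simp: nonlin_const_def)
  finally show ?thesis .
qed

text \<open>An intermediate point satisfies |z| \<le> |a| or |z| \<le> |b|, and the weight is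
  monotone; the sum of both weights avoids a maximum under later integrals.\<close>

lemma nonlin_deriv_between:
  assumes p: "1 < p" and z: "a \<le> z \<and> z \<le> b \<or> b \<le> z \<and> z \<le> a"
  shows "\<bar>nonlin_deriv p z\<bar> \<le> nonlin_const p * (1 + weight p a + weight p b)"
proof -
  have "\<bar>z\<bar> \<le> \<bar>a\<bar> \<or> \<bar>z\<bar> \<le> \<bar>b\<bar>" using z by linarith
  then have "weight p z \<le> weight p a + weight p b"
    using weight_mono[OF p, of z a] weight_mono[OF p, of z b] weight_nonneg[of p a] weight_nonneg[of p b]
    by (elim disjE) simp_all
  then have "nonlin_const p * (1 + weight p z) \<le> nonlin_const p * (1 + weight p a + weight p b)"
    using nonlin_const_pos[OF p] by (intro mult_left_mono) auto
  then show ?thesis using nonlin_deriv_le[OF p, of z] by linarith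
qed

lemma DERIV_mean_value:
  fixes g :: "real \<Rightarrow> real"
  assumes "\<And>x. (g has_real_derivative g' x) (at x)"
  obtains z where "a \<le> z \<and> z \<le> b \<or> b \<le> z \<and> z \<le> a" "g b - g a = g' z * (b - a)"
proof -
  consider "a < b" | "b < a" | "a = b" by linarith
  then show ?thesis
  proof cases
    case 1
    then obtain z where "a < z" "z < b" "g b - g a = (b - a) * g' z" using MVT2[OF 1] assms by blast
    then show ?thesis using 1 by (intro that[of z]) auto
  next
    case 2
    then obtain z where "b < z" "z < a" "g a - g b = (a - b) * g' z" using MVT2[OF 2] assms by blast
    then show ?thesis using 2 by (intro that[of z]) (auto simp: algebra_simps)
  next
    case 3
    then show ?thesis by (intro that[of a]) auto
  qed
qed

lemma nonlin_lipschitz: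
  assumes p: "1 < p"
  shows "\<bar>nonlin p b - nonlin p a\<bar> \<le> nonlin_const p * (1 + weight p a + weight p b) * \<bar>b - a\<bar>"
proof -
  obtain z where z: "a \<le> z \<and> z \<le> b \<or> b \<le> z \<and> z \<le> a" "nonlin p b - nonlin p a = nonlin_deriv p z * (b - a)"
    using DERIV_mean_value[of "nonlin p" "nonlin_deriv p"] nonlin_has_derivative[OF p] by metis
  then show ?thesis
    using nonlin_deriv_between[OF p z(1)] unfolding z(2) abs_mult by (intro mult_right_mono) auto
qed

text \<open>Two applications of the mean value theorem, to the primitive and then to
  \<open>nonlin p\<close>; both intermediate points lie between a and b.\<close>

lemma nonlin_prim_taylor:
  assumes p: "1 < p"
  shows "\<bar>nonlin_prim p b - nonlin_prim p a - nonlin p a * (b - a)\<bar>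
    \<le> nonlin_const p * (1 + weight p a + weight p b) * (b - a)\<^sup>2"
proof -
  obtain z where z: "a \<le> z \<and> z \<le> b \<or> b \<le> z \<and> z \<le> a" "nonlin_prim p b - nonlin_prim p a = nonlin p z * (b - a)"
    using DERIV_mean_value[of "nonlin_prim p" "nonlin p"] nonlin_prim_has_derivative[OF p] by metis
  obtain y where y: "a \<le> y \<and> y \<le> z \<or> z \<le> y \<and> y \<le> a" "nonlin p z - nonlin p a = nonlin_deriv p y * (z - a)"
    using DERIV_mean_value[of "nonlin p" "nonlin_deriv p"] nonlin_has_derivative[OF p] by metis
  have y': "a \<le> y \<and> y \<le> b \<or> b \<le> y \<and> y \<le> a" using y(1) z(1) by linarith
  have za: "\<bar>z - a\<bar> \<le> \<bar>b - a\<bar>" using z(1) by linarith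
  have "nonlin_prim p b - nonlin_prim p a - nonlin p a * (b - a) = nonlin_deriv p y * (z - a) * (b - a)"
    unfolding z(2) y(2)[symmetric] by (simp add: algebra_simps)
  then have "\<bar>nonlin_prim p b - nonlin_prim p a - nonlin p a * (b - a)\<bar> = \<bar>nonlin_deriv p y\<bar> * (\<bar>z - a\<bar> * \<bar>b - a\<bar>)"
    by (simp add: abs_mult)
  also have "\<dots> \<le> (nonlin_const p * (1 + weight p a + weight p b)) * (\<bar>b - a\<bar> * \<bar>b - a\<bar>)"
    using za nonlin_deriv_between[OF p y'] by (intro mult_mono) auto
  finally show ?thesis by (simp add: power2_eq_square)
qed

lemma nonlin_0 [simp]: "nonlin p 0 = 0" and nonlin_prim_0 [simp]: "nonlin_prim p 0 = 0"
  by (simp_all add: nonlin_def nonlin_prim_def)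

lemma nonlin_measurable [measurable]: "nonlin p \<in> borel_measurable borel"
  and nonlin_prim_measurable [measurable]: "nonlin_prim p \<in> borel_measurable borel"
  and weight_measurable [measurable]: "weight p \<in> borel_measurable borel"
  and young_measurable [measurable]: "young p \<in> borel_measurable borel"
  unfolding nonlin_def nonlin_prim_def weight_def young_def by measurable

lemma continuous_on_young:
  assumes "1 < p"
  shows "continuous_on UNIV (young p)"
  unfolding young_def[abs_def] weight_def
  by (intro continuous_on_mult continuous_on_power continuous_on_id continuous_on_powr' continuous_on_add
      continuous_on_ln continuous_on_const continuous_on_rabs ballI) (use assms in auto)

lemma Lspace_2_norm_sq_measurable:
  "f \<in> Lspace U 2 \<Longrightarrow> (\<lambda>x. (norm (f x))\<^sup>2) \<in> borel_measurable (lebesgue_on U)"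
  unfolding Lspace_2_iff by (blast intro: borel_measurable_integrable)

lemma H01_scale:
  assumes U: "open U" and v: "v \<in> H01 U"
  shows "(\<lambda>x. c * v x) \<in> H01 U" "Lnorm U 2 (wgrad U (\<lambda>x. c * v x)) = \<bar>c\<bar> * Lnorm U 2 (wgrad U v)"
    "H1norm U (\<lambda>x. c * v x) = \<bar>c\<bar> * H1norm U v"
proof -
  have Us: "U \<in> sets lebesgue" using U by auto
  note w = H01_weak_gradient[OF v U]
  have z: "is_weak_gradient U (\<lambda>x. 0 :: real) (\<lambda>x. 0)"
    by (simp add: is_weak_gradient_def locally_integrable_def)
  have zL: "(\<lambda>x. 0 :: real) \<in> Lspace U 2" "(\<lambda>x. 0 :: 'a) \<in> Lspace U 2" by (auto simp: Lspace_2_iff)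
  have wg: "is_weak_gradient U (\<lambda>x. c * v x) (\<lambda>x. c *\<^sub>R wgrad U v x)"
    using is_weak_gradient_lin[OF Us z w(2), of c] by simp
  have L: "(\<lambda>x. c * v x) \<in> Lspace U 2" "(\<lambda>x. c *\<^sub>R wgrad U v x) \<in> Lspace U 2"
    using Lspace_2_scaleR[OF w(1), of c] Lspace_2_scaleR[OF w(3), of c] by auto
  have "h1pair U (\<lambda>x. 0) (\<lambda>x. 0) = 0"
  proof -
    have "(\<lambda>x. if x \<in> U then (0::real, 0::'a) else 0) = (\<lambda>x. 0)" by (auto simp: zero_prod_def)
    then show ?thesis by (simp add: h1pair_def zero_L2_def)
  qed
  then have e: "h1pair U (\<lambda>x. c * v x) (\<lambda>x. c *\<^sub>R wgrad U v x) = c *\<^sub>R h1pair U v (wgrad U v)"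
    using h1pair_lin[OF Us zL w(1,3), of c] by simp
  then have "h1pair U (\<lambda>x. c * v x) (\<lambda>x. c *\<^sub>R wgrad U v x) \<in> closure (test_space U)"
    using h1pair_H01_mem[OF U v] subspace_closure_normed[OF subspace_test_space[OF Us]] by (simp add: subspace_scale)
  then show "(\<lambda>x. c * v x) \<in> H01 U" by (rule H01I[OF U L wg])
  show "H1norm U (\<lambda>x. c * v x) = \<bar>c\<bar> * H1norm U v"
    using H1norm_eq_h1pair(3)[OF U L wg] H1norm_eq_h1pair(3)[OF U w(1,3,2)] by (simp add: e)
  have "(LINT x|lebesgue_on U. (norm (wgrad U (\<lambda>x. c * v x) x))\<^sup>2) = (LINT x|lebesgue_on U. (norm (c *\<^sub>R wgrad U v x))\<^sup>2)"
  proof (rule integral_cong_AE)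
    show "(\<lambda>x. (norm (wgrad U (\<lambda>x. c * v x) x))\<^sup>2) \<in> borel_measurable (lebesgue_on U)"
      by (rule Lspace_2_norm_sq_measurable[OF H1norm_eq_h1pair(1)[OF U L wg]])
    show "(\<lambda>x. (norm (c *\<^sub>R wgrad U v x))\<^sup>2) \<in> borel_measurable (lebesgue_on U)"
      by (rule Lspace_2_norm_sq_measurable[OF L(2)])
    show "AE x in lebesgue_on U. (norm (wgrad U (\<lambda>x. c * v x) x))\<^sup>2 = (norm (c *\<^sub>R wgrad U v x))\<^sup>2"
      using wgrad_eq[OF U wg] Us by (subst AE_restrict_space_iff) (auto elim!: eventually_mono)
  qed
  then have "(Lnorm U 2 (wgrad U (\<lambda>x. c * v x)))\<^sup>2 = (c * Lnorm U 2 (wgrad U v))\<^sup>2"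
    by (simp add: Lnorm_2_sq power_mult_distrib)
  then have "\<bar>Lnorm U 2 (wgrad U (\<lambda>x. c * v x))\<bar> = \<bar>c * Lnorm U 2 (wgrad U v)\<bar>"
    by (simp only: power2_eq_iff abs_eq_iff)
  then show "Lnorm U 2 (wgrad U (\<lambda>x. c * v x)) = \<bar>c\<bar> * Lnorm U 2 (wgrad U v)"
    by (simp add: abs_mult Lnorm_nonneg)
qed

section \<open>The potential well\<close>

text \<open>Integrating the divergence of \<open>\<phi>\<^sup>2 x\<^sub>b b\<close> bounds \<open>\<phi>\<close> by its derivative in the direction \<open>b\<close>.\<close>
lemma poincare_test_functions:
  fixes U :: "'a::euclidean_space set"
  assumes U: "U \<in> sets lebesgue" and R: "\<And>x. x \<in> U \<Longrightarrow> norm x \<le> R" and \<phi>: "\<phi> \<in> test_functions U"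
  shows "(Lnorm U 2 \<phi>)\<^sup>2 \<le> 4 * R\<^sup>2 * (Lnorm U 2 (gradient \<phi>))\<^sup>2"
proof -
  obtain b :: 'a where b: "b \<in> Basis" using nonempty_Basis by blast
  let ?D = "\<lambda>x. frechet_derivative \<phi> (at x) b"
  note sm = test_functions_smooth[OF \<phi>]
  have der: "frechet_derivative (\<lambda>x. \<phi> x * (\<phi> x * (x \<bullet> b))) (at x) b = (\<phi> x)\<^sup>2 + 2 * (\<phi> x * ?D x * (x \<bullet> b))" for x
  proof -
    have "((\<lambda>x. x \<bullet> b) has_derivative (\<lambda>h. h \<bullet> b)) (at x)" by (auto intro!: derivative_eq_intros)
    then have "frechet_derivative (\<lambda>x. x \<bullet> b) (at x) = (\<lambda>h. h \<bullet> b)"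
      by (rule frechet_derivative_at[symmetric])
    then have "frechet_derivative (\<lambda>x. x \<bullet> b) (at x) b = 1" using b by simp
    then show ?thesis
      by (simp add: frechet_derivative_mult smooth_mult sm smooth_inner_const power2_eq_square algebra_simps)
  qed
  have t1: "(\<lambda>x. \<phi> x * \<phi> x) \<in> test_functions U" by (rule test_functions_mult[OF \<phi> sm])
  have t2: "(\<lambda>x. \<phi> x * (?D x * (x \<bullet> b))) \<in> test_functions U"
    by (rule test_functions_mult[OF \<phi>]) (intro smooth_mult smooth_frechet_derivative sm b smooth_inner_const)
  have t3: "(\<lambda>x. ?D x * ?D x) \<in> test_functions U"
    by (rule test_functions_mult[OF test_functions_deriv[OF \<phi> b] smooth_frechet_derivative[OF sm b]])
  note i1 = lebesgue_on_integral_test_function[OF U t1] and i2 = lebesgue_on_integral_test_function[OF U t2]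
    and i3 = lebesgue_on_integral_test_function(1)[OF U t3]
  have "(LINT x|lborel. \<phi> x * \<phi> x + 2 * (\<phi> x * (?D x * (x \<bullet> b)))) = 0"
    using integral_test_functions_deriv[OF test_functions_mult[OF \<phi> smooth_mult[OF sm smooth_inner_const[of b]]] b]
    unfolding der by (simp add: power2_eq_square mult.assoc)
  then have z: "(LINT x|lebesgue_on U. \<phi> x * \<phi> x) + 2 * (LINT x|lebesgue_on U. \<phi> x * (?D x * (x \<bullet> b))) = 0"
    using test_functions_integrable[OF t1] test_functions_integrable[OF t2]
    by (simp add: i1 i2 Bochner_Integration.integral_add)
  \<comment> \<open>From 0 \<le> 1/2 (\<phi> + 2 D (x \<bullet> b))^2 with D the derivative and |x
    \<bullet> b| \<le> R. The factor 1/2 lets half of the integral of \<phi>^2 be absorbed on the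
    left, which produces the constant 4 R^2.\<close>
  have pt: "- (2 * (\<phi> x * (?D x * (x \<bullet> b)))) \<le> 1/2 * (\<phi> x * \<phi> x) + 2 * R\<^sup>2 * (?D x * ?D x)" if "x \<in> U" for x
  proof -
    have xb: "\<bar>x \<bullet> b\<bar> \<le> R" using R[OF that] Basis_le_norm[OF b, of x] by linarith
    then have "\<bar>x \<bullet> b\<bar>\<^sup>2 \<le> R\<^sup>2" by (rule power_mono) simp
    then have "(x \<bullet> b)\<^sup>2 \<le> R\<^sup>2" by simp
    then have "(?D x)\<^sup>2 * (x \<bullet> b)\<^sup>2 \<le> (?D x)\<^sup>2 * R\<^sup>2" by (rule mult_left_mono) simp
    moreover have "0 \<le> 1/2 * (\<phi> x + 2 * (?D x * (x \<bullet> b)))\<^sup>2" by simp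
    moreover have "1/2 * (\<phi> x + 2 * (?D x * (x \<bullet> b)))\<^sup>2
        = 1/2 * (\<phi> x * \<phi> x) + 2 * (\<phi> x * (?D x * (x \<bullet> b))) + 2 * ((?D x)\<^sup>2 * (x \<bullet> b)\<^sup>2)"
      by (simp add: power2_eq_square algebra_simps)
    moreover have "2 * R\<^sup>2 * (?D x * ?D x) = 2 * ((?D x)\<^sup>2 * R\<^sup>2)"
      by (simp add: power2_eq_square)
    ultimately show ?thesis by linarith
  qed
  have "(LINT x|lebesgue_on U. - (2 * (\<phi> x * (?D x * (x \<bullet> b))))) \<le>
      (LINT x|lebesgue_on U. 1/2 * (\<phi> x * \<phi> x) + 2 * R\<^sup>2 * (?D x * ?D x))"
    using i1(1) i2(1) i3 pt by (intro integral_mono) auto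
  also have "\<dots> = 1/2 * (LINT x|lebesgue_on U. \<phi> x * \<phi> x) + 2 * R\<^sup>2 * (LINT x|lebesgue_on U. ?D x * ?D x)"
    using i1(1) i3 by (subst Bochner_Integration.integral_add) auto
  finally have 1: "(LINT x|lebesgue_on U. \<phi> x * \<phi> x) \<le> 4 * R\<^sup>2 * (LINT x|lebesgue_on U. ?D x * ?D x)"
    using z by simp
  have "(LINT x|lebesgue_on U. ?D x * ?D x) \<le> (LINT x|lebesgue_on U. (norm (gradient \<phi> x))\<^sup>2)"
  proof (rule integral_mono[OF i3])
    show "integrable (lebesgue_on U) (\<lambda>x. (norm (gradient \<phi> x))\<^sup>2)"
      using gradient_Lspace[OF U \<phi>] by (simp add: Lspace_2_iff)
    show "?D x * ?D x \<le> (norm (gradient \<phi> x))\<^sup>2" for x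
    proof -
      have "\<bar>gradient \<phi> x \<bullet> b\<bar>\<^sup>2 \<le> (norm (gradient \<phi> x))\<^sup>2"
        by (intro power_mono Basis_le_norm b) simp
      then show ?thesis by (simp add: gradient_inner[OF b] power2_eq_square)
    qed
  qed
  then have "4 * R\<^sup>2 * (LINT x|lebesgue_on U. ?D x * ?D x) \<le> 4 * R\<^sup>2 * (LINT x|lebesgue_on U. (norm (gradient \<phi> x))\<^sup>2)"
    by (rule mult_left_mono) simp
  moreover have "(LINT x|lebesgue_on U. (norm (\<phi> x))\<^sup>2) = (LINT x|lebesgue_on U. \<phi> x * \<phi> x)"
    by (simp add: power2_eq_square)
  ultimately show ?thesis using 1 unfolding Lnorm_2_sq by linarith
qed

text \<open>Test functions that approximate v have gradients tending to 0, so by the Poincare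
  inequality they tend to 0 themselves, while they also tend to v.\<close>

lemma H01_zero_if_gradient_zero:
  assumes U: "open U" "bounded U" and v: "v \<in> H01 U" and D: "Lnorm U 2 (wgrad U v) = 0"
  shows "AE x in lebesgue. x \<in> U \<longrightarrow> v x = 0"
proof -
  have Us: "U \<in> sets lebesgue" using U by auto
  obtain R where R: "\<And>x. x \<in> U \<Longrightarrow> norm x \<le> R" using U(2) by (auto simp: bounded_iff)
  note w = H01_weak_gradient[OF v U(1)]
  obtain \<phi> where \<phi>: "\<And>k::nat. \<phi> k \<in> test_functions U" "(\<lambda>k. H1norm U (\<lambda>x. \<phi> k x - v x)) \<longlonglongrightarrow> 0"
    using v by (auto simp: H01_def)
  note \<phi>' = test_function_Lspace[OF Us \<phi>(1)] gradient_Lspace[OF Us \<phi>(1)]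
  define y where "y k = h1pair U (\<phi> k) (gradient (\<phi> k))" for k
  let ?x = "h1pair U v (wgrad U v)"
  have lim0: "(\<lambda>k. (norm (y k - ?x))\<^sup>2) \<longlonglongrightarrow> 0\<^sup>2"
    using \<phi>(2) unfolding h1pair_test_diff[OF U(1) \<phi>(1) w(1,3,2)] y_def by (rule tendsto_power)
  have D0: "AE t in lebesgue. t \<in> U \<longrightarrow> wgrad U v t = 0"
  proof -
    have "(LINT x|lebesgue_on U. (norm (wgrad U v x))\<^sup>2) = 0" using D Lnorm_2_sq[of U "wgrad U v"] by simp
    then have "AE x in lebesgue_on U. (norm (wgrad U v x))\<^sup>2 = 0"
      using w(3) by (subst (asm) integral_nonneg_eq_0_iff_AE) (auto simp: Lspace_2_iff)
    then show ?thesis using Us by (subst (asm) AE_restrict_space_iff) auto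
  qed
  have grad_le: "(Lnorm U 2 (gradient (\<phi> k)))\<^sup>2 \<le> (norm (y k - ?x))\<^sup>2" for k
  proof -
    note d = Lspace_2_diff[OF Us \<phi>'(1) w(1)] Lspace_2_diff[OF Us \<phi>'(2) w(3)]
    have "(norm (y k - ?x))\<^sup>2 = (Lnorm U 2 (\<lambda>x. \<phi> k x - v x))\<^sup>2 + (Lnorm U 2 (\<lambda>x. gradient (\<phi> k) x - wgrad U v x))\<^sup>2"
      unfolding y_def h1pair_diff[OF Us \<phi>' w(1,3), symmetric] by (rule h1pair_norm_sq[OF Us d])
    moreover have "(Lnorm U 2 (\<lambda>x. gradient (\<phi> k) x - wgrad U v x))\<^sup>2 = (Lnorm U 2 (gradient (\<phi> k)))\<^sup>2"
      unfolding Lnorm_2_sq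
    proof (rule integral_cong_AE)
      show "(\<lambda>x. (norm (gradient (\<phi> k) x - wgrad U v x))\<^sup>2) \<in> borel_measurable (lebesgue_on U)"
        "(\<lambda>x. (norm (gradient (\<phi> k) x))\<^sup>2) \<in> borel_measurable (lebesgue_on U)"
        by (rule Lspace_2_norm_sq_measurable[OF d(2)], rule Lspace_2_norm_sq_measurable[OF \<phi>'(2)])
      show "AE x in lebesgue_on U. (norm (gradient (\<phi> k) x - wgrad U v x))\<^sup>2 = (norm (gradient (\<phi> k) x))\<^sup>2"
        using D0 Us by (subst AE_restrict_space_iff) (auto elim!: eventually_mono)
    qed
    ultimately show ?thesis by simp
  qed
  have y_le: "(norm (y k))\<^sup>2 \<le> (4 * R\<^sup>2 + 1) * (norm (y k - ?x))\<^sup>2" for k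
  proof -
    have "(norm (y k))\<^sup>2 = (Lnorm U 2 (\<phi> k))\<^sup>2 + (Lnorm U 2 (gradient (\<phi> k)))\<^sup>2"
      unfolding y_def by (rule h1pair_norm_sq[OF Us \<phi>'])
    also have "\<dots> \<le> (4 * R\<^sup>2 + 1) * (Lnorm U 2 (gradient (\<phi> k)))\<^sup>2"
      using poincare_test_functions[OF Us R \<phi>(1), of k] by (simp add: algebra_simps)
    also have "\<dots> \<le> (4 * R\<^sup>2 + 1) * (norm (y k - ?x))\<^sup>2"
      by (intro mult_left_mono grad_le) (simp add: add_nonneg_nonneg)
    finally show ?thesis .
  qed
  have "(\<lambda>k. (4 * R\<^sup>2 + 1) * (norm (y k - ?x))\<^sup>2) \<longlonglongrightarrow> 0"
    using tendsto_mult_left[OF lim0, of "4 * R\<^sup>2 + 1"] by simp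
  then have "(\<lambda>k. (norm (y k))\<^sup>2) \<longlonglongrightarrow> 0"
    by (rule Lim_null_comparison[rotated]) (use y_le in simp)
  then have "(\<lambda>k. sqrt ((norm (y k))\<^sup>2)) \<longlonglongrightarrow> sqrt 0" by (rule tendsto_real_sqrt)
  then have y0: "y \<longlonglongrightarrow> 0" by (simp add: tendsto_norm_zero_iff)
  have "(\<lambda>k. sqrt ((norm (y k - ?x))\<^sup>2)) \<longlonglongrightarrow> sqrt (0\<^sup>2)" using lim0 by (rule tendsto_real_sqrt)
  then have "y \<longlonglongrightarrow> ?x" by (simp add: tendsto_norm_zero_iff LIM_zero_iff)
  with y0 have "?x = 0" using LIMSEQ_unique by blast
  then have "(Lnorm U 2 v)\<^sup>2 = 0" using h1pair_norm_sq[OF Us w(1,3)] D by simp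
  then have "(LINT x|lebesgue_on U. (norm (v x))\<^sup>2) = 0" by (simp only: Lnorm_2_sq)
  then have "AE x in lebesgue_on U. (norm (v x))\<^sup>2 = 0"
    using w(1) by (subst (asm) integral_nonneg_eq_0_iff_AE) (auto simp: Lspace_2_iff)
  then show ?thesis using Us by (subst (asm) AE_restrict_space_iff) auto
qed

lemma Lnorm_powr:
  assumes "q \<noteq> 0"
  shows "Lnorm U q v powr q = (LINT x|lebesgue_on U. norm (v x) powr q)"
proof -
  have "0 \<le> (LINT x|lebesgue_on U. norm (v x) powr q)" by simp
  then show ?thesis using assms by (simp add: Lnorm_def powr_powr)
qed

locale well_problem =
  fixes U :: "'a::euclidean_space set" and p :: real
  assumes open_U: "open U" and bounded_U: "bounded U" and p: "1 < p"
begin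

lemma Us [simp]: "U \<in> sets lebesgue"
  using open_U by auto

abbreviation "energy_density v \<equiv> \<lambda>x. \<bar>v x\<bar> powr (1 + p) * ln \<bar>v x\<bar>"
abbreviation "young_const \<equiv> 4 * 2 powr (p - 1) + 4 / (p - 1)"

lemma young_const_nonneg: "0 \<le> young_const"
  using p by simp

lemma compose_measurable:
  assumes "v \<in> Lspace U 2" "f \<in> borel_measurable borel"
  shows "(\<lambda>x. f (v x :: real) :: real) \<in> borel_measurable (lebesgue_on U)"
  using assms measurable_compose[of v "lebesgue_on U" borel f borel] by (simp add: Lspace_2_iff)

lemma abs_powr_measurable: "(\<lambda>s::real. \<bar>s\<bar> powr (1 + p)) \<in> borel_measurable borel"
  and energy_density_measurable: "(\<lambda>s::real. \<bar>s\<bar> powr (1 + p) * ln \<bar>s\<bar>) \<in> borel_measurable borel"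
  by measurable

lemma square_integrable_on: "v \<in> Lspace U 2 \<Longrightarrow> integrable (lebesgue_on U) (\<lambda>x. (v x)\<^sup>2)" for v :: "'a \<Rightarrow> real"
  by (simp add: Lspace_2_iff)

text \<open>The integrated form of \<open>young_le\<close>: the only place where a bound on the
  logarithmic integral is converted into one on the integral of \<open>young p\<close>.\<close>

lemma young_integrable_if_finite_energy:
  assumes v: "v \<in> Lspace U 2" and fe: "finite_energy U p v"
  shows "integrable (lebesgue_on U) (\<lambda>x. young p (v x))"
    and "(LINT x|lebesgue_on U. young p (v x)) \<le>
      4 * (LINT x|lebesgue_on U. energy_density v x) + young_const * (LINT x|lebesgue_on U. (v x)\<^sup>2)"
proof -
  have i: "integrable (lebesgue_on U) (\<lambda>x. 4 * energy_density v x + young_const * (v x)\<^sup>2)"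
    using fe square_integrable_on[OF v] by (simp add: finite_energy_def)
  show y: "integrable (lebesgue_on U) (\<lambda>x. young p (v x))"
  proof (rule Bochner_Integration.integrable_bound[OF i])
    show "(\<lambda>x. young p (v x)) \<in> borel_measurable (lebesgue_on U)"
      by (rule compose_measurable[OF v]) measurable
    show "AE x in lebesgue_on U. norm (young p (v x)) \<le> norm (4 * energy_density v x + young_const * (v x)\<^sup>2)"
    proof (rule AE_I2)
      fix x
      have "young p (v x) \<le> 4 * energy_density v x + young_const * (v x)\<^sup>2" by (rule young_le[OF p])
      then show "norm (young p (v x)) \<le> norm (4 * energy_density v x + young_const * (v x)\<^sup>2)"
        unfolding real_norm_def using young_nonneg[of p "v x"] by linarith
    qed
  qed
  have "(LINT x|lebesgue_on U. young p (v x)) \<le> (LINT x|lebesgue_on U. 4 * energy_density v x + young_const * (v x)\<^sup>2)"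
    by (rule integral_mono[OF y i]) (rule young_le[OF p])
  also have "\<dots> = 4 * (LINT x|lebesgue_on U. energy_density v x) + young_const * (LINT x|lebesgue_on U. (v x)\<^sup>2)"
    using fe square_integrable_on[OF v] by (simp add: finite_energy_def Bochner_Integration.integral_add)
  finally show "(LINT x|lebesgue_on U. young p (v x)) \<le>
      4 * (LINT x|lebesgue_on U. energy_density v x) + young_const * (LINT x|lebesgue_on U. (v x)\<^sup>2)" .
qed

lemma finite_energy_if_young_integrable:
  assumes v: "v \<in> Lspace U 2" and y: "integrable (lebesgue_on U) (\<lambda>x. young p (v x))"
  shows "finite_energy U p v"
  unfolding finite_energy_def
proof (rule Bochner_Integration.integrable_bound)
  show "integrable (lebesgue_on U) (\<lambda>x. young p (v x) + (v x)\<^sup>2 / (p - 1))"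
    using y square_integrable_on[OF v] by simp
  show "energy_density v \<in> borel_measurable (lebesgue_on U)"
    by (rule compose_measurable[OF v energy_density_measurable])
  show "AE x in lebesgue_on U. norm (energy_density v x) \<le> norm (young p (v x) + (v x)\<^sup>2 / (p - 1))"
  proof (rule AE_I2)
    fix x
    have "\<bar>energy_density v x\<bar> \<le> young p (v x) + (v x)\<^sup>2 / (p - 1)" by (rule abs_powr_ln_le_young[OF p])
    then show "norm (energy_density v x) \<le> norm (young p (v x) + (v x)\<^sup>2 / (p - 1))"
      unfolding real_norm_def by linarith
  qed
qed

lemma abs_powr_integrable:
  assumes v: "v \<in> Lspace U 2" and y: "integrable (lebesgue_on U) (\<lambda>x. young p (v x))"
  shows "integrable (lebesgue_on U) (\<lambda>x. \<bar>v x\<bar> powr (1 + p))"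
    and "(LINT x|lebesgue_on U. \<bar>v x\<bar> powr (1 + p)) \<le> (LINT x|lebesgue_on U. young p (v x))"
proof -
  show i: "integrable (lebesgue_on U) (\<lambda>x. \<bar>v x\<bar> powr (1 + p))"
    by (rule Bochner_Integration.integrable_bound[OF y compose_measurable[OF v abs_powr_measurable]])
       (simp add: AE_I2 abs_powr_le_young young_nonneg)
  show "(LINT x|lebesgue_on U. \<bar>v x\<bar> powr (1 + p)) \<le> (LINT x|lebesgue_on U. young p (v x))"
    by (rule integral_mono[OF i y]) (rule abs_powr_le_young)
qed

lemma energy_density_scale:
  fixes l s :: real
  assumes "0 < l"
  shows "\<bar>l * s\<bar> powr (1 + p) * ln \<bar>l * s\<bar> = l powr (1 + p) * (\<bar>s\<bar> powr (1 + p) * ln \<bar>s\<bar> + ln l * \<bar>s\<bar> powr (1 + p))"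
proof (cases "s = 0")
  case False
  then have "ln \<bar>l * s\<bar> = ln l + ln \<bar>s\<bar>" using assms by (simp add: abs_mult ln_mult_pos)
  then show ?thesis using assms by (simp add: abs_mult powr_mult algebra_simps)
qed simp

lemma energy_scale:
  assumes v: "v \<in> Lspace U 2" and fe: "finite_energy U p v" and l: "0 < l"
  shows "finite_energy U p (\<lambda>x. l * v x)"
    and "(LINT x|lebesgue_on U. energy_density (\<lambda>x. l * v x) x) = l powr (1 + p) *
       ((LINT x|lebesgue_on U. energy_density v x) + ln l * (LINT x|lebesgue_on U. \<bar>v x\<bar> powr (1 + p)))"
proof -
  note B = abs_powr_integrable(1)[OF v young_integrable_if_finite_energy(1)[OF v fe]]
  note A = fe[unfolded finite_energy_def]
  show "finite_energy U p (\<lambda>x. l * v x)"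
    unfolding finite_energy_def energy_density_scale[OF l]
    by (intro integrable_mult_right Bochner_Integration.integrable_add A B)
  have "(LINT x|lebesgue_on U. energy_density v x + ln l * \<bar>v x\<bar> powr (1 + p))
      = (LINT x|lebesgue_on U. energy_density v x) + ln l * (LINT x|lebesgue_on U. \<bar>v x\<bar> powr (1 + p))"
    using A B by (simp add: Bochner_Integration.integral_add)
  then show "(LINT x|lebesgue_on U. energy_density (\<lambda>x. l * v x) x) = l powr (1 + p) *
       ((LINT x|lebesgue_on U. energy_density v x) + ln l * (LINT x|lebesgue_on U. \<bar>v x\<bar> powr (1 + p)))"
    unfolding energy_density_scale[OF l] integral_mult_right_zero by (simp only:)
qed

lemma I_fun_eq: "finite_energy U p v \<Longrightarrow> I_fun U p v =
    ereal ((Lnorm U 2 (wgrad U v))\<^sup>2 - (LINT x|lebesgue_on U. energy_density v x))"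
  by (simp add: I_fun_def)

lemma J_fun_eq: "finite_energy U p v \<Longrightarrow> J_fun U p v =
    ereal (1 / 2 * (Lnorm U 2 (wgrad U v))\<^sup>2 - 1 / (1 + p) * (LINT x|lebesgue_on U. energy_density v x)
      + 1 / (1 + p)\<^sup>2 * (LINT x|lebesgue_on U. \<bar>v x\<bar> powr (1 + p)))"
  using p by (simp add: J_fun_def Lnorm_powr)

lemma H1norm_sq: "(H1norm U v)\<^sup>2 = (Lnorm U 2 v)\<^sup>2 + (Lnorm U 2 (wgrad U v))\<^sup>2"
  by (simp add: H1norm_def)

text \<open>If \<open>I v < 0\<close>, some \<open>\<lambda> v\<close> with \<open>\<lambda> < 1\<close> lies on the Nehari manifold, where \<open>J\<close> is bounded by
  the square of the \<open>H1\<close> norm; so \<open>v\<close> cannot be small if the well is deep.\<close>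
lemma nehari_scaling:
  assumes v: "v \<in> H01 U" and fe: "finite_energy U p v"
    and neg: "(Lnorm U 2 (wgrad U v))\<^sup>2 < (LINT x|lebesgue_on U. energy_density v x)"
  shows "\<exists>u\<in>nehari U p. J_fun U p u \<le> ereal ((5 + young_const) * (H1norm U v)\<^sup>2)"
proof -
  note vw = H01_weak_gradient[OF v open_U]
  define D where "D = (Lnorm U 2 (wgrad U v))\<^sup>2"
  define A where "A = (LINT x|lebesgue_on U. energy_density v x)"
  define B where "B = (LINT x|lebesgue_on U. \<bar>v x\<bar> powr (1 + p))"
  \<comment> \<open>If the gradient vanished, so would v by the Poincare inequality, and with it the
    logarithmic integral, against the strict inequality \<open>neg\<close>.\<close>
  have "0 < D"
  proof (rule ccontr)
    assume "\<not> 0 < D"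
    then have "Lnorm U 2 (wgrad U v) = 0" by (simp add: D_def)
    then have "AE x in lebesgue. x \<in> U \<longrightarrow> v x = 0" by (rule H01_zero_if_gradient_zero[OF open_U bounded_U v])
    then have "AE x in lebesgue_on U. energy_density v x = 0"
      by (subst AE_restrict_space_iff) (auto elim: eventually_mono)
    then have "A = 0" unfolding A_def by (rule integral_eq_zero_AE)
    then show False using neg \<open>\<not> 0 < D\<close> by (simp add: A_def D_def)
  qed
  \<comment> \<open>This is I (l v) / l^2. It tends to D > 0 as l tends to 0 and is negative at l =
    1, so it has a zero in between.\<close>
  define k where "k l = D - (l powr (p - 1) * A + l powr (p - 1) * ln l * B)" for l
  have k1: "k 1 < 0" using neg by (simp add: k_def A_def D_def)
  have lim: "(k \<longlongrightarrow> D - (0 * A + 0 * B)) (at_right 0)"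
  proof -
    have 1: "((\<lambda>l. l powr (p - 1)) \<longlongrightarrow> 0) (at_right (0::real))"
      by (rule tendsto_zero_powrI[OF tendsto_ident_at tendsto_const])
         (use p in \<open>auto simp: eventually_at_filter\<close>)
    have h0: "((\<lambda>l. l powr ((p - 1) / 2)) \<longlongrightarrow> 0) (at_right (0::real))"
      by (rule tendsto_zero_powrI[OF tendsto_ident_at tendsto_const])
         (use p in \<open>auto simp: eventually_at_filter\<close>)
    have half: "((\<lambda>l. 2 / (p - 1) * l powr ((p - 1) / 2)) \<longlongrightarrow> 0) (at_right (0::real))"
      using tendsto_mult_left[OF h0, of "2 / (p - 1)"] by (simp only: mult_zero_right)
    have 2: "((\<lambda>l. l powr (p - 1) * ln l) \<longlongrightarrow> 0) (at_right (0::real))"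
    proof (rule Lim_null_comparison[OF _ half])
      have "norm (l powr (p - 1) * ln l) \<le> 2 / (p - 1) * l powr ((p - 1) / 2)" if l: "0 < l" "l < 1" for l :: real
      proof -
        have "l powr (p - 1) = l powr ((p - 1) / 2) * l powr ((p - 1) / 2)" by (simp flip: powr_add)
        then have "norm (l powr (p - 1) * ln l) = l powr ((p - 1) / 2) * (l powr ((p - 1) / 2) * \<bar>ln l\<bar>)"
          by (simp add: abs_mult)
        also have "\<dots> \<le> l powr ((p - 1) / 2) * (1 / ((p - 1) / 2))"
          using l p by (intro mult_left_mono powr_mult_ln_le) auto
        finally show ?thesis by (simp add: mult.commute)
      qed
      then show "\<forall>\<^sub>F l in at_right 0. norm (l powr (p - 1) * ln l) \<le> 2 / (p - 1) * l powr ((p - 1) / 2)"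
        unfolding eventually_at_right_field by (intro exI[of _ 1]) simp
    qed
    show ?thesis unfolding k_def by (intro tendsto_diff tendsto_add tendsto_mult tendsto_const 1 2)
  qed
  then have "\<forall>\<^sub>F l in at_right 0. 0 < k l" using \<open>0 < D\<close> by (intro order_tendstoD(1)) auto
  moreover have "\<forall>\<^sub>F l in at_right 0. l < (1::real)"
    unfolding eventually_at_right_field by (intro exI[of _ 1]) simp
  moreover have "\<forall>\<^sub>F l in at_right 0. (0::real) < l" by (simp add: eventually_at_filter)
  ultimately have "\<forall>\<^sub>F l in at_right 0. 0 < k l \<and> l < 1 \<and> 0 < l" by eventually_elim simp
  then obtain a where a: "0 < k a" "a < 1" "0 < a"
    using eventually_happens'[of "at_right (0::real)"] by (auto simp: trivial_limit_at_right_real)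
  have "continuous_on {a..1} k"
    unfolding k_def using a by (intro continuous_intros) auto
  then obtain l where l: "a \<le> l" "l \<le> 1" "k l = 0"
    using IVT2'[of k 1 0 a] k1 a by (auto simp: less_imp_le)
  have l0: "0 < l" using l a by simp
  define u where "u x = l * v x" for x
  have u: "u \<in> H01 U" "Lnorm U 2 (wgrad U u) = l * Lnorm U 2 (wgrad U v)" "H1norm U u = l * H1norm U v"
    using H01_scale[OF open_U v, of l] l0 by (simp_all add: u_def[abs_def])
  note uw = H01_weak_gradient[OF u(1) open_U]
  have ufe: "finite_energy U p u" and uA: "(LINT x|lebesgue_on U. energy_density u x) = l powr (1 + p) * (A + ln l * B)"
    using energy_scale[OF vw(1) fe l0] by (simp_all add: u_def[abs_def] A_def B_def)
  have l2: "l powr (1 + p) = l\<^sup>2 * l powr (p - 1)"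
  proof -
    have "l powr (1 + p) = l powr (2 + (p - 1))" by (simp add: add.commute)
    also have "\<dots> = l\<^sup>2 * l powr (p - 1)" using l0 by (subst powr_add) simp
    finally show ?thesis .
  qed
  have uD: "(Lnorm U 2 (wgrad U u))\<^sup>2 = l\<^sup>2 * D" by (simp add: u D_def power_mult_distrib)
  have "l powr (1 + p) * (A + ln l * B) = l\<^sup>2 * (D - k l)"
    unfolding l2 k_def by (simp add: algebra_simps)
  then have eq: "(LINT x|lebesgue_on U. energy_density u x) = (Lnorm U 2 (wgrad U u))\<^sup>2"
    by (simp add: uA uD l)
  have "I_fun U p u = 0" by (simp add: I_fun_eq[OF ufe] eq zero_ereal_def)
  moreover have "(Lnorm U 2 (wgrad U u))\<^sup>2 \<noteq> 0" using uD l0 \<open>0 < D\<close> by simp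
  ultimately have "u \<in> nehari U p" using u(1) by (simp add: nehari_def)
  \<comment> \<open>On the Nehari manifold the logarithmic integral equals the Dirichlet term D, so
    the integral of |u|^(p + 1) is at most 4 D plus \<open>young_const\<close> times the squared L2
    norm; the 5 is this 4 and 1 more for the term D / 2. Finally l \<le> 1 returns from u to
    v.\<close>
  moreover have "J_fun U p u \<le> ereal ((5 + young_const) * (H1norm U v)\<^sup>2)"
  proof -
    let ?Y = "LINT x|lebesgue_on U. young p (u x)" and ?B = "LINT x|lebesgue_on U. \<bar>u x\<bar> powr (1 + p)"
    let ?D = "(Lnorm U 2 (wgrad U u))\<^sup>2" and ?N = "LINT x|lebesgue_on U. (u x)\<^sup>2"
    note y = young_integrable_if_finite_energy[OF uw(1) ufe]
    have Y: "?Y \<le> 4 * ?D + young_const * ?N" using y(2) by (simp add: eq)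
    have BY: "?B \<le> ?Y" by (rule abs_powr_integrable(2)[OF uw(1) y(1)])
    have B0: "0 \<le> ?B" by simp
    have N: "(H1norm U u)\<^sup>2 = ?N + ?D" by (simp add: H1norm_sq Lnorm_2_sq)
    have "1 / (1 + p)\<^sup>2 * ?B \<le> 1 * ?B"
    proof (rule mult_right_mono[OF _ B0])
      have "1 \<le> (1 + p)\<^sup>2" using p by (intro one_le_power) simp
      then show "1 / (1 + p)\<^sup>2 \<le> 1" using p by (subst divide_le_eq_1_pos) simp_all
    qed
    moreover have "0 \<le> 1 / (1 + p) * ?D" using p by simp
    moreover have "0 \<le> ?D" "0 \<le> ?N" "0 \<le> young_const * ?D" using young_const_nonneg by simp_all
    ultimately have "1 / 2 * ?D - 1 / (1 + p) * ?D + 1 / (1 + p)\<^sup>2 * ?B \<le> (5 + young_const) * (?N + ?D)"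
      using Y BY unfolding distrib_left distrib_right by linarith
    also have "\<dots> = (5 + young_const) * (l\<^sup>2 * (H1norm U v)\<^sup>2)"
      unfolding N[symmetric] u(3) by (simp add: power_mult_distrib)
    also have "\<dots> \<le> (5 + young_const) * (1 * (H1norm U v)\<^sup>2)"
      using young_const_nonneg l l0 by (intro mult_left_mono mult_right_mono power_le_one) auto
    finally show ?thesis by (simp add: J_fun_eq[OF ufe] eq)
  qed
  ultimately show ?thesis by blast
qed

end

section \<open>Bounds for the integral of \<open>young p\<close> on balls\<close>

abbreviation fn :: "('a::euclidean_space, real \<times> 'a) L2 \<Rightarrow> 'a \<Rightarrow> real" where
  "fn x \<equiv> \<lambda>t. fst (rep_L2 x t)"

abbreviation gr :: "('a::euclidean_space, real \<times> 'a) L2 \<Rightarrow> 'a \<Rightarrow> 'a" where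
  "gr x \<equiv> \<lambda>t. snd (rep_L2 x t)"

text \<open>Boundedness of a test function replaces the weight by a constant, leaving its
  square.\<close>

lemma test_function_finite_energy:
  assumes U: "U \<in> sets lebesgue" and p: "1 < p" and \<phi>: "\<phi> \<in> test_functions U"
  shows "integrable (lebesgue_on U) (\<lambda>x. young p (\<phi> x))"
proof -
  obtain B where B: "0 \<le> B" "\<And>x. \<bar>\<phi> x\<bar> \<le> B" using test_functions_bounded[OF \<phi>] by metis
  have L: "integrable (lebesgue_on U) (\<lambda>x. weight p B * (\<phi> x)\<^sup>2)"
    using test_function_Lspace[OF U \<phi>] by (simp add: Lspace_2_iff)
  show ?thesis
  proof (rule Bochner_Integration.integrable_bound[OF L])
    show "(\<lambda>x. young p (\<phi> x)) \<in> borel_measurable (lebesgue_on U)"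
      by (rule measurable_compose[OF test_function_measurable_on[OF \<phi>]]) measurable
    have "young p (\<phi> x) \<le> weight p B * (\<phi> x)\<^sup>2" for x
      unfolding young_def using weight_mono[OF p, of "\<phi> x" B] B by (simp add: mult.commute mult_right_mono)
    then show "AE x in lebesgue_on U. norm (young p (\<phi> x)) \<le> norm (weight p B * (\<phi> x)\<^sup>2)"
      by (intro AE_I2) (simp add: young_nonneg weight_nonneg)
  qed
qed

context well_problem
begin

abbreviation "HS \<equiv> closure (test_space U)"

lemma AE_on: "AE t in lebesgue. P t \<Longrightarrow> AE t in lebesgue_on U. P t"
  by (subst AE_restrict_space_iff) (auto elim: eventually_mono)

lemma fn_add: "AE t in lebesgue_on U. fn (x + y) t = fn x t + fn y t"
  using AE_on[OF rep_plus_L2[of x y]] by eventually_elim simp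

lemma fn_diff: "AE t in lebesgue_on U. fn (x - y) t = fn x t - fn y t"
  using AE_on[OF rep_minus_L2[of x y]] by eventually_elim simp

lemma fn_scaleR: "AE t in lebesgue_on U. fn (c *\<^sub>R x) t = c * fn x t"
  using AE_on[OF rep_scaleR_L2[of c x]] by eventually_elim simp

lemma subspace_HS: "subspace HS"
  by (rule subspace_closure_normed[OF subspace_test_space[OF Us]])

end

text \<open>The number d is a positive real lower bound of the energy on the Nehari manifold rather
  than the depth itself, which is \<infinity> when the manifold is empty.\<close>

locale deep_well = well_problem U p for U :: "'a::euclidean_space set" and p +
  fixes d :: real
  assumes d: "0 < d" and depth: "\<And>u. u \<in> nehari U p \<Longrightarrow> ereal d \<le> J_fun U p u"
begin

text \<open>Chosen so that the bound in \<open>nehari_scaling\<close> becomes d / 2, strictly below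
  d.\<close>

definition small_radius :: real where
  "small_radius = sqrt (d / (2 * (5 + young_const)))"

lemma small_radius_pos: "0 < small_radius"
  unfolding small_radius_def using d young_const_nonneg by simp

text \<open>Otherwise scaling would produce a Nehari function of energy at most d / 2. Finite energy
  has to be assumed at this stage; for general elements it is derived afterwards.\<close>

lemma I_nonneg_small:
  assumes v: "v \<in> H01 U" and fe: "finite_energy U p v" and small: "H1norm U v \<le> small_radius"
  shows "(LINT x|lebesgue_on U. energy_density v x) \<le> (Lnorm U 2 (wgrad U v))\<^sup>2"
proof (rule ccontr)
  assume "\<not> ?thesis"
  then obtain u where u: "u \<in> nehari U p" "J_fun U p u \<le> ereal ((5 + young_const) * (H1norm U v)\<^sup>2)"
    using nehari_scaling[OF v fe] by auto
  have pos: "0 < 5 + young_const" using young_const_nonneg by linarith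
  have "0 \<le> H1norm U v" by (simp add: H1norm_def)
  then have "(H1norm U v)\<^sup>2 \<le> small_radius\<^sup>2" using small by (intro power_mono)
  also have "\<dots> = d / (2 * (5 + young_const))"
    unfolding small_radius_def using d pos by (intro real_sqrt_pow2) simp
  finally have "(5 + young_const) * (H1norm U v)\<^sup>2 \<le> (5 + young_const) * (d / (2 * (5 + young_const)))"
    using pos by (intro mult_left_mono) auto
  also have "\<dots> = d / 2" using pos by (simp only: times_divide_eq_right) (simp add: divide_eq_eq)
  finally have "(5 + young_const) * (H1norm U v)\<^sup>2 < d" using d by linarith
  moreover have "ereal d \<le> ereal ((5 + young_const) * (H1norm U v)\<^sup>2)"
    using depth[OF u(1)] u(2) by (rule order_trans)
  ultimately show False by simp
qed

lemma h1pair_test_function_H01: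
  assumes \<phi>: "\<phi> \<in> test_functions U"
  shows "\<phi> \<in> H01 U" "H1norm U \<phi> = norm (h1pair U \<phi> (gradient \<phi>))"
proof -
  note \<phi>' = test_function_Lspace[OF Us \<phi>] gradient_Lspace[OF Us \<phi>] is_weak_gradient_test_function[OF Us \<phi>]
  have "h1pair U \<phi> (gradient \<phi>) \<in> HS" using \<phi> closure_subset[of "test_space U"] by (auto simp: test_space_def)
  then show "\<phi> \<in> H01 U" by (rule H01I[OF open_U \<phi>'])
  show "H1norm U \<phi> = norm (h1pair U \<phi> (gradient \<phi>))" by (rule H1norm_eq_h1pair(3)[OF open_U \<phi>'])
qed

text \<open>Test functions have finite energy, so the sign of \<open>I\<close> applies and bounds
  the logarithmic integral by the Dirichlet term. The resulting bound depends on the radius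
  alone.\<close>

lemma young_test_function_small:
  assumes \<phi>: "\<phi> \<in> test_functions U" and small: "norm (h1pair U \<phi> (gradient \<phi>)) \<le> small_radius"
  shows "(LINT x|lebesgue_on U. young p (\<phi> x)) \<le> (4 + young_const) * small_radius\<^sup>2"
proof -
  note \<phi>L = test_function_Lspace[OF Us \<phi>]
  note \<phi>H = h1pair_test_function_H01[OF \<phi>]
  have fe: "finite_energy U p \<phi>"
    by (rule finite_energy_if_young_integrable[OF \<phi>L test_function_finite_energy[OF Us p \<phi>]])
  let ?D = "(Lnorm U 2 (wgrad U \<phi>))\<^sup>2" and ?N = "LINT x|lebesgue_on U. (\<phi> x)\<^sup>2"
  have "(LINT x|lebesgue_on U. energy_density \<phi> x) \<le> ?D"
    using small by (intro I_nonneg_small \<phi>H(1) fe) (simp add: \<phi>H(2))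
  then have "(LINT x|lebesgue_on U. young p (\<phi> x)) \<le> 4 * ?D + young_const * ?N"
    using young_integrable_if_finite_energy(2)[OF \<phi>L fe] by linarith
  also have "\<dots> \<le> (4 + young_const) * (?N + ?D)"
  proof -
    have "0 \<le> young_const * ?D" "0 \<le> ?N" using young_const_nonneg by simp_all
    then show ?thesis unfolding distrib_left distrib_right by linarith
  qed
  also have "?N + ?D = (H1norm U \<phi>)\<^sup>2" by (simp add: H1norm_sq Lnorm_2_sq)
  also have "(4 + young_const) * (H1norm U \<phi>)\<^sup>2 \<le> (4 + young_const) * small_radius\<^sup>2"
    using small young_const_nonneg by (intro mult_left_mono power_mono) (auto simp: \<phi>H(2))
  finally show ?thesis .
qed

lemma young_measurable_on: "v \<in> Lspace U 2 \<Longrightarrow> (\<lambda>t. young p (v t)) \<in> borel_measurable (lebesgue_on U)" for v :: "'a \<Rightarrow> real"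
  by (rule compose_measurable) measurable

text \<open>Fatou's lemma along an almost everywhere convergent subsequence of test functions. The
  norm is strictly below the radius so that the approximants eventually lie in the ball; the
  integral is an extended one because integrability is still to be established.\<close>

lemma nn_integral_young_small:
  assumes x: "x \<in> HS" and small: "norm x < small_radius"
  shows "(\<integral>\<^sup>+t. ennreal (young p (fn x t)) \<partial>lebesgue_on U) \<le> ennreal ((4 + young_const) * small_radius\<^sup>2)"
proof -
  let ?K = "(4 + young_const) * small_radius\<^sup>2"
  obtain y where y: "\<And>n. y n \<in> test_space U" "y \<longlonglongrightarrow> x" using x unfolding closure_sequential by blast
  obtain r where r: "strict_mono r" "AE t in lebesgue. (\<lambda>n. rep_L2 (y (r n)) t) \<longlonglongrightarrow> rep_L2 x t"
    using L2_tendsto_AE_subseq[OF y(2)] by blast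
  have "(\<lambda>n. norm (y (r n))) \<longlonglongrightarrow> norm x"
    using LIMSEQ_subseq_LIMSEQ[OF y(2) r(1)] by (intro tendsto_norm) (simp add: o_def)
  then have ev: "\<forall>\<^sub>F n in sequentially. norm (y (r n)) < small_radius" using small by (rule order_tendstoD)
  have bound: "(\<integral>\<^sup>+t. ennreal (young p (fn (y (r n)) t)) \<partial>lebesgue_on U) \<le> ennreal ?K" if n: "norm (y (r n)) < small_radius" for n
  proof -
    obtain \<phi> where \<phi>: "\<phi> \<in> test_functions U" "y (r n) = h1pair U \<phi> (gradient \<phi>)"
      using y(1)[of "r n"] by (auto simp: test_space_def)
    have "AE t in lebesgue. rep_L2 (y (r n)) t = (if t \<in> U then (\<phi> t, gradient \<phi> t) else 0)"
      unfolding \<phi>(2) h1pair_def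
      by (intro rep_abs_L2 h1pair_square_integrable Us test_function_Lspace gradient_Lspace \<phi>(1))
    then have eq: "AE t in lebesgue_on U. fn (y (r n)) t = \<phi> t"
      by (subst AE_restrict_space_iff) (auto elim: eventually_mono)
    have "(\<integral>\<^sup>+t. ennreal (young p (fn (y (r n)) t)) \<partial>lebesgue_on U) = (\<integral>\<^sup>+t. ennreal (young p (\<phi> t)) \<partial>lebesgue_on U)"
      by (rule nn_integral_cong_AE) (use eq in \<open>eventually_elim, simp\<close>)
    also have "\<dots> = ennreal (LINT t|lebesgue_on U. young p (\<phi> t))"
      by (rule nn_integral_eq_integral[OF test_function_finite_energy[OF Us p \<phi>(1)]]) (simp add: young_nonneg)
    also have "\<dots> \<le> ennreal ?K"
      using n \<phi>(2) by (intro ennreal_leI young_test_function_small \<phi>(1)) simp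
    finally show ?thesis .
  qed
  have lim: "AE t in lebesgue_on U. (\<lambda>n. rep_L2 (y (r n)) t) \<longlonglongrightarrow> rep_L2 x t"
    using r(2) by (subst AE_restrict_space_iff) (auto elim: eventually_mono)
  have "(\<integral>\<^sup>+t. ennreal (young p (fn x t)) \<partial>lebesgue_on U)
      = (\<integral>\<^sup>+t. liminf (\<lambda>n. ennreal (young p (fn (y (r n)) t))) \<partial>lebesgue_on U)"
  proof (rule nn_integral_cong_AE, use lim in eventually_elim)
    case (elim t)
    have "(\<lambda>n. young p (fn (y (r n)) t)) \<longlonglongrightarrow> young p (fn x t)"
      by (rule continuous_on_tendsto_compose[OF continuous_on_young[OF p] tendsto_fst[OF elim]]) auto
    then have "(\<lambda>n. ennreal (young p (fn (y (r n)) t))) \<longlonglongrightarrow> ennreal (young p (fn x t))"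
      by (rule tendsto_ennrealI)
    then show ?case by (rule lim_imp_Liminf[OF sequentially_bot, THEN sym])
  qed
  also have "\<dots> \<le> liminf (\<lambda>n. \<integral>\<^sup>+t. ennreal (young p (fn (y (r n)) t)) \<partial>lebesgue_on U)"
    by (rule nn_integral_liminf) (intro measurable_compose[OF young_measurable_on[OF rep_L2_Lspace(1)[OF Us]] measurable_ennreal])
  also have "\<dots> \<le> limsup (\<lambda>n. \<integral>\<^sup>+t. ennreal (young p (fn (y (r n)) t)) \<partial>lebesgue_on U)"
    by (rule Liminf_le_Limsup) simp
  also have "\<dots> \<le> ennreal ?K"
    by (rule Limsup_bounded) (use ev bound in \<open>auto elim: eventually_mono\<close>)
  finally show ?thesis .
qed

text \<open>Division by c moves the ball of radius R into the ball of radius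
  \<open>small_radius\<close>, and \<open>young_scale\<close> gives the factor by which the integral
  grows on the way back. The term \<open>max 0 R\<close> keeps c \<ge> 1 for every real R.\<close>

definition young_bound :: "real \<Rightarrow> real" where
  "young_bound R = (let c = 1 + 2 * max 0 R / small_radius in
     c powr (1 + p) * (1 + ln c) * ((4 + young_const) * small_radius\<^sup>2))"

lemma young_bound_nonneg: "0 \<le> young_bound R"
proof -
  define c where "c = 1 + 2 * max 0 R / small_radius"
  have "1 \<le> c" using small_radius_pos by (simp add: c_def)
  then have "0 \<le> c powr (1 + p) * (1 + ln c)" by simp
  moreover have "0 \<le> (4 + young_const) * small_radius\<^sup>2" using young_const_nonneg by simp
  ultimately show ?thesis unfolding young_bound_def Let_def c_def[symmetric] by (rule mult_nonneg_nonneg)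
qed

lemma young_bound:
  assumes x: "x \<in> HS" and R: "norm x \<le> R"
  shows "integrable (lebesgue_on U) (\<lambda>t. young p (fn x t))"
    and "(LINT t|lebesgue_on U. young p (fn x t)) \<le> young_bound R"
proof -
  define c where "c = 1 + 2 * max 0 R / small_radius"
  have c: "1 \<le> c" using small_radius_pos by (simp add: c_def)
  define x' where "x' = (1 / c) *\<^sub>R x"
  have x'H: "x' \<in> HS" unfolding x'_def using x by (intro subspace_scale subspace_HS)
  have "norm x' < small_radius"
  proof -
    have "2 * norm x \<le> 2 * max 0 R" using R by simp
    also have "\<dots> = (c - 1) * small_radius" using small_radius_pos by (simp add: c_def)
    finally have "2 * norm x \<le> c * small_radius - small_radius" by (simp add: algebra_simps)
    then have "norm x < c * small_radius" using small_radius_pos norm_ge_zero[of x] by linarith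
    then show ?thesis using c by (simp add: x'_def divide_less_eq mult.commute)
  qed
  note small = nn_integral_young_small[OF x'H this]
  let ?K = "(4 + young_const) * small_radius\<^sup>2"
  let ?C = "c powr (1 + p) * (1 + ln c)"
  have K0: "0 \<le> ?K" using young_const_nonneg by simp
  have C0: "0 \<le> ?C" using c by simp
  have m: "(\<lambda>t. young p (fn x t)) \<in> borel_measurable (lebesgue_on U)" for x
    by (rule young_measurable_on[OF rep_L2_Lspace(1)[OF Us]])
  have xeq: "x = c *\<^sub>R x'" using c by (simp add: x'_def)
  have le: "AE t in lebesgue_on U. young p (fn x t) \<le> ?C * young p (fn x' t)"
    using fn_scaleR[of c x'] unfolding xeq[symmetric]
    by eventually_elim (simp add: young_scale[OF c])
  have "(\<integral>\<^sup>+t. ennreal (young p (fn x t)) \<partial>lebesgue_on U) \<le> (\<integral>\<^sup>+t. ennreal ?C * ennreal (young p (fn x' t)) \<partial>lebesgue_on U)"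
  proof (rule nn_integral_mono_AE, use le in eventually_elim)
    case (elim t)
    then show ?case using C0 by (simp add: young_nonneg ennreal_leI flip: ennreal_mult)
  qed
  also have "\<dots> = ennreal ?C * (\<integral>\<^sup>+t. ennreal (young p (fn x' t)) \<partial>lebesgue_on U)"
    by (rule nn_integral_cmult) (intro measurable_compose[OF m measurable_ennreal])
  also have "\<dots> \<le> ennreal ?C * ennreal ?K" using small by (rule mult_left_mono) simp
  also have "\<dots> = ennreal (young_bound R)"
    unfolding young_bound_def c_def[symmetric] Let_def using C0 K0 by (simp add: ennreal_mult)
  finally have fin: "(\<integral>\<^sup>+t. ennreal (young p (fn x t)) \<partial>lebesgue_on U) \<le> ennreal (young_bound R)" .
  show i: "integrable (lebesgue_on U) (\<lambda>t. young p (fn x t))"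
    by (rule integrableI_bounded[OF m])
       (use fin le_less_trans[OF fin ennreal_less_top] in \<open>simp add: young_nonneg\<close>)
  have "ennreal (LINT t|lebesgue_on U. young p (fn x t)) \<le> ennreal (young_bound R)"
    using fin by (subst (asm) nn_integral_eq_integral[OF i]) (simp_all add: young_nonneg)
  then show "(LINT t|lebesgue_on U. young p (fn x t)) \<le> young_bound R"
    by (simp add: ennreal_le_iff young_bound_nonneg)
qed

end

context well_problem
begin

lemmas fnL = rep_L2_Lspace(1)[OF Us] and grL = rep_L2_Lspace(2)[OF Us]

lemma HS_pair: "x \<in> HS \<Longrightarrow> h1pair U (fn x) (gr x) = x"
  by (rule closure_test_space(1)[OF open_U])

lemma norm_sq_HS: "x \<in> HS \<Longrightarrow> (norm x)\<^sup>2 = (LINT t|lebesgue_on U. (fn x t)\<^sup>2) + (Lnorm U 2 (gr x))\<^sup>2"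
  using h1pair_norm_sq[OF Us fnL grL, of x x] by (simp add: HS_pair Lnorm_2_sq)

lemma fn_sq_integrable: "integrable (lebesgue_on U) (\<lambda>t. (fn x t)\<^sup>2)"
  by (rule square_integrable_on[OF fnL])

lemma fn_mult_integrable: "integrable (lebesgue_on U) (\<lambda>t. fn x t * fn y t)"
  using L2inner_integrable[OF Us fnL[of x] fnL[of y]] by simp

lemma fn_sq_le: "x \<in> HS \<Longrightarrow> (LINT t|lebesgue_on U. (fn x t)\<^sup>2) \<le> (norm x)\<^sup>2"
  using norm_sq_HS[of x] by simp

lemma fn_measurable: "fn x \<in> borel_measurable (lebesgue_on U)"
  using fnL[of x] by (simp add: Lspace_2_iff)

text \<open>Pairs with zero second component isolate the L2 part of the inner product, so that
  Cauchy-Schwarz in \<open>L2\<close> applies.\<close>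

lemma fn_mult_le:
  assumes "x \<in> HS" "y \<in> HS"
  shows "\<bar>LINT t|lebesgue_on U. fn x t * fn y t\<bar> \<le> norm x * norm y"
proof -
  let ?z = "\<lambda>t. 0 :: 'a"
  have z: "?z \<in> Lspace U 2" by (simp add: Lspace_2_iff)
  have "norm (h1pair U (fn x) ?z) \<le> norm x" if "x \<in> HS" for x
  proof (rule power2_le_imp_le)
    show "(norm (h1pair U (fn x) ?z))\<^sup>2 \<le> (norm x)\<^sup>2"
      unfolding h1pair_norm_sq[OF Us fnL z] using fn_sq_le[OF that] by (simp add: Lnorm_2_sq)
  qed simp
  then have "norm (h1pair U (fn x) ?z) * norm (h1pair U (fn y) ?z) \<le> norm x * norm y"
    using assms by (intro mult_mono) auto
  moreover have "\<bar>h1pair U (fn x) ?z \<bullet> h1pair U (fn y) ?z\<bar> \<le> norm (h1pair U (fn x) ?z) * norm (h1pair U (fn y) ?z)"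
    by (rule Cauchy_Schwarz_ineq2)
  moreover have "h1pair U (fn x) ?z \<bullet> h1pair U (fn y) ?z = (LINT t|lebesgue_on U. fn x t * fn y t)"
    unfolding h1pair_inner[OF Us fnL z fnL z] by (simp add: L2inner_def)
  ultimately show ?thesis by linarith
qed

lemma zero_HS: "0 \<in> HS"
  by (rule subspace_0[OF subspace_HS])

lemma fn_zero: "AE t in lebesgue_on U. fn 0 t = 0"
  using AE_on[OF rep_zero_L2[where 'a='a and 'b="real \<times> 'a"]] by eventually_elim simp

end

section \<open>The nonlinearity as a map from the subspace to its dual\<close>

context deep_well
begin

text \<open>For vectors z', w' in the unit ball the summands are 1 + 1 from their L2 norms,
  \<open>young_bound R\<close> once for each of a and b, and \<open>young_bound 1\<close> twice for
  each of z' and w', which meet both weights.\<close>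

definition weight_bound :: "real \<Rightarrow> real" where
  "weight_bound R = 2 + 2 * young_bound R + 4 * young_bound 1"

text \<open>The inequality \<open>weight_mult_le_young\<close> is not homogeneous, so z and w are
  first scaled to unit length; homogeneity of the product then restores the factor |z| |w|.\<close>

lemma weighted_product:
  assumes a: "a \<in> HS" "norm a \<le> R" and b: "b \<in> HS" "norm b \<le> R" and z: "z \<in> HS" and w: "w \<in> HS"
  shows "integrable (lebesgue_on U) (\<lambda>t. (1 + weight p (fn a t) + weight p (fn b t)) * (\<bar>fn z t\<bar> * \<bar>fn w t\<bar>))"
    and "(LINT t|lebesgue_on U. (1 + weight p (fn a t) + weight p (fn b t)) * (\<bar>fn z t\<bar> * \<bar>fn w t\<bar>))
      \<le> weight_bound R * (norm z * norm w)"
proof -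
  \<comment> \<open>For z = 0 the division by zero yields z' = 0, and the identities below still
    hold.\<close>
  define z' where "z' = (1 / norm z) *\<^sub>R z"
  define w' where "w' = (1 / norm w) *\<^sub>R w"
  have z': "z' \<in> HS" "norm z' \<le> 1" and w': "w' \<in> HS" "norm w' \<le> 1"
    unfolding z'_def w'_def by (auto intro!: subspace_scale subspace_HS z w)
  have zz: "norm z *\<^sub>R z' = z" and ww: "norm w *\<^sub>R w' = w" by (auto simp: z'_def w'_def)
  let ?h = "\<lambda>t. (1 + weight p (fn a t) + weight p (fn b t)) * (\<bar>fn z t\<bar> * \<bar>fn w t\<bar>)"
  let ?g = "\<lambda>t. (fn z' t)\<^sup>2 + (fn w' t)\<^sup>2 + young p (fn a t) + young p (fn b t) + 2 * young p (fn z' t) + 2 * young p (fn w' t)"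
  note ya = young_bound[OF a] and yb = young_bound[OF b] and yz = young_bound[OF z'] and yw = young_bound[OF w']
  have gi: "integrable (lebesgue_on U) ?g"
    by (intro Bochner_Integration.integrable_add integrable_mult_right fn_sq_integrable ya(1) yb(1) yz(1) yw(1))
  have hg: "AE t in lebesgue_on U. ?h t \<le> norm z * norm w * ?g t"
    using fn_scaleR[of "norm z" z'] fn_scaleR[of "norm w" w'] unfolding zz ww
  proof eventually_elim
    case (elim t)
    have pt: "(1 + weight p (fn a t) + weight p (fn b t)) * (\<bar>fn z' t\<bar> * \<bar>fn w' t\<bar>) \<le> ?g t"
    proof -
      have "\<bar>fn z' t\<bar> * \<bar>fn w' t\<bar> \<le> (fn z' t)\<^sup>2 + (fn w' t)\<^sup>2"
      proof -
        have "2 * (\<bar>fn z' t\<bar> * \<bar>fn w' t\<bar>) \<le> (fn z' t)\<^sup>2 + (fn w' t)\<^sup>2"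
          using sum_squares_bound[of "\<bar>fn z' t\<bar>" "\<bar>fn w' t\<bar>"] by (simp add: mult.assoc)
        moreover have "0 \<le> \<bar>fn z' t\<bar> * \<bar>fn w' t\<bar>" by simp
        ultimately show ?thesis by linarith
      qed
      then show ?thesis
        using weight_mult_le_young[OF p, of "fn a t" "fn z' t" "fn w' t"] weight_mult_le_young[OF p, of "fn b t" "fn z' t" "fn w' t"]
        unfolding distrib_right by linarith
    qed
    have "?h t = norm z * norm w * ((1 + weight p (fn a t) + weight p (fn b t)) * (\<bar>fn z' t\<bar> * \<bar>fn w' t\<bar>))"
      unfolding elim by (simp add: abs_mult)
    also have "\<dots> \<le> norm z * norm w * ?g t" by (intro mult_left_mono pt) simp
    finally show ?case .
  qed
  have h0: "0 \<le> ?h t" for t using weight_nonneg[of p] by (intro mult_nonneg_nonneg add_nonneg_nonneg) auto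
  have hm: "?h \<in> borel_measurable (lebesgue_on U)"
    by (intro borel_measurable_times borel_measurable_add borel_measurable_abs borel_measurable_const fn_measurable
        compose_measurable[OF fnL] weight_measurable)
  have gi': "integrable (lebesgue_on U) (\<lambda>t. norm z * norm w * ?g t)" by (rule integrable_mult_right[OF gi])
  show hi: "integrable (lebesgue_on U) ?h"
  proof (rule Bochner_Integration.integrable_bound[OF gi' hm])
    show "AE t in lebesgue_on U. norm (?h t) \<le> norm (norm z * norm w * ?g t)"
      using hg
    proof eventually_elim
      case (elim t)
      then show ?case unfolding real_norm_def using h0[of t] by linarith
    qed
  qed
  have "(LINT t|lebesgue_on U. ?h t) \<le> (LINT t|lebesgue_on U. norm z * norm w * ?g t)"
    by (rule integral_mono_AE[OF hi gi' hg])
  also have "\<dots> = norm z * norm w * (LINT t|lebesgue_on U. ?g t)" by simp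
  also have "\<dots> \<le> norm z * norm w * weight_bound R"
  proof (rule mult_left_mono)
    have "(LINT t|lebesgue_on U. ?g t) = (LINT t|lebesgue_on U. (fn z' t)\<^sup>2) + (LINT t|lebesgue_on U. (fn w' t)\<^sup>2)
        + (LINT t|lebesgue_on U. young p (fn a t)) + (LINT t|lebesgue_on U. young p (fn b t))
        + 2 * (LINT t|lebesgue_on U. young p (fn z' t)) + 2 * (LINT t|lebesgue_on U. young p (fn w' t))"
      using ya(1) yb(1) yz(1) yw(1) fn_sq_integrable[of z'] fn_sq_integrable[of w']
      by (simp add: Bochner_Integration.integral_add Bochner_Integration.integrable_add)
    moreover have "(LINT t|lebesgue_on U. (fn z' t)\<^sup>2) \<le> 1"
      using fn_sq_le[OF z'(1)] power_le_one[OF norm_ge_zero z'(2), of 2] by linarith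
    moreover have "(LINT t|lebesgue_on U. (fn w' t)\<^sup>2) \<le> 1"
      using fn_sq_le[OF w'(1)] power_le_one[OF norm_ge_zero w'(2), of 2] by linarith
    ultimately show "(LINT t|lebesgue_on U. ?g t) \<le> weight_bound R"
      using ya(2) yb(2) yz(2) yw(2) unfolding weight_bound_def by linarith
  qed simp
  finally show "(LINT t|lebesgue_on U. ?h t) \<le> weight_bound R * (norm z * norm w)"
    by (simp only: mult.commute)
qed

text \<open>The local Lipschitz property of the nonlinearity in weak form: the pointwise Lipschitz
  bound puts the weights in front of |b - a| |w|.\<close>

lemma nonlin_product:
  assumes a: "a \<in> HS" and b: "b \<in> HS" "norm a \<le> R" "norm b \<le> R" and w: "w \<in> HS"
  shows "integrable (lebesgue_on U) (\<lambda>t. (nonlin p (fn b t) - nonlin p (fn a t)) * fn w t)"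
    and "\<bar>LINT t|lebesgue_on U. (nonlin p (fn b t) - nonlin p (fn a t)) * fn w t\<bar>
      \<le> nonlin_const p * weight_bound R * (norm (b - a) * norm w)"
proof -
  have ba: "b - a \<in> HS" using a b by (intro subspace_diff subspace_HS)
  let ?h = "\<lambda>t. (nonlin p (fn b t) - nonlin p (fn a t)) * fn w t"
  let ?k = "\<lambda>t. (1 + weight p (fn a t) + weight p (fn b t)) * (\<bar>fn (b - a) t\<bar> * \<bar>fn w t\<bar>)"
  note k = weighted_product[OF a b(2) b(1,3) ba w]
  have ki: "integrable (lebesgue_on U) (\<lambda>t. nonlin_const p * ?k t)" by (rule integrable_mult_right[OF k(1)])
  have le: "AE t in lebesgue_on U. \<bar>?h t\<bar> \<le> nonlin_const p * ?k t"
    using fn_diff[of b a]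
  proof eventually_elim
    case (elim t)
    have "\<bar>?h t\<bar> = \<bar>nonlin p (fn b t) - nonlin p (fn a t)\<bar> * \<bar>fn w t\<bar>" by (rule abs_mult)
    also have "\<dots> \<le> nonlin_const p * (1 + weight p (fn a t) + weight p (fn b t)) * \<bar>fn b t - fn a t\<bar> * \<bar>fn w t\<bar>"
      by (intro mult_right_mono nonlin_lipschitz[OF p]) simp
    also have "\<dots> = nonlin_const p * ?k t" unfolding elim by (simp only: mult.assoc)
    finally show ?case .
  qed
  have hm: "?h \<in> borel_measurable (lebesgue_on U)"
    by (intro borel_measurable_times borel_measurable_diff fn_measurable compose_measurable[OF fnL] nonlin_measurable)
  show hi: "integrable (lebesgue_on U) ?h"
  proof (rule Bochner_Integration.integrable_bound[OF ki hm])
    show "AE t in lebesgue_on U. norm (?h t) \<le> norm (nonlin_const p * ?k t)"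
      using le by eventually_elim (unfold real_norm_def, linarith)
  qed
  have "\<bar>LINT t|lebesgue_on U. ?h t\<bar> \<le> (LINT t|lebesgue_on U. \<bar>?h t\<bar>)" by (rule integral_abs_bound)
  also have "\<dots> \<le> (LINT t|lebesgue_on U. nonlin_const p * ?k t)"
    by (rule integral_mono_AE[OF integrable_abs[OF hi] ki le])
  also have "\<dots> = nonlin_const p * (LINT t|lebesgue_on U. ?k t)" by simp
  also have "\<dots> \<le> nonlin_const p * (weight_bound R * (norm (b - a) * norm w))"
    using nonlin_const_pos[OF p] by (intro mult_left_mono k(2)) simp
  finally show "\<bar>LINT t|lebesgue_on U. ?h t\<bar> \<le> nonlin_const p * weight_bound R * (norm (b - a) * norm w)"
    by (simp only: mult.assoc)
qed

text \<open>Comparison with the zero function, at which the nonlinearity vanishes.\<close>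

lemma nonlin_integrable:
  assumes a: "a \<in> HS" and w: "w \<in> HS"
  shows "integrable (lebesgue_on U) (\<lambda>t. nonlin p (fn a t) * fn w t)"
    and "\<bar>LINT t|lebesgue_on U. nonlin p (fn a t) * fn w t\<bar>
      \<le> nonlin_const p * weight_bound (norm a) * (norm a * norm w)"
proof -
  note n = nonlin_product[OF zero_HS a _ order_refl w]
  have eq: "AE t in lebesgue_on U. (nonlin p (fn a t) - nonlin p (fn 0 t)) * fn w t = nonlin p (fn a t) * fn w t"
    using fn_zero by eventually_elim simp
  have m: "(\<lambda>t. nonlin p (fn a t) * fn w t) \<in> borel_measurable (lebesgue_on U)"
    by (intro borel_measurable_times fn_measurable compose_measurable[OF fnL] nonlin_measurable)
  show "integrable (lebesgue_on U) (\<lambda>t. nonlin p (fn a t) * fn w t)"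
    by (rule integrable_cong_AE_imp[OF n(1) m eq]) simp
  have "(LINT t|lebesgue_on U. (nonlin p (fn a t) - nonlin p (fn 0 t)) * fn w t) = (LINT t|lebesgue_on U. nonlin p (fn a t) * fn w t)"
    by (rule integral_cong_AE[OF borel_measurable_integrable[OF n(1)] m eq]) simp
  then show "\<bar>LINT t|lebesgue_on U. nonlin p (fn a t) * fn w t\<bar>
      \<le> nonlin_const p * weight_bound (norm a) * (norm a * norm w)"
    using n(2) by simp
qed

text \<open>Taylor expansion at 0, where the primitive and its derivative vanish, gives a majorant
  of the kind treated in \<open>weighted_product\<close>.\<close>

lemma nonlin_prim_integrable:
  assumes a: "a \<in> HS"
  shows "integrable (lebesgue_on U) (\<lambda>t. nonlin_prim p (fn a t))"
proof (rule Bochner_Integration.integrable_bound)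
  show "integrable (lebesgue_on U) (\<lambda>t. nonlin_const p * ((1 + weight p (fn a t) + weight p (fn a t)) * (\<bar>fn a t\<bar> * \<bar>fn a t\<bar>)))"
    by (rule integrable_mult_right[OF weighted_product(1)[OF a order_refl a order_refl a a]])
  show "(\<lambda>t. nonlin_prim p (fn a t)) \<in> borel_measurable (lebesgue_on U)"
    by (rule compose_measurable[OF fnL nonlin_prim_measurable])
  show "AE t in lebesgue_on U. norm (nonlin_prim p (fn a t))
      \<le> norm (nonlin_const p * ((1 + weight p (fn a t) + weight p (fn a t)) * (\<bar>fn a t\<bar> * \<bar>fn a t\<bar>)))"
  proof (rule AE_I2)
    fix t
    have "\<bar>nonlin_prim p (fn a t)\<bar> \<le> nonlin_const p * (1 + weight p (fn a t)) * (fn a t)\<^sup>2"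
      using nonlin_prim_taylor[OF p, of "fn a t" 0] by simp
    also have "\<dots> \<le> nonlin_const p * (1 + weight p (fn a t) + weight p (fn a t)) * (fn a t)\<^sup>2"
      using nonlin_const_pos[OF p] weight_nonneg[of p "fn a t"] by (intro mult_right_mono mult_left_mono) auto
    also have "\<dots> = nonlin_const p * ((1 + weight p (fn a t) + weight p (fn a t)) * (\<bar>fn a t\<bar> * \<bar>fn a t\<bar>))"
      by (simp add: power2_eq_square)
    finally show "norm (nonlin_prim p (fn a t)) \<le> norm (nonlin_const p * ((1 + weight p (fn a t) + weight p (fn a t)) * (\<bar>fn a t\<bar> * \<bar>fn a t\<bar>)))"
      unfolding real_norm_def by linarith
  qed
qed

lemma nonlin_prim_product:
  assumes a: "a \<in> HS" and b: "b \<in> HS" "norm a \<le> R" "norm b \<le> R"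
  shows "\<bar>(LINT t|lebesgue_on U. nonlin_prim p (fn b t)) - (LINT t|lebesgue_on U. nonlin_prim p (fn a t))
      - (LINT t|lebesgue_on U. nonlin p (fn a t) * fn (b - a) t)\<bar>
    \<le> nonlin_const p * weight_bound R * (norm (b - a))\<^sup>2"
proof -
  have ba: "b - a \<in> HS" using a b by (intro subspace_diff subspace_HS)
  note Fa = nonlin_prim_integrable[OF a] and Fb = nonlin_prim_integrable[OF b(1)] and fa = nonlin_integrable(1)[OF a ba]
  let ?h = "\<lambda>t. nonlin_prim p (fn b t) - nonlin_prim p (fn a t) - nonlin p (fn a t) * fn (b - a) t"
  let ?k = "\<lambda>t. (1 + weight p (fn a t) + weight p (fn b t)) * (\<bar>fn (b - a) t\<bar> * \<bar>fn (b - a) t\<bar>)"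
  note k = weighted_product[OF a b(2) b(1,3) ba ba]
  have ki: "integrable (lebesgue_on U) (\<lambda>t. nonlin_const p * ?k t)" by (rule integrable_mult_right[OF k(1)])
  have hi: "integrable (lebesgue_on U) ?h" by (intro Bochner_Integration.integrable_diff Fa Fb fa)
  have le: "AE t in lebesgue_on U. \<bar>?h t\<bar> \<le> nonlin_const p * ?k t"
    using fn_diff[of b a]
  proof eventually_elim
    case (elim t)
    have "\<bar>?h t\<bar> \<le> nonlin_const p * (1 + weight p (fn a t) + weight p (fn b t)) * (fn b t - fn a t)\<^sup>2"
      unfolding elim by (rule nonlin_prim_taylor[OF p])
    also have "\<dots> = nonlin_const p * ?k t" unfolding elim by (simp add: power2_eq_square)
    finally show ?case .
  qed
  have "(LINT t|lebesgue_on U. nonlin_prim p (fn b t)) - (LINT t|lebesgue_on U. nonlin_prim p (fn a t))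
      - (LINT t|lebesgue_on U. nonlin p (fn a t) * fn (b - a) t) = (LINT t|lebesgue_on U. ?h t)"
    using Fa Fb fa by (simp add: Bochner_Integration.integral_diff Bochner_Integration.integrable_diff)
  also have "\<bar>\<dots>\<bar> \<le> (LINT t|lebesgue_on U. \<bar>?h t\<bar>)" by (rule integral_abs_bound)
  also have "\<dots> \<le> (LINT t|lebesgue_on U. nonlin_const p * ?k t)"
    by (rule integral_mono_AE[OF integrable_abs[OF hi] ki le])
  also have "\<dots> = nonlin_const p * (LINT t|lebesgue_on U. ?k t)" by simp
  also have "\<dots> \<le> nonlin_const p * (weight_bound R * (norm (b - a) * norm (b - a)))"
    using nonlin_const_pos[OF p] by (intro mult_left_mono k(2)) simp
  finally show ?thesis by (simp only: mult.assoc power2_eq_square)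
qed

section \<open>The energy and its gradient as maps on all of \<open>L2\<close>\<close>

definition Pr :: "('a, real \<times> 'a) L2 \<Rightarrow> ('a, real \<times> 'a) L2" where
  "Pr = (SOME P. bounded_linear P \<and> (\<forall>x. P x \<in> HS) \<and> (\<forall>x\<in>HS. P x = x) \<and> (\<forall>x. \<forall>w\<in>HS. P x \<bullet> w = x \<bullet> w))"

lemma Pr: "bounded_linear Pr" "Pr x \<in> HS" "x \<in> HS \<Longrightarrow> Pr x = x" "w \<in> HS \<Longrightarrow> Pr x \<bullet> w = x \<bullet> w"
proof -
  have "\<exists>P. bounded_linear P \<and> (\<forall>x. P x \<in> HS) \<and> (\<forall>x\<in>HS. P x = x) \<and> (\<forall>x. \<forall>w\<in>HS. P x \<bullet> w = x \<bullet> w)"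
    by (rule orthogonal_projection[OF subspace_HS closed_closure]) blast
  from someI_ex[OF this, folded Pr_def]
  show "bounded_linear Pr" "Pr x \<in> HS" "x \<in> HS \<Longrightarrow> Pr x = x" "w \<in> HS \<Longrightarrow> Pr x \<bullet> w = x \<bullet> w" by auto
qed

lemma Pr_inner: "Pr x \<bullet> y = Pr x \<bullet> Pr y"
  using Pr(4)[OF Pr(2), of y x] by (simp add: inner_commute)

lemma norm_Pr_le: "norm (Pr x) \<le> norm x"
proof -
  have "(norm (Pr x))\<^sup>2 = x \<bullet> Pr x" using Pr(4)[OF Pr(2), of x x] by (simp add: power2_norm_eq_inner)
  also have "\<dots> \<le> norm x * norm (Pr x)" by (rule norm_cauchy_schwarz)
  finally show ?thesis by (cases "Pr x = 0") (auto simp: power2_eq_square)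
qed

lemma Pr_diff: "Pr (x - y) = Pr x - Pr y"
  using Pr(1) by (rule bounded_linear.linear[THEN linear_diff])

text \<open>Arguments are projected first, so that the functional is defined on all of
  \<open>L2\<close>. The second integral is the L2 part of the H1 inner product, which the Dirichlet
  form does not contain and which is removed when \<open>ell\<close> is subtracted.\<close>

definition ell :: "('a, real \<times> 'a) L2 \<Rightarrow> ('a, real \<times> 'a) L2 \<Rightarrow> real" where
  "ell x w = (LINT t|lebesgue_on U. nonlin p (fn (Pr x) t) * fn (Pr w) t) + (LINT t|lebesgue_on U. fn (Pr x) t * fn (Pr w) t)"

lemma ell_bounded_linear: "bounded_linear (ell x)"
proof (rule bounded_linear_intro)
  let ?a = "Pr x"
  note i = nonlin_integrable(1)[OF Pr(2)[of x] Pr(2)] and j = fn_mult_integrable[of ?a]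
  have cong: "(LINT t|lebesgue_on U. f t * fn u t) = (LINT t|lebesgue_on U. f t * g t)"
    if "AE t in lebesgue_on U. fn u t = g t" "f \<in> borel_measurable (lebesgue_on U)" "g \<in> borel_measurable (lebesgue_on U)" for f g u
    using that by (intro integral_cong_AE borel_measurable_times fn_measurable) (auto elim: eventually_mono)
  have m: "(\<lambda>t. nonlin p (fn ?a t)) \<in> borel_measurable (lebesgue_on U)"
    by (rule compose_measurable[OF fnL nonlin_measurable])
  show "ell x (v + w) = ell x v + ell x w" for v w
  proof -
    have e: "AE t in lebesgue_on U. fn (Pr (v + w)) t = fn (Pr v) t + fn (Pr w) t"
      unfolding bounded_linear.linear[OF Pr(1), THEN linear_add] by (rule fn_add)
    have g: "(\<lambda>t. fn (Pr v) t + fn (Pr w) t) \<in> borel_measurable (lebesgue_on U)"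
      by (intro borel_measurable_add fn_measurable)
    show ?thesis
      unfolding ell_def cong[OF e m g] cong[OF e fn_measurable g] distrib_left
      using i[of v] i[of w] j[of "Pr v"] j[of "Pr w"] by (simp add: Bochner_Integration.integral_add)
  qed
  show "ell x (c *\<^sub>R w) = c *\<^sub>R ell x w" for c w
  proof -
    have e: "AE t in lebesgue_on U. fn (Pr (c *\<^sub>R w)) t = c * fn (Pr w) t"
      unfolding bounded_linear.linear[OF Pr(1), THEN linear_scale] by (rule fn_scaleR)
    have g: "(\<lambda>t. c * fn (Pr w) t) \<in> borel_measurable (lebesgue_on U)"
      by (intro borel_measurable_times borel_measurable_const fn_measurable)
    show ?thesis
      unfolding ell_def cong[OF e m g] cong[OF e fn_measurable g] mult.left_commute[of _ c] integral_mult_right_zero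
      by (simp add: distrib_left)
  qed
  show "norm (ell x w) \<le> norm w * (nonlin_const p * weight_bound (norm ?a) * norm ?a + norm ?a)" for w
  proof -
    let ?K = "nonlin_const p * weight_bound (norm ?a)"
    have 1: "\<bar>LINT t|lebesgue_on U. nonlin p (fn ?a t) * fn (Pr w) t\<bar> \<le> ?K * (norm ?a * norm (Pr w))"
      by (rule nonlin_integrable(2)[OF Pr(2) Pr(2)])
    have 2: "\<bar>LINT t|lebesgue_on U. fn ?a t * fn (Pr w) t\<bar> \<le> norm ?a * norm (Pr w)"
      by (rule fn_mult_le[OF Pr(2) Pr(2)])
    have K0: "0 \<le> ?K" unfolding weight_bound_def using nonlin_const_pos[OF p] young_bound_nonneg[of "norm ?a"] young_bound_nonneg[of 1] by simp
    have "\<bar>ell x w\<bar> \<le> ?K * (norm ?a * norm (Pr w)) + norm ?a * norm (Pr w)"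
      unfolding ell_def using 1 2 by linarith
    also have "\<dots> = (?K * norm ?a + norm ?a) * norm (Pr w)" by (simp add: algebra_simps)
    also have "\<dots> \<le> (?K * norm ?a + norm ?a) * norm w"
      using mult_nonneg_nonneg[OF K0 norm_ge_zero[of ?a]] by (intro mult_left_mono norm_Pr_le) simp
    finally show ?thesis by (simp add: mult.commute)
  qed
qed

definition N :: "('a, real \<times> 'a) L2 \<Rightarrow> ('a, real \<times> 'a) L2" where
  "N x = (SOME y. \<forall>w. ell x w = y \<bullet> w)"

lemma N: "N x \<bullet> w = ell x w"
proof -
  have "\<exists>y. \<forall>w. ell x w = y \<bullet> w" by (rule Riesz_representation[OF ell_bounded_linear[of x]]) blast
  from someI_ex[OF this, folded N_def] show ?thesis by simp
qed

text \<open>The gradient of \<open>J\<close> in the H1 inner product: for x and w in the subspace,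
  with u and \<phi> their function parts, the pairing with w is (\<nabla>u, \<nabla>\<phi>) -
  (\<open>nonlin p\<close> u, \<phi>).\<close>

definition G :: "('a, real \<times> 'a) L2 \<Rightarrow> ('a, real \<times> 'a) L2" where
  "G x = Pr x - N x"

definition J :: "('a, real \<times> 'a) L2 \<Rightarrow> real" where
  "J x = 1 / 2 * ((norm (Pr x))\<^sup>2 - (LINT t|lebesgue_on U. (fn (Pr x) t)\<^sup>2)) - (LINT t|lebesgue_on U. nonlin_prim p (fn (Pr x) t))"

text \<open>\<open>ell x w\<close> depends on w only through its projection, so the representing
  vector already lies in the subspace.\<close>

lemma Pr_G: "Pr (G x) = G x"
proof -
  have "Pr (N x) \<bullet> w = N x \<bullet> w" for w
  proof -
    have "Pr (N x) \<bullet> w = Pr (N x) \<bullet> Pr w" by (rule Pr_inner)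
    also have "\<dots> = N x \<bullet> Pr w" by (rule Pr(4)[OF Pr(2)])
    also have "\<dots> = N x \<bullet> w" unfolding N ell_def by (simp add: Pr(3)[OF Pr(2)])
    finally show ?thesis .
  qed
  then have "Pr (N x) = N x" by (metis vector_eq_rdot)
  then show ?thesis by (simp add: G_def Pr_diff Pr(3)[OF Pr(2)])
qed

lemma G_inner:
  assumes x: "x \<in> HS" and w: "w \<in> HS"
  shows "G x \<bullet> w = x \<bullet> w - (LINT t|lebesgue_on U. nonlin p (fn x t) * fn w t) - (LINT t|lebesgue_on U. fn x t * fn w t)"
  unfolding G_def inner_diff_left N ell_def using x w by (simp add: Pr(3))

text \<open>The difference N x - N y is tested against itself, which turns the weak estimate of
  \<open>nonlin_product\<close> into a norm bound. The 2 in L counts the projection and the L2 term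
  of \<open>ell\<close>.\<close>

lemma G_lipschitz: "\<exists>L. L-lipschitz_on (cball 0 R) G"
proof -
  define L where "L = 2 + \<bar>nonlin_const p * weight_bound R\<bar>"
  have "norm (G x - G y) \<le> L * norm (x - y)" if x: "norm x \<le> R" and y: "norm y \<le> R" for x y
  proof -
    let ?n = "N x - N y" and ?K = "nonlin_const p * weight_bound R"
    let ?a = "Pr x" and ?b = "Pr y" and ?w = "Pr (N x - N y)"
    have a: "norm ?a \<le> R" "norm ?b \<le> R" using x y norm_Pr_le order_trans by blast+
    have d: "norm (?a - ?b) \<le> norm (x - y)" using norm_Pr_le[of "x - y"] by (simp add: Pr_diff)
    note i = nonlin_integrable(1)[OF Pr(2) Pr(2)]
    have "?n \<bullet> ?n = (LINT t|lebesgue_on U. (nonlin p (fn ?a t) - nonlin p (fn ?b t)) * fn ?w t)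
        + (LINT t|lebesgue_on U. fn (?a - ?b) t * fn ?w t)"
    proof -
      have "(LINT t|lebesgue_on U. fn (?a - ?b) t * fn ?w t) = (LINT t|lebesgue_on U. (fn ?a t - fn ?b t) * fn ?w t)"
        using fn_diff[of ?a ?b]
        by (intro integral_cong_AE borel_measurable_times borel_measurable_diff fn_measurable) (auto elim: eventually_mono)
      then show ?thesis
        unfolding inner_diff_left N ell_def left_diff_distrib using i fn_mult_integrable
        by (simp add: Bochner_Integration.integral_diff)
    qed
    also have "\<dots> \<le> ?K * (norm (?a - ?b) * norm ?w) + norm (?a - ?b) * norm ?w"
      using nonlin_product(2)[OF Pr(2) Pr(2) a(2,1) Pr(2), of "?n"] fn_mult_le[OF subspace_diff[OF subspace_HS Pr(2) Pr(2)] Pr(2), of x y ?n]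
      by linarith
    also have "\<dots> = (?K + 1) * (norm (?a - ?b) * norm ?w)" by (simp only: distrib_right mult_1)
    also have "\<dots> \<le> (\<bar>?K\<bar> + 1) * (norm (?a - ?b) * norm ?w)"
      by (intro mult_right_mono) auto
    also have "\<dots> \<le> (\<bar>?K\<bar> + 1) * (norm (x - y) * norm ?n)"
      by (intro mult_left_mono mult_mono d norm_Pr_le) auto
    finally have "norm ?n * norm ?n \<le> ((\<bar>?K\<bar> + 1) * norm (x - y)) * norm ?n"
      by (simp only: power2_norm_eq_inner[symmetric] power2_eq_square mult.assoc)
    then have "norm ?n \<le> (\<bar>?K\<bar> + 1) * norm (x - y)"
      by (cases "?n = 0") (auto intro: mult_nonneg_nonneg add_nonneg_nonneg)
    moreover have "G x - G y = (?a - ?b) - ?n" by (simp add: G_def)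
    then have "norm (G x - G y) \<le> norm (?a - ?b) + norm ?n" by (metis norm_triangle_ineq4)
    ultimately have "norm (G x - G y) \<le> norm (x - y) + (\<bar>?K\<bar> + 1) * norm (x - y)" using d by linarith
    then show ?thesis by (simp add: L_def algebra_simps)
  qed
  then have "L-lipschitz_on (cball 0 R) G"
    by (intro lipschitz_onI) (auto simp: dist_norm L_def)
  then show ?thesis by blast
qed

text \<open>The quadratic part expands exactly, and \<open>nonlin_prim_product\<close> shows that
  the primitive leaves a remainder of second order.\<close>

lemma J_taylor:
  assumes x: "norm x \<le> R" and y: "norm y \<le> R"
  shows "\<bar>J y - J x - G x \<bullet> (y - x)\<bar> \<le> (1 + \<bar>nonlin_const p * weight_bound R\<bar>) * (norm (y - x))\<^sup>2"
proof -
  let ?a = "Pr x" and ?b = "Pr y" and ?K = "nonlin_const p * weight_bound R"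
  let ?z = "?b - ?a"
  have z: "?z = Pr (y - x)" by (simp add: Pr_diff)
  have zH: "?z \<in> HS" unfolding z by (rule Pr(2))
  have a: "norm ?a \<le> R" "norm ?b \<le> R" using x y norm_Pr_le order_trans by blast+
  have zn: "(norm ?z)\<^sup>2 \<le> (norm (y - x))\<^sup>2" unfolding z by (intro power_mono norm_Pr_le) simp
  have n: "(norm ?b)\<^sup>2 = (norm ?a)\<^sup>2 + 2 * (?a \<bullet> ?z) + (norm ?z)\<^sup>2"
    by (simp add: power2_norm_eq_inner inner_diff_left inner_diff_right inner_commute)
  have s: "(LINT t|lebesgue_on U. (fn ?b t)\<^sup>2) = (LINT t|lebesgue_on U. (fn ?a t)\<^sup>2)
      + 2 * (LINT t|lebesgue_on U. fn ?a t * fn ?z t) + (LINT t|lebesgue_on U. (fn ?z t)\<^sup>2)"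
  proof -
    have "(LINT t|lebesgue_on U. (fn ?b t)\<^sup>2) = (LINT t|lebesgue_on U. (fn ?a t)\<^sup>2 + 2 * (fn ?a t * fn ?z t) + (fn ?z t)\<^sup>2)"
    proof (intro integral_cong_AE borel_measurable_power borel_measurable_add borel_measurable_times
        borel_measurable_const fn_measurable)
      show "AE t in lebesgue_on U. (fn ?b t)\<^sup>2 = (fn ?a t)\<^sup>2 + 2 * (fn ?a t * fn ?z t) + (fn ?z t)\<^sup>2"
        using fn_diff[of ?b ?a]
      proof eventually_elim
        case (elim t)
        then have "fn ?b t = fn ?a t + fn ?z t" by simp
        then show ?case by (simp only: power2_sum)
      qed
    qed
    also have "\<dots> = (LINT t|lebesgue_on U. (fn ?a t)\<^sup>2)
      + 2 * (LINT t|lebesgue_on U. fn ?a t * fn ?z t) + (LINT t|lebesgue_on U. (fn ?z t)\<^sup>2)"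
      using fn_sq_integrable fn_mult_integrable by (simp add: Bochner_Integration.integral_add Bochner_Integration.integrable_add)
    finally show ?thesis .
  qed
  have g: "G x \<bullet> (y - x) = ?a \<bullet> ?z - (LINT t|lebesgue_on U. nonlin p (fn ?a t) * fn ?z t) - (LINT t|lebesgue_on U. fn ?a t * fn ?z t)"
    unfolding G_def inner_diff_left N ell_def Pr_inner[of x "y - x"] z[symmetric] by linarith
  have F: "\<bar>(LINT t|lebesgue_on U. nonlin_prim p (fn ?b t)) - (LINT t|lebesgue_on U. nonlin_prim p (fn ?a t))
      - (LINT t|lebesgue_on U. nonlin p (fn ?a t) * fn ?z t)\<bar> \<le> ?K * (norm ?z)\<^sup>2"
    by (rule nonlin_prim_product[OF Pr(2) Pr(2) a])
  have q: "0 \<le> (LINT t|lebesgue_on U. (fn ?z t)\<^sup>2)" "(LINT t|lebesgue_on U. (fn ?z t)\<^sup>2) \<le> (norm ?z)\<^sup>2"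
    using fn_sq_le[OF zH] by simp_all
  have "J y - J x - G x \<bullet> (y - x) = 1 / 2 * ((norm ?z)\<^sup>2 - (LINT t|lebesgue_on U. (fn ?z t)\<^sup>2))
      - ((LINT t|lebesgue_on U. nonlin_prim p (fn ?b t)) - (LINT t|lebesgue_on U. nonlin_prim p (fn ?a t))
      - (LINT t|lebesgue_on U. nonlin p (fn ?a t) * fn ?z t))"
    unfolding J_def n s g by (simp add: algebra_simps)
  then have "\<bar>J y - J x - G x \<bullet> (y - x)\<bar> \<le> (norm ?z)\<^sup>2 + ?K * (norm ?z)\<^sup>2"
    using F q unfolding right_diff_distrib by linarith
  also have "\<dots> = (1 + ?K) * (norm ?z)\<^sup>2" by (simp add: algebra_simps)
  also have "\<dots> \<le> (1 + \<bar>?K\<bar>) * (norm (y - x))\<^sup>2"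
    using zn by (intro mult_mono) auto
  finally show ?thesis .
qed

lemma J_has_derivative: "(J has_derivative (\<lambda>h. G x \<bullet> h)) (at x)"
proof (rule has_derivativeI_sandwich[of 1])
  let ?C = "1 + \<bar>nonlin_const p * weight_bound (norm x + 1)\<bar>"
  show "bounded_linear (\<lambda>h. G x \<bullet> h)" by (rule bounded_linear_inner_right)
  show "norm (J y - J x - G x \<bullet> (y - x)) / norm (y - x) \<le> ?C * norm (y - x)" if "y \<noteq> x" "dist y x < 1" for y
  proof -
    have "norm y \<le> norm x + 1" using that norm_triangle_sub[of y x] by (simp add: dist_norm)
    then have "\<bar>J y - J x - G x \<bullet> (y - x)\<bar> \<le> ?C * (norm (y - x))\<^sup>2" by (intro J_taylor) simp_all
    then show ?thesis using that by (simp add: divide_le_eq power2_eq_square)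
  qed
  show "((\<lambda>y. ?C * norm (y - x)) \<longlongrightarrow> 0) (at x)"
  proof -
    have "((\<lambda>y. ?C * norm (y - x)) \<longlongrightarrow> ?C * norm (x - x)) (at x)" by (intro tendsto_intros)
    then show ?thesis by simp
  qed
qed simp

end

section \<open>From the gradient flow to a weak solution\<close>

text \<open>Simple functions arise by sampling the curve on a dyadic time grid. Continuity is
  required of y only, whose distances dominate those of w in N.\<close>

lemma strongly_measurable_onI_continuous:
  fixes y :: "real \<Rightarrow> 'h::real_normed_vector" and w :: "real \<Rightarrow> 'a \<Rightarrow> real"
  assumes X: "\<And>t. 0 \<le> t \<Longrightarrow> w t \<in> X" and cont: "continuous_on {0..} y"
    and N: "\<And>a b. 0 \<le> a \<Longrightarrow> 0 \<le> b \<Longrightarrow> 0 \<le> N (\<lambda>x. w a x - w b x) \<and> N (\<lambda>x. w a x - w b x) \<le> norm (y a - y b)"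
  shows "strongly_measurable_on X N {0<..} w"
  unfolding strongly_measurable_on_def
proof (intro conjI exI allI)
  \<comment> \<open>Times before k are rounded down to multiples of 2^(- k); later times are sent to
    0, so that only finitely many values occur.\<close>
  define grid :: "nat \<Rightarrow> real \<Rightarrow> real" where
    "grid k t = (if t < real k then real_of_int \<lfloor>t * 2 ^ k\<rfloor> / 2 ^ k else 0)" for k t
  have grid0: "0 \<le> grid k t" if "0 < t" for k t using that by (simp add: grid_def)
  show "AE t in lebesgue_on {0<..}. w t \<in> X" using X by (intro AE_I2) simp
  fix k :: nat
  let ?s = "\<lambda>t. w (grid k t)"
  define I where "I = (\<lambda>j::int. real_of_int j / 2 ^ k) ` {0..int k * 2 ^ k}"
  have gI: "grid k t \<in> I" if "0 < t" for t
  proof (cases "t < real k")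
    case True
    have le: "t * 2 ^ k \<le> real k * 2 ^ k" using True by (intro mult_right_mono) auto
    have "real_of_int \<lfloor>t * 2 ^ k\<rfloor> \<le> real_of_int (int k * 2 ^ k)"
      using order_trans[OF of_int_floor_le le] by simp
    then have "\<lfloor>t * 2 ^ k\<rfloor> \<le> int k * 2 ^ k" by (simp only: of_int_le_iff)
    moreover have "0 \<le> \<lfloor>t * 2 ^ k\<rfloor>" using that by simp
    ultimately show ?thesis using True by (auto simp: I_def grid_def)
  next
    case False
    then show ?thesis by (auto simp: I_def grid_def image_iff intro!: bexI[of _ 0])
  qed
  have "?s ` {0<..} \<subseteq> w ` I" using gI by auto
  moreover have "finite (w ` I)" by (simp add: I_def)
  ultimately show "finite (?s ` {0<..})" by (rule finite_subset)
  show "?s ` {0<..} \<subseteq> X" using X grid0 by auto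
  fix z
  have "grid k \<in> borel_measurable borel"
    unfolding grid_def by measurable
  then have "{t \<in> {0<..}. grid k t = c} \<in> sets lebesgue" for c
  proof -
    have "grid k -` {c} \<inter> space borel \<in> sets borel"
      by (rule measurable_sets[OF \<open>grid k \<in> borel_measurable borel\<close>]) simp
    then have "(grid k -` {c} \<inter> space borel) \<inter> {0<..} \<in> sets lborel" by simp
    then have "(grid k -` {c} \<inter> space borel) \<inter> {0<..} \<in> sets lebesgue" by (rule sets_completionI_sets)
    moreover have "{t \<in> {0<..}. grid k t = c} = (grid k -` {c} \<inter> space borel) \<inter> {0<..}" by auto
    ultimately show ?thesis by simp
  qed
  \<comment> \<open>The curve may take the same value at several grid points, so a level set is a
    finite union over them.\<close>
  then have "(\<Union>c\<in>{c\<in>I. w c = z}. {t \<in> {0<..}. grid k t = c}) \<in> sets lebesgue"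
    by (intro sets.finite_UN) (auto simp: I_def)
  moreover have "{t \<in> {0<..}. ?s t = z} = (\<Union>c\<in>{c\<in>I. w c = z}. {t \<in> {0<..}. grid k t = c})"
    using gI by auto
  ultimately show "{t \<in> {0<..}. ?s t = z} \<in> sets lebesgue" by simp
next
  define grid :: "nat \<Rightarrow> real \<Rightarrow> real" where
    "grid k t = (if t < real k then real_of_int \<lfloor>t * 2 ^ k\<rfloor> / 2 ^ k else 0)" for k t
  have grid0: "0 \<le> grid k t" if "0 < t" for k t using that by (simp add: grid_def)
  have "(\<lambda>k. N (\<lambda>x. w (grid k t) x - w t x)) \<longlonglongrightarrow> 0" if t: "0 < t" for t
  proof -
    have "\<bar>grid k t - t\<bar> \<le> (1 / 2) ^ k" if "t < real k" for k
    proof -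
      have "real_of_int \<lfloor>t * 2 ^ k\<rfloor> \<le> t * 2 ^ k" "t * 2 ^ k < real_of_int \<lfloor>t * 2 ^ k\<rfloor> + 1" by linarith+
      then have "real_of_int \<lfloor>t * 2 ^ k\<rfloor> / 2 ^ k \<le> t" "t < (real_of_int \<lfloor>t * 2 ^ k\<rfloor> + 1) / 2 ^ k"
        by (simp_all add: field_simps)
      then show ?thesis using that by (simp add: grid_def add_divide_distrib power_one_over)
    qed
    moreover have "\<forall>\<^sub>F k in sequentially. t < real k"
      using filterlim_real_sequentially by (simp add: filterlim_at_top_dense)
    ultimately have "\<forall>\<^sub>F k in sequentially. norm (grid k t - t) \<le> (1 / 2) ^ k"
      by (auto elim: eventually_mono)
    then have "(\<lambda>k. grid k t - t) \<longlonglongrightarrow> 0"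
      by (rule Lim_null_comparison) (simp add: LIMSEQ_realpow_zero)
    then have "(\<lambda>k. grid k t) \<longlonglongrightarrow> t" by (simp add: LIM_zero_iff)
    then have "(\<lambda>k. y (grid k t)) \<longlonglongrightarrow> y t"
      by (rule continuous_on_tendsto_compose[OF cont]) (use t grid0 in auto)
    then have "(\<lambda>k. norm (y (grid k t) - y t)) \<longlonglongrightarrow> 0" by (simp add: tendsto_norm_zero_iff LIM_zero_iff)
    then show ?thesis
      by (rule Lim_null_comparison[rotated]) (use N[OF grid0[OF t] less_imp_le[OF t]] in simp)
  qed
  then show "AE t in lebesgue_on {0<..}. (\<lambda>k. N (\<lambda>x. w (if t < real k then real_of_int \<lfloor>t * 2 ^ k\<rfloor> / 2 ^ k else 0) x - w t x)) \<longlonglongrightarrow> 0"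
    unfolding grid_def by (intro AE_I2) simp
qed

text \<open>Monotone convergence along the intervals [0, n], on which the gauge integral of a
  continuous function agrees with the Lebesgue integral.\<close>

lemma integrable_half_line:
  fixes f :: "real \<Rightarrow> real"
  assumes cont: "continuous_on {0..} f" and nonneg: "\<And>t. 0 \<le> t \<Longrightarrow> 0 \<le> f t"
    and bound: "\<And>n::nat. integral {0..real n} f \<le> C"
  shows "integrable (lebesgue_on {0<..}) f"
proof -
  define g where "g t = indicator {0..} t * f t" for t
  have gm: "g \<in> borel_measurable borel"
    unfolding g_def
    using borel_measurable_continuous_on_indicator[OF _ cont] by (simp add: closed_atLeast borel_closed)
  have g0: "0 \<le> g t" for t using nonneg by (simp add: g_def split: split_indicator)
  have "(\<integral>\<^sup>+t. ennreal (g t) \<partial>lborel) = (\<integral>\<^sup>+t. (SUP n. ennreal (g t) * indicator {0..real n} t) \<partial>lborel)"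
  proof (rule nn_integral_cong)
    fix t
    obtain m :: nat where m: "t \<le> real m" using real_arch_simple by blast
    show "ennreal (g t) = (SUP n. ennreal (g t) * indicator {0..real n} t)"
    proof (rule antisym)
      show "ennreal (g t) \<le> (SUP n. ennreal (g t) * indicator {0..real n} t)"
        by (rule SUP_upper2[of m]) (use m in \<open>auto simp: g_def split: split_indicator\<close>)
      show "(SUP n. ennreal (g t) * indicator {0..real n} t) \<le> ennreal (g t)"
        by (rule SUP_least) (auto split: split_indicator)
    qed
  qed
  also have "\<dots> = (SUP n. \<integral>\<^sup>+t. ennreal (g t) * indicator {0..real n} t \<partial>lborel)"
  proof (rule nn_integral_monotone_convergence_SUP)
    show "incseq (\<lambda>n t. ennreal (g t) * indicator {0..real n} t)"
      by (auto simp: incseq_def le_fun_def split: split_indicator)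
    show "(\<lambda>t. ennreal (g t) * indicator {0..real n} t) \<in> borel_measurable lborel" for n
      using gm by measurable
  qed
  also have "\<dots> \<le> ennreal C"
  proof (rule SUP_least)
    fix n :: nat
    have fi: "f integrable_on {0..real n}"
      by (rule integrable_continuous_real, rule continuous_on_subset[OF cont]) auto
    have "(\<integral>\<^sup>+t. ennreal (g t) * indicator {0..real n} t \<partial>lborel) = (\<integral>\<^sup>+t. ennreal (f t) * indicator {0..real n} t \<partial>lborel)"
      by (rule nn_integral_cong) (auto simp: g_def split: split_indicator)
    also have "\<dots> = ennreal (integral {0..real n} f)"
      by (rule nn_integral_has_integral_lebesgue'[OF _ integrable_integral[OF fi]]) (use nonneg in auto)
    also have "\<dots> \<le> ennreal C" by (rule ennreal_leI[OF bound])
    finally show "(\<integral>\<^sup>+t. ennreal (g t) * indicator {0..real n} t \<partial>lborel) \<le> ennreal C" .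
  qed
  finally have "(\<integral>\<^sup>+t. ennreal (g t) \<partial>lborel) \<le> ennreal C" .
  then have "(\<integral>\<^sup>+t. ennreal (norm (g t)) \<partial>lborel) < \<infinity>"
    using g0 ennreal_less_top[of C] by (simp add: le_less_trans)
  then have "integrable lborel g" using gm by (intro integrableI_bounded) auto
  then have "integrable lebesgue g" using gm by (subst integrable_completion) auto
  then have "integrable lebesgue (\<lambda>t. indicator {0<..} t *\<^sub>R g t)"
    by (rule integrable_mult_indicator[rotated]) simp
  moreover have "(\<lambda>t. indicator {0<..} t *\<^sub>R g t) = (\<lambda>t. if t \<in> {0<..} then f t else 0)"
    by (auto simp: g_def)
  ultimately show ?thesis
    using Lebesgue_Measure.integrable_restrict_UNIV[of "{0<..}" f] by simp
qed

lemma deriv_test_function: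
  fixes \<psi> :: "real \<Rightarrow> real"
  assumes "smooth \<psi>"
  shows "(\<psi> has_real_derivative deriv \<psi> t) (at t)" "deriv \<psi> t = frechet_derivative \<psi> (at t) 1"
proof -
  have d: "(\<psi> has_derivative frechet_derivative \<psi> (at t)) (at t)" by (rule smooth_has_derivative[OF assms])
  have "frechet_derivative \<psi> (at t) = (*) (frechet_derivative \<psi> (at t) 1)"
  proof
    fix h
    have "frechet_derivative \<psi> (at t) (h *\<^sub>R 1) = h *\<^sub>R frechet_derivative \<psi> (at t) 1"
      using has_derivative_linear[OF d] by (rule linear_scale)
    then show "frechet_derivative \<psi> (at t) h = frechet_derivative \<psi> (at t) 1 * h" by (simp add: mult.commute)
  qed
  then have "(\<psi> has_real_derivative frechet_derivative \<psi> (at t) 1) (at t)"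
    using d by (simp add: has_field_derivative_def)
  then show "(\<psi> has_real_derivative deriv \<psi> t) (at t)" "deriv \<psi> t = frechet_derivative \<psi> (at t) 1"
    using DERIV_imp_deriv by metis+
qed

text \<open>The support of \<psi> is compact in the open half line, so both integrals live on some
  [0, T] at whose ends \<psi> vanishes, and the fundamental theorem applies to the product of \<psi>
  and g.\<close>

lemma integral_by_parts_half_line:
  fixes g g' \<psi> :: "real \<Rightarrow> real"
  assumes \<psi>: "\<psi> \<in> test_functions {0<..}"
    and g: "\<And>t. 0 \<le> t \<Longrightarrow> (g has_real_derivative g' t) (at t within {0..})" and g': "continuous_on {0..} g'"
  shows "(LINT t|lebesgue_on {0<..}. deriv \<psi> t * g t) = - (LINT t|lebesgue_on {0<..}. \<psi> t * g' t)"
proof -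
  obtain K where K: "smooth \<psi>" "compact K" "K \<subseteq> {0<..}" "\<And>t. t \<notin> K \<Longrightarrow> \<psi> t = 0"
    "\<And>t. t \<notin> K \<Longrightarrow> frechet_derivative \<psi> (at t) = (\<lambda>h. 0)"
    using test_functionsE[OF \<psi>] by metis
  note D = deriv_test_function[OF K(1)]
  obtain R where R: "\<And>t. t \<in> K \<Longrightarrow> \<bar>t\<bar> \<le> R" using compact_imp_bounded[OF K(2)] by (auto simp: bounded_iff)
  \<comment> \<open>Adding 1 puts T strictly beyond the support; the absolute value keeps T positive
    when the support is empty and R is arbitrary.\<close>
  define T where "T = \<bar>R\<bar> + 1"
  have T: "0 < T" by (simp add: T_def)
  have KT: "t \<in> {0<..<T}" if "t \<in> K" for t using R[OF that] K(3) that by (auto simp: T_def)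
  have d0: "deriv \<psi> t = 0" if "t \<notin> K" for t using K(5)[OF that] D(2)[of t] by simp
  have gc: "continuous_on {0..} g"
    using g by (auto simp: continuous_on_eq_continuous_within intro: DERIV_continuous)
  have dc: "continuous_on S (deriv \<psi>)" for S
    unfolding D(2)[abs_def] by (rule smooth_continuous_on[OF smooth_frechet_derivative[OF K(1)]]) simp
  have conv: "(LINT t|lebesgue_on {0<..}. F t) = integral {0..T} F"
    if F: "continuous_on {0..} F" "\<And>t. t \<notin> K \<Longrightarrow> F t = 0" for F :: "real \<Rightarrow> real"
  proof -
    have "(\<lambda>t. if t \<in> {0<..} then F t else 0) = (\<lambda>t. if t \<in> {0..T} then F t else 0)"
      using F(2) KT by fastforce
    then have "(LINT t|lebesgue_on {0<..}. F t) = (LINT t|lebesgue_on {0..T}. F t)"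
      using Lebesgue_Measure.integral_restrict_UNIV[of "{0<..}" F] Lebesgue_Measure.integral_restrict_UNIV[of "{0..T}" F] by simp
    also have "\<dots> = integral {0..T} F"
    proof (rule lebesgue_integral_eq_integral)
      have "continuous_on (cbox 0 T) F" using F(1) by (rule continuous_on_subset) auto
      then have "integrable (lebesgue_on (cbox 0 T)) F" by (rule continuous_imp_integrable)
      then show "integrable (lebesgue_on {0..T}) F" by simp
    qed simp
    finally show ?thesis .
  qed
  have c1: "continuous_on {0..} (\<lambda>t. deriv \<psi> t * g t)" and c2: "continuous_on {0..} (\<lambda>t. \<psi> t * g' t)"
    by (intro continuous_on_mult dc gc g' smooth_continuous_on K(1))+
  have "((\<lambda>t. deriv \<psi> t * g t + \<psi> t * g' t) has_integral (\<psi> T * g T - \<psi> 0 * g 0)) {0..T}"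
  proof (rule fundamental_theorem_of_calculus)
    fix t assume t: "t \<in> {0..T}"
    have "(\<psi> has_real_derivative deriv \<psi> t) (at t within {0..T})"
      using D(1) by (rule has_field_derivative_at_within)
    moreover have "(g has_real_derivative g' t) (at t within {0..T})"
      by (rule has_field_derivative_subset[OF g]) (use t in auto)
    ultimately have "((\<lambda>t. \<psi> t * g t) has_real_derivative (deriv \<psi> t * g t + g' t * \<psi> t)) (at t within {0..T})"
      by (rule DERIV_mult)
    then show "((\<lambda>t. \<psi> t * g t) has_vector_derivative (deriv \<psi> t * g t + \<psi> t * g' t)) (at t within {0..T})"
      by (simp add: has_real_derivative_iff_has_vector_derivative mult.commute)
  qed (use T in simp)
  moreover have "T \<notin> K" "0 \<notin> K" using KT by fastforce+
  ultimately have "integral {0..T} (\<lambda>t. deriv \<psi> t * g t + \<psi> t * g' t) = 0"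
    using K(4) by (simp add: integral_unique)
  moreover have "(\<lambda>t. deriv \<psi> t * g t) integrable_on {0..T}" "(\<lambda>t. \<psi> t * g' t) integrable_on {0..T}"
    by (rule integrable_continuous_real, rule continuous_on_subset[OF c1], simp,
        rule integrable_continuous_real, rule continuous_on_subset[OF c2], simp)
  ultimately have "integral {0..T} (\<lambda>t. deriv \<psi> t * g t) + integral {0..T} (\<lambda>t. \<psi> t * g' t) = 0"
    by (simp add: Henstock_Kurzweil_Integration.integral_add)
  then show ?thesis
    using conv[OF c1] conv[OF c2] d0 K(4) by simp
qed

section \<open>Curves in the subspace as weak solutions\<close>

context well_problem
begin

lemma HS_facts:
  assumes z: "z \<in> HS"
  shows "fn z \<in> H01 U" "wgrad U (fn z) \<in> Lspace U 2" "h1pair U (fn z) (wgrad U (fn z)) = z"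
    "H1norm U (fn z) = norm z"
proof -
  note c = closure_test_space[OF open_U z]
  show "fn z \<in> H01 U" by (rule c(3))
  note e = H1norm_eq_h1pair[OF open_U fnL grL c(2)]
  show "wgrad U (fn z) \<in> Lspace U 2" by (rule e(1))
  show "h1pair U (fn z) (wgrad U (fn z)) = z" "H1norm U (fn z) = norm z" using e(2,3) c(1) by simp_all
qed

lemma H1norm_fn_diff:
  assumes a: "a \<in> HS" and b: "b \<in> HS"
  shows "H1norm U (\<lambda>t. fn a t - fn b t) = norm (a - b)"
proof -
  note ca = closure_test_space[OF open_U a] and cb = closure_test_space[OF open_U b]
  have w: "is_weak_gradient U (\<lambda>t. fn a t - fn b t) (\<lambda>t. gr a t - gr b t)"
    using is_weak_gradient_lin[OF Us ca(2) cb(2), of "-1"] by simp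
  have "H1norm U (\<lambda>t. fn a t - fn b t) = norm (h1pair U (\<lambda>t. fn a t - fn b t) (\<lambda>t. gr a t - gr b t))"
    by (rule H1norm_eq_h1pair(3)[OF open_U Lspace_2_diff[OF Us fnL fnL] Lspace_2_diff[OF Us grL grL] w])
  also have "\<dots> = norm (a - b)"
    unfolding h1pair_diff[OF Us fnL grL fnL grL] by (simp add: ca(1) cb(1))
  finally show ?thesis .
qed

lemma Lnorm_fn_diff:
  assumes a: "a \<in> HS" and b: "b \<in> HS"
  shows "Lnorm U 2 (\<lambda>t. fn a t - fn b t) \<le> norm (a - b)"
proof (rule power2_le_imp_le)
  show "(Lnorm U 2 (\<lambda>t. fn a t - fn b t))\<^sup>2 \<le> (norm (a - b))\<^sup>2"
    using H1norm_sq[of "\<lambda>t. fn a t - fn b t"] by (simp add: H1norm_fn_diff[OF a b])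
qed simp

lemma Lnorm_fn_le: "z \<in> HS \<Longrightarrow> Lnorm U 2 (fn z) \<le> norm z"
  by (rule power2_le_imp_le) (simp_all add: Lnorm_2_sq fn_sq_le)

text \<open>The pair (w, 0) turns the L2 product into a continuous linear functional on
  \<open>L2\<close>, so that time derivatives of a curve pass to it.\<close>

lemma L2inner_fn: "z \<in> HS \<Longrightarrow> w \<in> Lspace U 2 \<Longrightarrow> L2inner U (fn z) w = z \<bullet> h1pair U w (\<lambda>t. 0)"
  using h1pair_inner[OF Us fnL grL, of w "\<lambda>t. 0" z z] HS_pair[of z] by (simp add: L2inner_def Lspace_2_iff)

text \<open>From a^2 - b^2 = (a - b) (a + b) and the Cauchy-Schwarz bound
  \<open>fn_mult_le\<close>.\<close>

lemma fn_sq_continuous: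
  assumes y: "continuous_on S y" and yH: "\<And>t. t \<in> S \<Longrightarrow> y t \<in> HS"
  shows "continuous_on S (\<lambda>t. (Lnorm U 2 (fn (y t)))\<^sup>2)"
  unfolding continuous_on_def
proof
  fix s assume s: "s \<in> S"
  have lim: "(y \<longlongrightarrow> y s) (at s within S)" using y s by (simp add: continuous_on_def)
  have eq: "(Lnorm U 2 (fn a))\<^sup>2 - (Lnorm U 2 (fn b))\<^sup>2 = (LINT t|lebesgue_on U. fn (a - b) t * fn (a + b) t)" for a b
  proof -
    have "(Lnorm U 2 (fn a))\<^sup>2 - (Lnorm U 2 (fn b))\<^sup>2 = (LINT t|lebesgue_on U. (fn a t)\<^sup>2 - (fn b t)\<^sup>2)"
      unfolding Lnorm_2_sq using fn_sq_integrable[of a] fn_sq_integrable[of b]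
      by (simp add: Bochner_Integration.integral_diff)
    also have "\<dots> = (LINT t|lebesgue_on U. fn (a - b) t * fn (a + b) t)"
    proof (intro integral_cong_AE borel_measurable_diff borel_measurable_power borel_measurable_times fn_measurable)
      show "AE t in lebesgue_on U. (fn a t)\<^sup>2 - (fn b t)\<^sup>2 = fn (a - b) t * fn (a + b) t"
        using fn_diff[of a b] fn_add[of a b]
      proof eventually_elim
        case (elim t)
        show ?case unfolding elim by (simp add: power2_eq_square algebra_simps)
      qed
    qed
    finally show ?thesis .
  qed
  have "((\<lambda>t. norm (y t - y s) * norm (y t + y s)) \<longlongrightarrow> norm (y s - y s) * norm (y s + y s)) (at s within S)"
    by (intro tendsto_intros lim)
  then have l0: "((\<lambda>t. norm (y t - y s) * norm (y t + y s)) \<longlongrightarrow> 0) (at s within S)" by simp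
  have "((\<lambda>t. (Lnorm U 2 (fn (y t)))\<^sup>2 - (Lnorm U 2 (fn (y s)))\<^sup>2) \<longlongrightarrow> 0) (at s within S)"
  proof (rule Lim_null_comparison[OF _ l0])
    show "\<forall>\<^sub>F t in at s within S. norm ((Lnorm U 2 (fn (y t)))\<^sup>2 - (Lnorm U 2 (fn (y s)))\<^sup>2) \<le> norm (y t - y s) * norm (y t + y s)"
      unfolding eventually_at_filter
    proof (intro always_eventually allI impI)
      fix t assume "t \<in> S"
      then show "norm ((Lnorm U 2 (fn (y t)))\<^sup>2 - (Lnorm U 2 (fn (y s)))\<^sup>2) \<le> norm (y t - y s) * norm (y t + y s)"
        unfolding eq real_norm_def using yH s
        by (intro fn_mult_le subspace_diff subspace_add subspace_HS) auto
    qed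
  qed
  then show "((\<lambda>t. (Lnorm U 2 (fn (y t)))\<^sup>2) \<longlongrightarrow> (Lnorm U 2 (fn (y s)))\<^sup>2) (at s within S)"
    by (rule LIM_zero_cancel)
qed

text \<open>Translates a continuously differentiable curve in the subspace into the definition of a
  weak solution. In the equation y t \<bullet> w is the full H1 product, as required for the time
  derivative, while from x t \<bullet> w the L2 product is subtracted so that only the gradients
  remain.\<close>

lemma path_global_weak_solution:
  assumes init: "AE t in lebesgue_on U. fn (x 0) t = v0 t"
    and xH: "\<And>t. 0 \<le> t \<Longrightarrow> x t \<in> HS" and yH: "\<And>t. 0 \<le> t \<Longrightarrow> y t \<in> HS"
    and deriv: "\<And>t. 0 \<le> t \<Longrightarrow> (x has_vector_derivative y t) (at t within {0..})"
    and ycont: "continuous_on {0..} y"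
    and xb: "\<And>t. 0 \<le> t \<Longrightarrow> norm (x t) \<le> M" and yb: "\<And>t. 0 \<le> t \<Longrightarrow> norm (y t) \<le> M'"
    and energy: "\<And>T. 0 \<le> T \<Longrightarrow> integral {0..T} (\<lambda>t. (norm (y t))\<^sup>2) \<le> C"
    and eq: "\<And>t w. 0 < t \<Longrightarrow> w \<in> HS \<Longrightarrow> integrable (lebesgue_on U) (\<lambda>s. nonlin p (fn (x t) s) * fn w s)"
      "\<And>t w. 0 < t \<Longrightarrow> w \<in> HS \<Longrightarrow> y t \<bullet> w + x t \<bullet> w - (LINT s|lebesgue_on U. fn (x t) s * fn w s)
        = (LINT s|lebesgue_on U. nonlin p (fn (x t) s) * fn w s)"
  shows "global_weak_solution U p v0 (\<lambda>t. fn (x t)) (\<lambda>t. fn (y t)) \<and>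
    Linf_time (H01 U) (H1norm U) {0<..} (\<lambda>t. fn (x t)) \<and>
    Linf_time (Lspace U 2) (Lnorm U 2) {0<..} (\<lambda>t. fn (y t))"
proof -
  have S: "{t. 0 < t \<and> ereal t < \<infinity>} = {0<..}" "{t. 0 \<le> t \<and> ereal t < \<infinity>} = {0..}" by auto
  have xcont: "continuous_on {0..} x"
    using deriv has_vector_derivative_continuous unfolding continuous_on_eq_continuous_within by blast
  have sm_x: "strongly_measurable_on (H01 U) (H1norm U) {0<..} (\<lambda>t. fn (x t))"
    by (rule strongly_measurable_onI_continuous[OF _ xcont])
       (use xH in \<open>simp_all add: HS_facts(1) H1norm_fn_diff\<close>)
  have sm_y: "strongly_measurable_on (Lspace U 2) (Lnorm U 2) {0<..} (\<lambda>t. fn (y t))"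
    by (rule strongly_measurable_onI_continuous[OF _ ycont])
       (use yH in \<open>simp_all add: fnL Lnorm_fn_diff Lnorm_nonneg\<close>)
  have Lx: "Linf_time (H01 U) (H1norm U) {0<..} (\<lambda>t. fn (x t))"
    unfolding Linf_time_def using sm_x xb xH
    by (intro conjI exI[of _ M] AE_I2) (simp_all add: HS_facts(4))
  have Ly: "Linf_time (Lspace U 2) (Lnorm U 2) {0<..} (\<lambda>t. fn (y t))"
    unfolding Linf_time_def
  proof (intro conjI exI[of _ M'] AE_I2 sm_y)
    fix t assume "t \<in> space (lebesgue_on {0<..} :: real measure)"
    then have t: "0 \<le> t" by simp
    show "Lnorm U 2 (fn (y t)) \<le> M'" using Lnorm_fn_le[OF yH[OF t]] yb[OF t] by linarith
  qed
  have L2y: "L2_time (Lspace U 2) (Lnorm U 2) {0<..} (\<lambda>t. fn (y t))"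
    unfolding L2_time_def
  proof (intro conjI sm_y integrable_half_line)
    show c: "continuous_on {0..} (\<lambda>t. (Lnorm U 2 (fn (y t)))\<^sup>2)"
      by (rule fn_sq_continuous[OF ycont]) (use yH in simp)
    fix n :: nat
    have "integral {0..real n} (\<lambda>t. (Lnorm U 2 (fn (y t)))\<^sup>2) \<le> integral {0..real n} (\<lambda>t. (norm (y t))\<^sup>2)"
    proof (rule integral_le)
      show "(\<lambda>t. (Lnorm U 2 (fn (y t)))\<^sup>2) integrable_on {0..real n}"
        by (rule integrable_continuous_real, rule continuous_on_subset[OF c]) auto
      show "(\<lambda>t. (norm (y t))\<^sup>2) integrable_on {0..real n}"
        by (rule integrable_continuous_real, intro continuous_on_power continuous_on_norm,
            rule continuous_on_subset[OF ycont]) auto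
      show "(Lnorm U 2 (fn (y t)))\<^sup>2 \<le> (norm (y t))\<^sup>2" if "t \<in> {0..real n}" for t
        using that yH by (intro power_mono Lnorm_fn_le Lnorm_nonneg) auto
    qed
    also have "\<dots> \<le> C" by (rule energy) simp
    finally show "integral {0..real n} (\<lambda>t. (Lnorm U 2 (fn (y t)))\<^sup>2) \<le> C" .
  qed simp
  have wtd: "weak_time_derivative U {0<..} (\<lambda>t. fn (x t)) (\<lambda>t. fn (y t))"
    unfolding weak_time_derivative_def
  proof (intro ballI)
    fix \<psi> :: "real \<Rightarrow> real" and w :: "'a \<Rightarrow> real"
    assume \<psi>: "\<psi> \<in> test_functions {0<..}" and w: "w \<in> Lspace U 2"
    let ?w = "h1pair U w (\<lambda>t. 0)"
    have "(LINT t|lebesgue_on {0<..}. deriv \<psi> t * (x t \<bullet> ?w)) = - (LINT t|lebesgue_on {0<..}. \<psi> t * (y t \<bullet> ?w))"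
    proof (rule integral_by_parts_half_line[OF \<psi>])
      show "continuous_on {0..} (\<lambda>t. y t \<bullet> ?w)" by (intro continuous_on_inner ycont continuous_on_const)
      fix t :: real assume t: "0 \<le> t"
      show "((\<lambda>t. x t \<bullet> ?w) has_real_derivative y t \<bullet> ?w) (at t within {0..})"
        unfolding has_real_derivative_iff_has_vector_derivative
        by (rule bounded_linear.has_vector_derivative[OF bounded_linear_inner_left deriv[OF t]])
    qed
    moreover have "(LINT t|lebesgue_on {0<..}. deriv \<psi> t * L2inner U (fn (x t)) w) = (LINT t|lebesgue_on {0<..}. deriv \<psi> t * (x t \<bullet> ?w))"
      by (rule Bochner_Integration.integral_cong) (use xH w in \<open>simp_all add: L2inner_fn\<close>)
    moreover have "(LINT t|lebesgue_on {0<..}. \<psi> t * L2inner U (fn (y t)) w) = (LINT t|lebesgue_on {0<..}. \<psi> t * (y t \<bullet> ?w))"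
      by (rule Bochner_Integration.integral_cong) (use yH w in \<open>simp_all add: L2inner_fn\<close>)
    ultimately show "(LINT t|lebesgue_on {0<..}. deriv \<psi> t * L2inner U (fn (x t)) w) =
        - (LINT t|lebesgue_on {0<..}. \<psi> t * L2inner U (fn (y t)) w)" by simp
  qed
  have cont: "((\<lambda>t. Lnorm U 2 (\<lambda>r. fn (x t) r - fn (x s) r)) \<longlongrightarrow> 0) (at s within {0..})" if s: "0 \<le> s" for s
  proof (rule Lim_null_comparison)
    show "\<forall>\<^sub>F t in at s within {0..}. norm (Lnorm U 2 (\<lambda>r. fn (x t) r - fn (x s) r)) \<le> norm (x t - x s)"
      unfolding eventually_at_filter using xH s
      by (intro always_eventually allI impI) (simp add: Lnorm_nonneg Lnorm_fn_diff)
    have "(x \<longlongrightarrow> x s) (at s within {0..})" using xcont s by (simp add: continuous_on_def)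
    then show "((\<lambda>t. norm (x t - x s)) \<longlongrightarrow> 0) (at s within {0..})"
      by (simp add: tendsto_norm_zero_iff LIM_zero_iff)
  qed
  have equation: "integrable (lebesgue_on U) (\<lambda>s. fn (x t) s * \<bar>fn (x t) s\<bar> powr (p - 1) * ln \<bar>fn (x t) s\<bar> * w s)
      \<and> L2inner U (fn (y t)) w + L2inner U (wgrad U (fn (y t))) (wgrad U w)
         + L2inner U (wgrad U (fn (x t))) (wgrad U w)
       = L2inner U (\<lambda>s. fn (x t) s * \<bar>fn (x t) s\<bar> powr (p - 1) * ln \<bar>fn (x t) s\<bar>) w"
    if t: "0 < t" and w: "w \<in> H01 U" for t w
  proof
    note ww = H01_weak_gradient[OF w open_U]
    \<comment> \<open>The test function enters the subspace together with its chosen gradient;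
      integrals against w and \<open>fn \<omega>\<close> agree because the functions agree almost
      everywhere on U.\<close>
    define \<omega> where "\<omega> = h1pair U w (wgrad U w)"
    have \<omega>: "\<omega> \<in> HS" unfolding \<omega>_def by (rule h1pair_H01_mem[OF open_U w])
    have "AE s in lebesgue. rep_L2 \<omega> s = (if s \<in> U then (w s, wgrad U w s) else 0)"
      unfolding \<omega>_def h1pair_def by (intro rep_abs_L2 h1pair_square_integrable Us ww)
    then have fw: "AE s in lebesgue_on U. fn \<omega> s = w s"
      by (subst AE_restrict_space_iff) (auto elim: eventually_mono)
    have t0: "0 \<le> t" using t by simp
    note xt = xH[OF t0] and yt = yH[OF t0]
    have nm: "(\<lambda>s. nonlin p (fn (x t) s)) \<in> borel_measurable (lebesgue_on U)"
      by (rule compose_measurable[OF fnL nonlin_measurable])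
    have wm: "w \<in> borel_measurable (lebesgue_on U)" using ww(1) by (simp add: Lspace_2_iff)
    have ae: "AE s in lebesgue_on U. nonlin p (fn (x t) s) * fn \<omega> s = nonlin p (fn (x t) s) * w s"
      using fw by eventually_elim simp
    have "integrable (lebesgue_on U) (\<lambda>s. nonlin p (fn (x t) s) * w s)"
      by (rule integrable_cong_AE_imp[OF eq(1)[OF t \<omega>] borel_measurable_times[OF nm wm] ae])
    then show "integrable (lebesgue_on U) (\<lambda>s. fn (x t) s * \<bar>fn (x t) s\<bar> powr (p - 1) * ln \<bar>fn (x t) s\<bar> * w s)"
      by (simp only: nonlin_def)
    have r: "(LINT s|lebesgue_on U. nonlin p (fn (x t) s) * fn \<omega> s) = (LINT s|lebesgue_on U. nonlin p (fn (x t) s) * w s)"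
      by (rule integral_cong_AE[OF borel_measurable_times[OF nm fn_measurable] borel_measurable_times[OF nm wm] ae])
    have q: "(LINT s|lebesgue_on U. fn (x t) s * fn \<omega> s) = L2inner U (fn (x t)) w"
      unfolding L2inner_def inner_real_def
      by (rule integral_cong_AE[OF borel_measurable_times[OF fn_measurable fn_measurable] borel_measurable_times[OF fn_measurable wm]])
         (use fw in \<open>eventually_elim, simp\<close>)
    have ip: "z \<bullet> \<omega> = L2inner U (fn z) w + L2inner U (wgrad U (fn z)) (wgrad U w)" if z: "z \<in> HS" for z
      using h1pair_inner[OF Us fnL HS_facts(2)[OF z] ww(1,3), of z] by (simp add: HS_facts(3)[OF z] \<omega>_def)
    show "L2inner U (fn (y t)) w + L2inner U (wgrad U (fn (y t))) (wgrad U w)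
         + L2inner U (wgrad U (fn (x t))) (wgrad U w)
       = L2inner U (\<lambda>s. fn (x t) s * \<bar>fn (x t) s\<bar> powr (p - 1) * ln \<bar>fn (x t) s\<bar>) w"
      using eq(2)[OF t \<omega>] unfolding r q ip[OF xt] ip[OF yt]
      by (simp add: L2inner_def nonlin_def)
  qed
  have "weak_solution U p v0 \<infinity> (\<lambda>t. fn (x t)) (\<lambda>t. fn (y t))"
    unfolding weak_solution_def S
    using Lx L2y wtd cont init equation xH yH by (auto simp: HS_facts(1))
  then show ?thesis using Lx Ly by (simp add: global_weak_solution_def)
qed

lemma zero_solution:
  assumes v0: "AE t in lebesgue_on U. v0 t = 0"
  shows "\<exists>v vt. global_weak_solution U p v0 v vt \<and> Linf_time (H01 U) (H1norm U) {0<..} v \<and>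
    Linf_time (Lspace U 2) (Lnorm U 2) {0<..} vt"
proof -
  have z: "AE s in lebesgue_on U. nonlin p (fn 0 s) * fn w s = 0" "AE s in lebesgue_on U. fn 0 s * fn w s = 0" for w
    using fn_zero by (eventually_elim, simp)+
  have m: "(\<lambda>s. nonlin p (fn 0 s) * fn w s) \<in> borel_measurable (lebesgue_on U)" for w
    by (intro borel_measurable_times compose_measurable[OF fnL nonlin_measurable] fn_measurable)
  have "global_weak_solution U p v0 (\<lambda>t. fn 0) (\<lambda>t. fn 0) \<and>
    Linf_time (H01 U) (H1norm U) {0<..} (\<lambda>t. fn 0) \<and> Linf_time (Lspace U 2) (Lnorm U 2) {0<..} (\<lambda>t. fn 0)"
  proof (rule path_global_weak_solution[where M = 0 and M' = 0 and C = 0])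
    show "AE t in lebesgue_on U. fn 0 t = v0 t" using fn_zero v0 by eventually_elim simp
    show "integrable (lebesgue_on U) (\<lambda>s. nonlin p (fn 0 s) * fn w s)" for w
    proof (rule integrable_cong_AE_imp[OF _ m])
      show "integrable (lebesgue_on U) (\<lambda>s. 0 :: real)" by simp
      show "AE s in lebesgue_on U. 0 = nonlin p (fn 0 s) * fn w s" using z(1)[of w] by eventually_elim simp
    qed
    show "0 \<bullet> w + 0 \<bullet> w - (LINT s|lebesgue_on U. fn 0 s * fn w s) = (LINT s|lebesgue_on U. nonlin p (fn 0 s) * fn w s)"
      for w :: "('a, real \<times> 'a) L2"
      by (simp add: integral_eq_zero_AE[OF z(1)] integral_eq_zero_AE[OF z(2)])
  qed (simp_all add: zero_HS)
  then show ?thesis by blast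
qed

end

section \<open>The hypotheses of the abstract flow\<close>

context deep_well
begin

text \<open>Identifies the abstract functionals with the concrete ones: G x \<bullet> x is the
  Nehari functional and J x the energy of \<open>fn x\<close>. Since every element of the subspace
  has finite energy, the value -\<infinity> does not occur.\<close>

lemma HS_energy:
  assumes x: "x \<in> HS"
  shows "finite_energy U p (fn x)"
    and "G x \<bullet> x = (Lnorm U 2 (wgrad U (fn x)))\<^sup>2 - (LINT t|lebesgue_on U. energy_density (fn x) t)"
    and "J x = 1 / 2 * (Lnorm U 2 (wgrad U (fn x)))\<^sup>2 - 1 / (1 + p) * (LINT t|lebesgue_on U. energy_density (fn x) t)
      + 1 / (1 + p)\<^sup>2 * (LINT t|lebesgue_on U. \<bar>fn x t\<bar> powr (1 + p))"
proof -
  note y = young_bound(1)[OF x order_refl]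
  show fe: "finite_energy U p (fn x)" by (rule finite_energy_if_young_integrable[OF fnL y])
  have n: "(norm x)\<^sup>2 = (LINT t|lebesgue_on U. (fn x t)\<^sup>2) + (Lnorm U 2 (wgrad U (fn x)))\<^sup>2"
    using h1pair_norm_sq[OF Us fnL HS_facts(2)[OF x], of x] by (simp add: HS_facts(3)[OF x] Lnorm_2_sq)
  have nl: "nonlin p s * s = \<bar>s\<bar> powr (1 + p) * ln \<bar>s\<bar>" for s :: real
  proof (cases "s = 0")
    case False
    have "\<bar>s\<bar> powr (1 + p) = \<bar>s\<bar> powr (2 + (p - 1))" by (simp add: add.commute)
    also have "\<dots> = s\<^sup>2 * \<bar>s\<bar> powr (p - 1)" using False by (subst powr_add) simp
    finally show ?thesis by (simp add: nonlin_def power2_eq_square)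
  qed simp
  show "G x \<bullet> x = (Lnorm U 2 (wgrad U (fn x)))\<^sup>2 - (LINT t|lebesgue_on U. energy_density (fn x) t)"
    unfolding G_inner[OF x x] nl using n by (simp add: power2_norm_eq_inner[symmetric] power2_eq_square[of "fn x _"])
  have A: "integrable (lebesgue_on U) (energy_density (fn x))" using fe by (simp add: finite_energy_def)
  note B = abs_powr_integrable(1)[OF fnL y]
  have "(LINT t|lebesgue_on U. nonlin_prim p (fn x t)) =
      (LINT t|lebesgue_on U. energy_density (fn x) t) / (1 + p) - (LINT t|lebesgue_on U. \<bar>fn x t\<bar> powr (1 + p)) / (1 + p)\<^sup>2"
    unfolding nonlin_prim_def using A B
    by (subst Bochner_Integration.integral_diff) (auto intro: integrable_divide_zero)
  then show "J x = 1 / 2 * (Lnorm U 2 (wgrad U (fn x)))\<^sup>2 - 1 / (1 + p) * (LINT t|lebesgue_on U. energy_density (fn x) t)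
      + 1 / (1 + p)\<^sup>2 * (LINT t|lebesgue_on U. \<bar>fn x t\<bar> powr (1 + p))"
    unfolding J_def Pr(3)[OF x] using n by simp
qed

lemma HS_eq_zero:
  assumes x: "x \<in> HS" and "AE t in lebesgue. t \<in> U \<longrightarrow> fn x t = 0"
  shows "x = 0"
proof -
  have z: "is_weak_gradient U (\<lambda>x. 0 :: real) (\<lambda>x. 0)"
    by (simp add: is_weak_gradient_def locally_integrable_def)
  have "AE t in lebesgue. t \<in> U \<longrightarrow> gr x t = 0"
    by (rule is_weak_gradient_unique[OF open_U closure_test_space(2)[OF open_U x] z assms(2)])
  then have "AE t in lebesgue_on U. (norm (gr x t))\<^sup>2 = 0"
    by (subst AE_restrict_space_iff) (auto elim: eventually_mono)
  then have "(LINT t|lebesgue_on U. (norm (gr x t))\<^sup>2) = 0" by (rule integral_eq_zero_AE)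
  moreover have "AE t in lebesgue_on U. (fn x t)\<^sup>2 = 0"
    using assms(2) by (subst AE_restrict_space_iff) (auto elim: eventually_mono)
  then have "(LINT t|lebesgue_on U. (fn x t)\<^sup>2) = 0" by (rule integral_eq_zero_AE)
  ultimately have "(norm x)\<^sup>2 = 0" using norm_sq_HS[OF x] by (simp add: Lnorm_2_sq)
  then show ?thesis by simp
qed

lemma abs_powr_integral_pos:
  assumes x: "x \<in> HS" and "x \<noteq> 0"
  shows "0 < (LINT t|lebesgue_on U. \<bar>fn x t\<bar> powr (1 + p))"
proof (rule ccontr)
  assume "\<not> ?thesis"
  moreover have "0 \<le> (LINT t|lebesgue_on U. \<bar>fn x t\<bar> powr (1 + p))" by simp
  ultimately have "(LINT t|lebesgue_on U. \<bar>fn x t\<bar> powr (1 + p)) = 0" by linarith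
  then have "AE t in lebesgue_on U. \<bar>fn x t\<bar> powr (1 + p) = 0"
    by (subst (asm) integral_nonneg_eq_0_iff_AE[OF abs_powr_integrable(1)[OF fnL young_bound(1)[OF x order_refl]]]) auto
  then have "AE t in lebesgue. t \<in> U \<longrightarrow> fn x t = 0"
    by (subst (asm) AE_restrict_space_iff) auto
  then show False using HS_eq_zero[OF x] assms(2) by blast
qed

text \<open>With D the Dirichlet term, A the logarithmic integral and B that of |u|^(p + 1), I (l u)
  / l^2 = D - l^(p - 1) A - l^(p - 1) B ln l. From A \<le> D and l^(p - 1) \<le> 1 the first
  difference is nonnegative, and ln l < 0 < B makes the last contribution strictly positive.\<close>

lemma well_ray:
  assumes x: "x \<in> HS" "x \<noteq> 0" "0 \<le> G x \<bullet> x" and l: "0 < l" "l < 1"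
  shows "0 < G (l *\<^sub>R x) \<bullet> x"
proof -
  let ?A = "LINT t|lebesgue_on U. energy_density (fn x) t" and ?B = "LINT t|lebesgue_on U. \<bar>fn x t\<bar> powr (1 + p)"
  let ?D = "(Lnorm U 2 (wgrad U (fn x)))\<^sup>2"
  have lx: "l *\<^sub>R x \<in> HS" using x by (intro subspace_scale subspace_HS)
  have "(norm x)\<^sup>2 = (LINT t|lebesgue_on U. (fn x t)\<^sup>2) + ?D"
    using h1pair_norm_sq[OF Us fnL HS_facts(2)[OF x(1)], of x] by (simp add: HS_facts(3)[OF x(1)] Lnorm_2_sq)
  note e = HS_energy[OF x(1)]
  have E: "(LINT t|lebesgue_on U. energy_density (fn (l *\<^sub>R x)) t) = l powr (1 + p) * (?A + ln l * ?B)"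
  proof -
    have "(LINT t|lebesgue_on U. energy_density (fn (l *\<^sub>R x)) t) = (LINT t|lebesgue_on U. energy_density (\<lambda>t. l * fn x t) t)"
    proof (rule integral_cong_AE)
      show "energy_density (fn (l *\<^sub>R x)) \<in> borel_measurable (lebesgue_on U)"
        by (rule compose_measurable[OF fnL energy_density_measurable])
      show "energy_density (\<lambda>t. l * fn x t) \<in> borel_measurable (lebesgue_on U)"
        using energy_scale(1)[OF fnL e(1) l(1)] unfolding finite_energy_def by (rule borel_measurable_integrable)
      show "AE t in lebesgue_on U. energy_density (fn (l *\<^sub>R x)) t = energy_density (\<lambda>t. l * fn x t) t"
        using fn_scaleR[of l x] by eventually_elim (simp only:)
    qed
    then show ?thesis using energy_scale(2)[OF fnL e(1) l(1)] by simp
  qed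
  have D: "(Lnorm U 2 (wgrad U (fn (l *\<^sub>R x))))\<^sup>2 = l\<^sup>2 * ?D"
  proof -
    have "(norm (l *\<^sub>R x))\<^sup>2 = (LINT t|lebesgue_on U. (fn (l *\<^sub>R x) t)\<^sup>2) + (Lnorm U 2 (wgrad U (fn (l *\<^sub>R x))))\<^sup>2"
      using h1pair_norm_sq[OF Us fnL HS_facts(2)[OF lx], of "l *\<^sub>R x"] by (simp only: HS_facts(3)[OF lx]) (simp add: Lnorm_2_sq)
    moreover have "(LINT t|lebesgue_on U. (fn (l *\<^sub>R x) t)\<^sup>2) = (LINT t|lebesgue_on U. l\<^sup>2 * (fn x t)\<^sup>2)"
      by (intro integral_cong_AE borel_measurable_power borel_measurable_times borel_measurable_const fn_measurable)
         (use fn_scaleR[of l x] in \<open>eventually_elim, simp add: power_mult_distrib\<close>)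
    moreover have "(norm (l *\<^sub>R x))\<^sup>2 = l\<^sup>2 * (norm x)\<^sup>2" by (simp add: power_mult_distrib)
    ultimately show ?thesis using \<open>(norm x)\<^sup>2 = _\<close> by (simp add: distrib_left)
  qed
  have l2: "l powr (1 + p) = l\<^sup>2 * l powr (p - 1)"
  proof -
    have "l powr (1 + p) = l powr (2 + (p - 1))" by (simp add: add.commute)
    also have "\<dots> = l\<^sup>2 * l powr (p - 1)" using l by (subst powr_add) simp
    finally show ?thesis .
  qed
  have "l * (G (l *\<^sub>R x) \<bullet> x) = G (l *\<^sub>R x) \<bullet> (l *\<^sub>R x)" by simp
  also have "\<dots> = l\<^sup>2 * (?D - l powr (p - 1) * ?A - l powr (p - 1) * (ln l * ?B))"
    unfolding HS_energy(2)[OF lx] E D l2 by (simp add: algebra_simps)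
  also have "0 < \<dots>"
  proof -
    have lp: "0 < l powr (p - 1)" "l powr (p - 1) \<le> 1" using l p by (auto intro: powr_le1)
    have "0 \<le> ?D - l powr (p - 1) * ?A"
    proof (cases "0 \<le> ?A")
      case True
      then have "l powr (p - 1) * ?A \<le> 1 * ?A" using lp by (intro mult_right_mono) auto
      then show ?thesis using x(3) e(2) by linarith
    next
      case False
      then have "l powr (p - 1) * ?A \<le> 0" using lp by (intro mult_nonneg_nonpos) auto
      then show ?thesis using zero_le_power2[of "Lnorm U 2 (wgrad U (fn x))"] by linarith
    qed
    moreover have "l powr (p - 1) * (ln l * ?B) < 0"
      using lp abs_powr_integral_pos[OF x(1,2)] l by (intro mult_pos_neg mult_neg_pos) auto
    ultimately show ?thesis using l by (intro mult_pos_pos) auto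
  qed
  finally show ?thesis using l by (simp add: zero_less_mult_iff)
qed

text \<open>From the identity J = I / (1 + p) + (1/2 - 1 / (1 + p)) D + B / (1 + p)^2, with D the
  Dirichlet term and B the integral of |u|^(p + 1); all terms are nonnegative as p > 1. The L2 norm
  is bounded through s^2 \<le> 1 + |s|^(p + 1) and the finite measure of U.\<close>

lemma coercive_bound:
  assumes x: "x \<in> HS" "0 \<le> G x \<bullet> x" "J x \<le> d"
  shows "norm x \<le> sqrt (measure lebesgue U + (1 + p)\<^sup>2 * d + d / (1 / 2 - 1 / (1 + p)))"
proof (rule real_le_rsqrt)
  let ?A = "LINT t|lebesgue_on U. energy_density (fn x) t" and ?B = "LINT t|lebesgue_on U. \<bar>fn x t\<bar> powr (1 + p)"
  let ?D = "(Lnorm U 2 (wgrad U (fn x)))\<^sup>2"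
  define k where "k = 1 / 2 - 1 / (1 + p)"
  have k: "0 < k" using p by (simp add: k_def field_simps)
  have n: "(norm x)\<^sup>2 = (LINT t|lebesgue_on U. (fn x t)\<^sup>2) + ?D"
    using h1pair_norm_sq[OF Us fnL HS_facts(2)[OF x(1)], of x] by (simp add: HS_facts(3)[OF x(1)] Lnorm_2_sq)
  note e = HS_energy[OF x(1)]
  have B0: "0 \<le> ?B" by simp
  have "J x = 1 / (1 + p) * (G x \<bullet> x) + k * ?D + 1 / (1 + p)\<^sup>2 * ?B"
    unfolding e(2,3) k_def by (simp add: algebra_simps)
  moreover have "0 \<le> 1 / (1 + p) * (G x \<bullet> x)" using p x(2) by (intro mult_nonneg_nonneg) auto
  moreover have "0 \<le> k * ?D" "0 \<le> 1 / (1 + p)\<^sup>2 * ?B" using k B0 by simp_all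
  ultimately have kD: "k * ?D \<le> d" and BB: "1 / (1 + p)\<^sup>2 * ?B \<le> d" using x(3) by linarith+
  have "?D \<le> d / k" using kD k by (simp add: pos_le_divide_eq mult.commute)
  moreover have "?B \<le> (1 + p)\<^sup>2 * d"
    using BB p by (simp add: pos_divide_le_eq mult.commute)
  moreover have "(LINT t|lebesgue_on U. (fn x t)\<^sup>2) \<le> measure lebesgue U + ?B"
  proof -
    have U_lm: "U \<in> lmeasurable" using bounded_U Us by (rule bounded_set_imp_lmeasurable)
    have ind: "(\<lambda>x. if x \<in> U then 1 else 0) = indicat_real U" by (auto simp: indicator_def)
    have one: "integrable (lebesgue_on U) (\<lambda>t. 1 :: real)" "(LINT t|lebesgue_on U. 1) = measure lebesgue U"
      using Lebesgue_Measure.integrable_restrict_UNIV[OF Us, of "\<lambda>t. 1 :: real"]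
        Lebesgue_Measure.integral_restrict_UNIV[OF Us, of "\<lambda>t. 1 :: real"]
        U_lm by (simp_all add: lmeasurable_iff_integrable ind)
    note Bi = abs_powr_integrable(1)[OF fnL young_bound(1)[OF x(1) order_refl]]
    have pt: "s\<^sup>2 \<le> 1 + \<bar>s\<bar> powr (1 + p)" for s :: real
    proof (cases "\<bar>s\<bar> \<le> 1")
      case True
      then have "s\<^sup>2 \<le> 1" by (simp add: abs_square_le_1)
      moreover have "0 \<le> \<bar>s\<bar> powr (1 + p)" by simp
      ultimately show ?thesis by linarith
    next
      case False
      then have "\<bar>s\<bar> powr 2 \<le> \<bar>s\<bar> powr (1 + p)" using p by (intro powr_mono) auto
      moreover have "\<bar>s\<bar> powr 2 = s\<^sup>2" using False by simp
      ultimately show ?thesis by linarith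
    qed
    have "(LINT t|lebesgue_on U. (fn x t)\<^sup>2) \<le> (LINT t|lebesgue_on U. 1 + \<bar>fn x t\<bar> powr (1 + p))"
      by (rule integral_mono[OF fn_sq_integrable Bochner_Integration.integrable_add[OF one(1) Bi]]) (rule pt)
    also have "\<dots> = measure lebesgue U + ?B"
      using Bochner_Integration.integral_add[OF one(1) Bi] one(2) by simp
    finally show ?thesis .
  qed
  ultimately show "(norm x)\<^sup>2 \<le> measure lebesgue U + (1 + p)\<^sup>2 * d + d / (1 / 2 - 1 / (1 + p))"
    using n unfolding k_def by linarith
qed

lemma solution_exists:
  assumes v0: "v0 \<in> H01 U" and I: "0 \<le> I_fun U p v0" and Jd: "J_fun U p v0 \<le> ereal d"
  shows "\<exists>v vt. global_weak_solution U p v0 v vt \<and> Linf_time (H01 U) (H1norm U) {0<..} v \<and>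
    Linf_time (Lspace U 2) (Lnorm U 2) {0<..} vt"
proof -
  note vw = H01_weak_gradient[OF v0 open_U]
  define x0 where "x0 = h1pair U v0 (wgrad U v0)"
  have x0: "x0 \<in> HS" unfolding x0_def by (rule h1pair_H01_mem[OF open_U v0])
  have "AE s in lebesgue. rep_L2 x0 s = (if s \<in> U then (v0 s, wgrad U v0 s) else 0)"
    unfolding x0_def h1pair_def by (intro rep_abs_L2 h1pair_square_integrable Us vw)
  then have f0: "AE s in lebesgue_on U. fn x0 s = v0 s"
    by (subst AE_restrict_space_iff) (auto elim: eventually_mono)
  \<comment> \<open>The sign of \<open>I\<close> excludes its value -\<infinity>.\<close>
  have fe: "finite_energy U p v0" using I by (auto simp: I_fun_def split: if_splits)
  note e = HS_energy[OF x0]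
  have m0: "v0 \<in> borel_measurable (lebesgue_on U)" using vw(1) by (simp add: Lspace_2_iff)
  have A: "(LINT t|lebesgue_on U. energy_density (fn x0) t) = (LINT t|lebesgue_on U. energy_density v0 t)"
    by (rule integral_cong_AE[OF compose_measurable[OF fnL energy_density_measurable] compose_measurable[OF vw(1) energy_density_measurable]])
       (use f0 in \<open>eventually_elim, simp only:\<close>)
  have B: "(LINT t|lebesgue_on U. \<bar>fn x0 t\<bar> powr (1 + p)) = (LINT t|lebesgue_on U. \<bar>v0 t\<bar> powr (1 + p))"
    by (rule integral_cong_AE[OF compose_measurable[OF fnL abs_powr_measurable] compose_measurable[OF vw(1) abs_powr_measurable]])
       (use f0 in \<open>eventually_elim, simp only:\<close>)
  have Q: "(LINT t|lebesgue_on U. (fn x0 t)\<^sup>2) = (LINT t|lebesgue_on U. (v0 t)\<^sup>2)"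
    by (intro integral_cong_AE borel_measurable_power fn_measurable m0) (use f0 in \<open>eventually_elim, simp only:\<close>)
  have D: "(Lnorm U 2 (wgrad U (fn x0)))\<^sup>2 = (Lnorm U 2 (wgrad U v0))\<^sup>2"
    using h1pair_norm_sq[OF Us fnL HS_facts(2)[OF x0], of x0] h1pair_norm_sq[OF Us vw(1,3)] Q
    by (simp add: HS_facts(3)[OF x0] x0_def[symmetric] Lnorm_2_sq)
  have I0: "0 \<le> G x0 \<bullet> x0" using I unfolding I_fun_eq[OF fe] e(2) A D by simp
  have J0: "J x0 \<le> d" using Jd unfolding J_fun_eq[OF fe] e(3) A B D by simp
  define M where "M = sqrt (measure lebesgue U + (1 + p)\<^sup>2 * d + d / (1 / 2 - 1 / (1 + p)))"
  have HSP: "x \<in> HS" if "Pr x = x" for x using Pr(2)[of x] that by simp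
  have Jzero: "J 0 < d"
  proof -
    have "J 0 = - (LINT t|lebesgue_on U. nonlin_prim p (fn 0 t)) - 1 / 2 * (LINT t|lebesgue_on U. (fn 0 t)\<^sup>2)"
      unfolding J_def Pr(3)[OF zero_HS] by simp
    moreover have "(LINT t|lebesgue_on U. nonlin_prim p (fn 0 t)) = 0"
      by (rule integral_eq_zero_AE) (use fn_zero in \<open>eventually_elim, simp\<close>)
    moreover have "(LINT t|lebesgue_on U. (fn 0 t)\<^sup>2) = 0"
      by (rule integral_eq_zero_AE) (use fn_zero in \<open>eventually_elim, simp\<close>)
    ultimately show ?thesis using d by simp
  qed
  have "\<exists>x. x 0 = x0 \<and> (\<forall>t\<ge>0. Pr (x t) = x t) \<and> (\<forall>t\<ge>0. norm (x t) \<le> M) \<and> (\<forall>t\<ge>0. 0 \<le> G (x t) \<bullet> x t) \<and>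
      (\<forall>t\<ge>0. (x has_vector_derivative - G (x t)) (at t within {0..})) \<and>
      (\<forall>T\<ge>0. ((\<lambda>t. (norm (G (x t)))\<^sup>2) has_integral J x0 - J (x T)) {0..T})"
  proof (rule potential_well_gradient_flow[where P = Pr and G = G and J = J and d = d and M = M and \<delta> = small_radius and ?x0.0 = x0])
    show "bounded_linear Pr" by (rule Pr(1))
    show "Pr (G x) = G x" for x by (rule Pr_G)
    show "\<exists>L. L-lipschitz_on (cball 0 R) G" for R by (rule G_lipschitz)
    show "(J has_derivative (\<bullet>) (G x)) (at x)" for x by (rule J_has_derivative)
    show "0 < small_radius" by (rule small_radius_pos)
    show "0 \<le> G x \<bullet> x" if "Pr x = x" "norm x \<le> small_radius" for x
    proof -
      note xH = HSP[OF that(1)]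
      show ?thesis
        using I_nonneg_small[OF HS_facts(1)[OF xH] HS_energy(1)[OF xH]] that(2)
        by (simp add: HS_facts(4)[OF xH] HS_energy(2)[OF xH])
    qed
    show "0 < G (l *\<^sub>R x) \<bullet> x" if "Pr x = x" "x \<noteq> 0" "0 \<le> G x \<bullet> x" "0 < l" "l < 1" for x l
      by (rule well_ray[OF HSP[OF that(1)] that(2-5)])
    show "norm x \<le> M" if "Pr x = x" "0 \<le> G x \<bullet> x" "J x \<le> d" for x
      unfolding M_def by (rule coercive_bound[OF HSP[OF that(1)] that(2,3)])
    \<comment> \<open>A nonzero element has a nonzero gradient by the Poincare inequality, so it is
      a genuine member of the Nehari manifold.\<close>
    show "d \<le> J x" if x: "Pr x = x" "x \<noteq> 0" "G x \<bullet> x = 0" for x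
    proof -
      note xH = HSP[OF x(1)] and e = HS_energy[OF HSP[OF x(1)]]
      have "Lnorm U 2 (wgrad U (fn x)) \<noteq> 0"
        using H01_zero_if_gradient_zero[OF open_U bounded_U HS_facts(1)[OF xH]] HS_eq_zero[OF xH] x(2) by blast
      then have "fn x \<in> nehari U p"
        using HS_facts(1)[OF xH] e(2) x(3) by (simp add: nehari_def I_fun_eq[OF e(1)] zero_ereal_def)
      then show ?thesis using depth J_fun_eq[OF e(1)] e(3) by fastforce
    qed
    show "J 0 < d" by (rule Jzero)
    show "Pr x0 = x0" by (rule Pr(3)[OF x0])
    show "0 \<le> G x0 \<bullet> x0" "J x0 \<le> d" by (rule I0, rule J0)
  qed blast
  then obtain x where x: "x 0 = x0" "\<And>t. 0 \<le> t \<Longrightarrow> Pr (x t) = x t" "\<And>t. 0 \<le> t \<Longrightarrow> norm (x t) \<le> M"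
    "\<And>t. 0 \<le> t \<Longrightarrow> 0 \<le> G (x t) \<bullet> x t"
    "\<And>t. 0 \<le> t \<Longrightarrow> (x has_vector_derivative - G (x t)) (at t within {0..})"
    "\<And>T. 0 \<le> T \<Longrightarrow> ((\<lambda>t. (norm (G (x t)))\<^sup>2) has_integral J x0 - J (x T)) {0..T}"
    by blast
  have xH: "x t \<in> HS" if "0 \<le> t" for t by (rule HSP[OF x(2)[OF that]])
  have GH: "G z \<in> HS" for z using Pr(2)[of "G z"] by (simp add: Pr_G)
  have xcont: "continuous_on {0..} x"
    using x(5) has_vector_derivative_continuous unfolding continuous_on_eq_continuous_within by blast
  obtain L where L: "L-lipschitz_on (cball 0 M) G" using G_lipschitz by blast
  have Gx: "continuous_on {0..} (\<lambda>t. G (x t))"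
    by (rule continuous_on_compose2[OF lipschitz_on_continuous_on[OF L] xcont]) (use x(3) in auto)
  have "global_weak_solution U p v0 (\<lambda>t. fn (x t)) (\<lambda>t. fn (- G (x t))) \<and>
    Linf_time (H01 U) (H1norm U) {0<..} (\<lambda>t. fn (x t)) \<and>
    Linf_time (Lspace U 2) (Lnorm U 2) {0<..} (\<lambda>t. fn (- G (x t)))"
  proof (rule path_global_weak_solution[where M = M and M' = "norm (G 0) + L * M" and C = d])
    show "AE t in lebesgue_on U. fn (x 0) t = v0 t" using f0 by (simp add: x(1))
    show "x t \<in> HS" if "0 \<le> t" for t by (rule xH[OF that])
    show "- G (x t) \<in> HS" for t using GH by (intro subspace_neg subspace_HS)
    show "(x has_vector_derivative - G (x t)) (at t within {0..})" if "0 \<le> t" for t by (rule x(5)[OF that])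
    show "continuous_on {0..} (\<lambda>t. - G (x t))" by (intro continuous_on_minus Gx)
    show "norm (x t) \<le> M" if "0 \<le> t" for t by (rule x(3)[OF that])
    \<comment> \<open>The trajectory stays in the ball of radius M, where the Lipschitz constant L
      controls G from its value at 0; this bounds the time derivative even in the H1 norm.\<close>
    show "norm (- G (x t)) \<le> norm (G 0) + L * M" if t: "0 \<le> t" for t
    proof -
      have "0 \<le> M" using x(3)[OF t] norm_ge_zero order_trans by blast
      then have "norm (G (x t) - G 0) \<le> L * norm (x t)"
        using lipschitz_onD[OF L, of "x t" 0] x(3)[OF t] by (simp add: dist_norm)
      also have "\<dots> \<le> L * M" using x(3)[OF t] lipschitz_on_nonneg[OF L] by (rule mult_left_mono)
      finally show ?thesis using norm_triangle_sub[of "G (x t)" "G 0"] by simp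
    qed
    \<comment> \<open>The dissipated energy is J x0 - J (x T). Since the Nehari functional is
      nonnegative along the trajectory, so is J, and the dissipation never exceeds J x0 \<le>
      d.\<close>
    show "integral {0..T} (\<lambda>t. (norm (- G (x t)))\<^sup>2) \<le> d" if T: "0 \<le> T" for T
    proof -
      have "0 \<le> J (x T)"
      proof -
        note e = HS_energy[OF xH[OF T]]
        let ?B = "LINT t|lebesgue_on U. \<bar>fn (x T) t\<bar> powr (1 + p)" and ?D = "(Lnorm U 2 (wgrad U (fn (x T))))\<^sup>2"
        have "J (x T) = 1 / (1 + p) * (G (x T) \<bullet> x T) + (1 / 2 - 1 / (1 + p)) * ?D + 1 / (1 + p)\<^sup>2 * ?B"
          unfolding e(2,3) by (simp add: algebra_simps)
        moreover have "0 \<le> 1 / (1 + p) * (G (x T) \<bullet> x T)" using p x(4)[OF T] by (intro mult_nonneg_nonneg) auto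
        moreover have "0 \<le> (1 / 2 - 1 / (1 + p)) * ?D" using p by (intro mult_nonneg_nonneg) (auto simp: field_simps)
        moreover have "0 \<le> 1 / (1 + p)\<^sup>2 * ?B" by (intro mult_nonneg_nonneg) auto
        ultimately show ?thesis by linarith
      qed
      then show ?thesis using integral_unique[OF x(6)[OF T]] J0 by simp
    qed
    show "integrable (lebesgue_on U) (\<lambda>s. nonlin p (fn (x t) s) * fn w s)" if "0 < t" "w \<in> HS" for t w
      by (rule nonlin_integrable(1)[OF xH that(2)]) (use that in simp)
    show "- G (x t) \<bullet> w + x t \<bullet> w - (LINT s|lebesgue_on U. fn (x t) s * fn w s)
        = (LINT s|lebesgue_on U. nonlin p (fn (x t) s) * fn w s)" if "0 < t" "w \<in> HS" for t w
      using G_inner[OF xH that(2), of t] that(1) by simp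
  qed
  then show ?thesis by blast
qed

end

theorem theorem3p1:
  fixes U :: "(real ^ 'n) set" and p :: real and v0 :: "real ^ 'n \<Rightarrow> real"
  assumes "p > 1"
    and "smooth_bounded_domain U"
    and "v0 \<in> H01 U"
    and "I_fun U p v0 \<ge> 0"
    and "J_fun U p v0 \<le> well_depth U p"
  shows "\<exists>v vt. global_weak_solution U p v0 v vt \<and>
           Linf_time (H01 U) (H1norm U) {0<..} v \<and>
           Linf_time (Lspace U 2) (Lnorm U 2) {0<..} vt"
proof -
  interpret well_problem U p
    using assms(1,2) by unfold_locales (auto simp: smooth_bounded_domain_def)
  have fe: "finite_energy U p v0" using assms(4) by (auto simp: I_fun_def split: if_splits)
  note vw = H01_weak_gradient[OF assms(3) open_U]
  show ?thesis
  proof (cases "0 < well_depth U p")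
    case True
    \<comment> \<open>If the depth is \<infinity>, any positive real that is at least the initial
      energy serves as level; the maximum with 1 provides one.\<close>
    obtain d where pos: "0 < d" and le: "ereal d \<le> well_depth U p" "J_fun U p v0 \<le> ereal d"
    proof (cases "well_depth U p")
      case (real r)
      then show ?thesis using True assms(5) that[of r] by simp
    next
      case PInf
      obtain j where j: "J_fun U p v0 = ereal j" using J_fun_eq[OF fe] by blast
      show ?thesis using that[of "max 1 j"] PInf j by simp
    next
      case MInf
      then show ?thesis using True by simp
    qed
    interpret deep_well U p d
    proof
      show "ereal d \<le> J_fun U p u" if "u \<in> nehari U p" for u
        using le(1) INF_lower[OF that, of "J_fun U p"] unfolding well_depth_def by (rule order_trans)
    qed (rule pos)
    show ?thesis by (rule solution_exists[OF assms(3,4) le(2)])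
  next
    case False
    let ?A = "LINT t|lebesgue_on U. energy_density v0 t" and ?B = "LINT t|lebesgue_on U. \<bar>v0 t\<bar> powr (1 + p)"
    let ?D = "(Lnorm U 2 (wgrad U v0))\<^sup>2"
    have I: "?A \<le> ?D" using assms(4) unfolding I_fun_eq[OF fe] by simp
    have "J_fun U p v0 \<le> 0" using assms(5) False by simp
    then have J: "1 / 2 * ?D - 1 / (1 + p) * ?A + 1 / (1 + p)\<^sup>2 * ?B \<le> 0"
      unfolding J_fun_eq[OF fe] by (simp add: zero_ereal_def)
    \<comment> \<open>Since A \<le> D and p > 1, the first two terms of the energy have nonnegative
      sum, so the integral of |v0|^(p + 1) cannot be positive.\<close>
    have "1 / (1 + p) * ?A \<le> 1 / (1 + p) * ?D" using I p by (intro mult_left_mono) auto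
    moreover have "1 / (1 + p) * ?D \<le> 1 / 2 * ?D" using p by (intro mult_right_mono) (auto simp: field_simps)
    ultimately have "1 / (1 + p)\<^sup>2 * ?B \<le> 0" using J by linarith
    then have "?B \<le> 0" using p by (simp add: divide_le_0_iff)
    moreover have "0 \<le> ?B" by simp
    ultimately have "?B = 0" by linarith
    then have "AE t in lebesgue_on U. \<bar>v0 t\<bar> powr (1 + p) = 0"
      by (subst (asm) integral_nonneg_eq_0_iff_AE[OF abs_powr_integrable(1)[OF vw(1) young_integrable_if_finite_energy(1)[OF vw(1) fe]]]) auto
    then have "AE t in lebesgue_on U. v0 t = 0" by eventually_elim simp
    then show ?thesis by (rule zero_solution)
  qed
qed

end
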